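(* Let $(M,g)$ be a compact oriented two-dimensional Riemannian manifold, possibly with smooth boundary $\partial M$. Suppose that either $H^1_{dR}(M)=0$ or $M$ is diffeomorphic to $I\times S^1$, where $I=[-1,1]$ and $S^1$ is the circle. Then, for any Arnold stable stationary solution $u$ of the incompressible Euler equation on $M$ and any divergence-free vector field $Y$ on $M$ which is tangent to $\partial M$, $$MC_{u,Y}\le 0 .$$
   Context: All functions and vector fields are smooth. $H^1_{dR}(M)$ is the first de Rham cohomology (closed one-forms modulo exact one-forms). Let $\mu$ be the Riemannian volume form of $(M,g)$ and $\nabla$ the Levi-Civita connection. The Hodge star $\star$ acts on vector fields as rotation by $\frac{\pi}{2}$ in the tangent planes, so $\star^2=-1$ on vector fields. Put $\Delta:=\operatorname{div}\circ\operatorname{grad}$ (Laplace-Beltrami operator). If $\partial M=\emptyset$, all conditions on the boundary are void. Stationary solution: a vector field $u$ on $M$ is a stationary solution of the incompressible Euler equation if there is a function $p$ on $M$ with $\nabla_u u=-\operatorname{grad}p$ and $\operatorname{div}u=0$ on $M$, and $u$ is tangent to $\partial M$ (i.e. $g(u,\nu)=0$ on $\partial M$, with $\nu$ the unit normal). Stream function: a stream function of a divergence-free vector field $V$ tangent to $\partial M$ is a function $\psi$ on $M$ with $\star\operatorname{grad}\psi=V$. First eigenvalue: $\lambda_1$ is the first eigenvalue of $-\Delta$, on functions of zero mean if $\partial M=\emptyset$ and on functions vanishing on $\partial M$ (Dirichlet condition) if $\partial M\neq\emptyset$. That is, $\lambda_1$ is the largest constant such that $\int_M f\,\Delta f\,\mu\le-\lambda_1\int_M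 f^2\mu$ for all functions $f$ on $M$ with $\int_M f\mu=0$ (if $\partial M=\emptyset$), respectively $f|_{\partial M}=0$ (if $\partial M\ne\emptyset$). Arnold stability: let $u$ be a stationary solution having a stream function $\psi$, and set $\omega:=\Delta\psi$. Then $\operatorname{grad}\omega$ and $\operatorname{grad}\psi$ are collinear, and one writes $\omega=F(\psi)$ for a possibly multivalued function $F$ on $\mathbb{R}$; $F'(\psi)$ is the ratio $\operatorname{grad}\omega/\operatorname{grad}\psi$. The solution $u$ is called Arnold stable if either $-\lambda_1<F'(\psi)<0$ or $0<F'(\psi)<\infty$. Precisely: there is a function $c:M\to\mathbb{R}$ (this is $F'(\psi)$; no regularity of $c$ is required) with $\operatorname{grad}\omega=c\,\operatorname{grad}\psi$ on $M$, such that either $-\lambda_1<c(x)<0$ for all $x\in M$, or $0<c(x)<\infty$ for all $x\in M$. Misiołek curvature: for vector fields $V,W$ on $M$ put $\langle V,W\rangle:=\int_M g(V,W)\mu$ and $|V|^2:=\langle V,V\rangle$. For a stationary solution $u$ and a divergence-free vector field $Y$ tangent to $\partial M$, $$MC_{u,Y}:=-|[u,Y]|^2-\langle[[u,Y],Y],u\rangle,$$ where $[\cdot,\cdot]$ is the Lie bracket of vector fields. *)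

theory Defs
  imports "HOL-Analysis.Analysis"
begin

section \<open>Smoothness on relatively open subsets of a half plane\<close>

text \<open>
  Derivatives are taken within \<open>S\<close>, so that they are one-sided at boundary points. The sets
  \<open>S\<close> of interest are relatively open in the half plane below, where derivatives within \<open>S\<close>
  are unique.
\<close>

definition half_plane :: "(real^2) set" where
  "half_plane = {x. x $ 1 \<ge> 0}"

definition partial_within :: "(real^2) set \<Rightarrow> 2 \<Rightarrow> (real^2 \<Rightarrow> 'b::real_normed_vector) \<Rightarrow> real^2 \<Rightarrow> 'b" where
  "partial_within S i f x = frechet_derivative f (at x within S) (axis i 1)"

primrec C_k_on :: "nat \<Rightarrow> (real^2) set \<Rightarrow> (real^2 \<Rightarrow> 'b::real_normed_vector) \<Rightarrow> bool" where
  "C_k_on 0 S f \<longleftrightarrow> continuous_on S f"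
| "C_k_on (Suc k) S f \<longleftrightarrow> f differentiable_on S \<and> (\<forall>i. C_k_on k S (partial_within S i f))"

definition smooth_on :: "(real^2) set \<Rightarrow> (real^2 \<Rightarrow> 'b::real_normed_vector) \<Rightarrow> bool" where
  "smooth_on S f \<longleftrightarrow> (\<forall>k. C_k_on k S f)"


section \<open>Surfaces with boundary\<close>

text \<open>
  A chart is a pair of its domain and its coordinate map. The manifold is a subset \<open>M\<close> of a
  Hausdorff space, carrying the subspace topology; second countability is not required
  separately because only compact \<open>M\<close> are considered.
\<close>

type_synonym 'a chart = "'a set \<times> ('a \<Rightarrow> real^2)"

abbreviation cdom :: "'a chart \<Rightarrow> 'a set" where "cdom c \<equiv> fst c"
abbreviation cmap :: "'a chart \<Rightarrow> 'a \<Rightarrow> real^2" where "cmap c \<equiv> snd c"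
abbreviation cinv :: "'a chart \<Rightarrow> real^2 \<Rightarrow> 'a" where "cinv c \<equiv> inv_into (cdom c) (cmap c)"
abbreviation cimg :: "'a chart \<Rightarrow> (real^2) set" where "cimg c \<equiv> cmap c ` cdom c"

definition is_chart :: "'a::topological_space set \<Rightarrow> 'a chart \<Rightarrow> bool" where
  "is_chart M c \<longleftrightarrow>
     openin (top_of_set M) (cdom c) \<and> openin (top_of_set half_plane) (cimg c) \<and>
     homeomorphism (cdom c) (cimg c) (cmap c) (cinv c)"

definition smooth_atlas :: "'a::topological_space set \<Rightarrow> 'a chart set \<Rightarrow> bool" where
  "smooth_atlas M A \<longleftrightarrow>
     (\<forall>c\<in>A. is_chart M c) \<and> (\<Union>c\<in>A. cdom c) = M \<and>
     (\<forall>c\<in>A. \<forall>d\<in>A. smooth_on (cmap c ` (cdom c \<inter> cdom d)) (cmap d \<circ> cinv c))"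

text \<open>The Jacobian matrix at \<open>p\<close> of the change of coordinates from \<open>c\<close> to \<open>d\<close>.\<close>

definition jacobian :: "'a chart \<Rightarrow> 'a chart \<Rightarrow> 'a \<Rightarrow> real^2^2" where
  "jacobian c d p =
     matrix (frechet_derivative (cmap d \<circ> cinv c) (at (cmap c p) within cmap c ` (cdom c \<inter> cdom d)))"

definition oriented_atlas :: "'a::topological_space set \<Rightarrow> 'a chart set \<Rightarrow> bool" where
  "oriented_atlas M A \<longleftrightarrow>
     smooth_atlas M A \<and> (\<forall>c\<in>A. \<forall>d\<in>A. \<forall>p\<in>cdom c \<inter> cdom d. det (jacobian c d p) > 0)"

definition bdry :: "'a chart set \<Rightarrow> 'a set" where
  "bdry A = {p. \<exists>c\<in>A. p \<in> cdom c \<and> cmap c p $ 1 = 0}"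

definition smooth_fun :: "'a chart set \<Rightarrow> ('a \<Rightarrow> real) \<Rightarrow> bool" where
  "smooth_fun A f \<longleftrightarrow> (\<forall>c\<in>A. smooth_on (cimg c) (f \<circ> cinv c))"

definition cpartial :: "'a chart \<Rightarrow> 2 \<Rightarrow> ('a \<Rightarrow> real) \<Rightarrow> 'a \<Rightarrow> real" where
  "cpartial c i f p = partial_within (cimg c) i (f \<circ> cinv c) (cmap c p)"

definition smooth_map ::
  "'a::topological_space set \<Rightarrow> 'a chart set \<Rightarrow> 'b::topological_space set \<Rightarrow> 'b chart set \<Rightarrow> ('a \<Rightarrow> 'b) \<Rightarrow> bool"
  where
  "smooth_map M A N B F \<longleftrightarrow>
     continuous_on M F \<and> F ` M \<subseteq> N \<and>
     (\<forall>c\<in>A. \<forall>d\<in>B. smooth_on (cmap c ` (cdom c \<inter> F -` cdom d)) (cmap d \<circ> F \<circ> cinv c))"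

definition diffeomorphic ::
  "'a::topological_space set \<Rightarrow> 'a chart set \<Rightarrow> 'b::topological_space set \<Rightarrow> 'b chart set \<Rightarrow> bool" where
  "diffeomorphic M A N B \<longleftrightarrow>
     (\<exists>F G. homeomorphism M N F G \<and> smooth_map M A N B F \<and> smooth_map N B M A G)"

text \<open>
  \<open>[-1,1] \<times> S\<^sup>1\<close> with its product structure: the charts cover the part of the interval away from
  one end point \<open>s\<close> by the distance to the other end point, and the circle minus the point
  \<open>- cis a\<close> by the angle relative to \<open>cis a\<close>.
\<close>

definition annulus :: "(real \<times> complex) set" where
  "annulus = {-1..1} \<times> sphere 0 1"

definition annulus_atlas :: "(real \<times> complex) chart set" where
  "annulus_atlas =
     {({(t, z). (t, z) \<in> annulus \<and> t \<noteq> s \<and> z \<noteq> - cis a},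
       \<lambda>(t, z). vector [1 + s * t, Arg (z / cis a)]) | s a. s \<in> {-1, 1}}"


section \<open>Vector fields, one-forms and metrics\<close>

text \<open>
  A vector field \<open>V\<close> is given by its components: \<open>V c p\<close> is the coordinate vector of \<open>V\<close> at \<open>p\<close>
  in the chart \<open>c\<close>, and these transform by the Jacobian matrices. One-forms and
  metrics are encoded likewise. Values for charts outside the atlas or points outside
  \<open>cdom c\<close> are irrelevant.
\<close>

type_synonym 'a vec_field = "'a chart \<Rightarrow> 'a \<Rightarrow> real^2"
type_synonym 'a one_form = "'a chart \<Rightarrow> 'a \<Rightarrow> real^2"
type_synonym 'a metric = "'a chart \<Rightarrow> 'a \<Rightarrow> real^2^2"

definition vector_field :: "'a chart set \<Rightarrow> 'a vec_field \<Rightarrow> bool" where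
  "vector_field A V \<longleftrightarrow>
     (\<forall>c\<in>A. smooth_on (cimg c) (V c \<circ> cinv c)) \<and>
     (\<forall>c\<in>A. \<forall>d\<in>A. \<forall>p\<in>cdom c \<inter> cdom d. V d p = jacobian c d p *v V c p)"

text \<open>Charts map the boundary to the line \<open>x\<^sub>1 = 0\<close>, so its tangent vectors have first component 0.\<close>

definition tangent_to_bdry :: "'a chart set \<Rightarrow> 'a vec_field \<Rightarrow> bool" where
  "tangent_to_bdry A V \<longleftrightarrow> (\<forall>c\<in>A. \<forall>p\<in>cdom c. cmap c p $ 1 = 0 \<longrightarrow> V c p $ 1 = 0)"

definition lie_bracket :: "'a vec_field \<Rightarrow> 'a vec_field \<Rightarrow> 'a vec_field" where
  "lie_bracket V W c p =
     (\<chi> k. \<Sum>i\<in>UNIV. V c p $ i * cpartial c i (\<lambda>q. W c q $ k) p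
                    - W c p $ i * cpartial c i (\<lambda>q. V c q $ k) p)"

definition one_form :: "'a chart set \<Rightarrow> 'a one_form \<Rightarrow> bool" where
  "one_form A \<alpha> \<longleftrightarrow>
     (\<forall>c\<in>A. smooth_on (cimg c) (\<alpha> c \<circ> cinv c)) \<and>
     (\<forall>c\<in>A. \<forall>d\<in>A. \<forall>p\<in>cdom c \<inter> cdom d. \<alpha> c p = transpose (jacobian c d p) *v \<alpha> d p)"

definition closed_one_forms :: "'a chart set \<Rightarrow> 'a one_form set" where
  "closed_one_forms A =
     {\<alpha>. one_form A \<alpha> \<and>
         (\<forall>c\<in>A. \<forall>p\<in>cdom c. cpartial c 1 (\<lambda>q. \<alpha> c q $ 2) p = cpartial c 2 (\<lambda>q. \<alpha> c q $ 1) p)}"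

definition exact_one_forms :: "'a chart set \<Rightarrow> 'a one_form set" where
  "exact_one_forms A =
     {\<alpha>. one_form A \<alpha> \<and>
         (\<exists>f. smooth_fun A f \<and> (\<forall>c\<in>A. \<forall>p\<in>cdom c. \<alpha> c p = (\<chi> i. cpartial c i f p)))}"

text \<open>
  The zero class of the quotient is \<open>exact_one_forms A\<close>; the vanishing of the
  first cohomology thus reads \<open>H1_dR A = {exact_one_forms A}\<close>.
\<close>

definition H1_dR :: "'a chart set \<Rightarrow> 'a one_form set set" where
  "H1_dR A =
     closed_one_forms A //
       {(\<alpha>, \<beta>). \<alpha> \<in> closed_one_forms A \<and> \<beta> \<in> closed_one_forms A \<and>
                (\<lambda>c p. \<alpha> c p - \<beta> c p) \<in> exact_one_forms A}"

definition riemannian_metric :: "'a chart set \<Rightarrow> 'a metric \<Rightarrow> bool" where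
  "riemannian_metric A g \<longleftrightarrow>
     (\<forall>c\<in>A. smooth_on (cimg c) (g c \<circ> cinv c)) \<and>
     (\<forall>c\<in>A. \<forall>p\<in>cdom c. transpose (g c p) = g c p \<and> (\<forall>v. v \<noteq> 0 \<longrightarrow> v \<bullet> (g c p *v v) > 0)) \<and>
     (\<forall>c\<in>A. \<forall>d\<in>A. \<forall>p\<in>cdom c \<inter> cdom d.
        g c p = transpose (jacobian c d p) ** g d p ** jacobian c d p)"


section \<open>Riemannian calculus\<close>

text \<open>
  Scalar quantities computed in coordinates do not depend on the chart, so they are evaluated
  at \<open>p\<close> in some chart around \<open>p\<close>.
\<close>

definition chart_at :: "'a chart set \<Rightarrow> 'a \<Rightarrow> 'a chart" where
  "chart_at A p = (SOME c. c \<in> A \<and> p \<in> cdom c)"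

definition metric_at :: "'a chart set \<Rightarrow> 'a metric \<Rightarrow> 'a vec_field \<Rightarrow> 'a vec_field \<Rightarrow> 'a \<Rightarrow> real" where
  "metric_at A g V W p = (let c = chart_at A p in V c p \<bullet> (g c p *v W c p))"

definition gradient :: "'a metric \<Rightarrow> ('a \<Rightarrow> real) \<Rightarrow> 'a vec_field" where
  "gradient g f c p = matrix_inv (g c p) *v (\<chi> i. cpartial c i f p)"

definition vol_density :: "'a metric \<Rightarrow> 'a chart \<Rightarrow> 'a \<Rightarrow> real" where
  "vol_density g c p = sqrt (det (g c p))"

text \<open>The function \<open>div V\<close> with \<open>L\<^sub>V \<mu> = (div V) \<mu>\<close>.\<close>

definition divergence :: "'a chart set \<Rightarrow> 'a metric \<Rightarrow> 'a vec_field \<Rightarrow> 'a \<Rightarrow> real" where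
  "divergence A g V p =
     (let c = chart_at A p
      in (\<Sum>i\<in>UNIV. cpartial c i (\<lambda>q. vol_density g c q * V c q $ i) p) / vol_density g c p)"

definition laplacian :: "'a chart set \<Rightarrow> 'a metric \<Rightarrow> ('a \<Rightarrow> real) \<Rightarrow> 'a \<Rightarrow> real" where
  "laplacian A g f = divergence A g (gradient g f)"

definition christoffel :: "'a metric \<Rightarrow> 'a chart \<Rightarrow> 'a \<Rightarrow> 2 \<Rightarrow> 2 \<Rightarrow> 2 \<Rightarrow> real" where
  "christoffel g c p k i j =
     (\<Sum>l\<in>UNIV. matrix_inv (g c p) $ k $ l *
        (cpartial c i (\<lambda>q. g c q $ j $ l) p + cpartial c j (\<lambda>q. g c q $ i $ l) p
         - cpartial c l (\<lambda>q. g c q $ i $ j) p)) / 2"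

definition levi_civita :: "'a metric \<Rightarrow> 'a vec_field \<Rightarrow> 'a vec_field \<Rightarrow> 'a vec_field" where
  "levi_civita g V W c p =
     (\<chi> k. (\<Sum>i\<in>UNIV. V c p $ i * cpartial c i (\<lambda>q. W c q $ k) p) +
           (\<Sum>i\<in>UNIV. \<Sum>j\<in>UNIV. christoffel g c p k i j * V c p $ i * W c p $ j))"

text \<open>
  The rotation by \<open>\<pi>/2\<close> in the tangent planes, with respect to \<open>g\<close> and the orientation, in
  coordinates of an oriented chart.
\<close>

definition hodge_star :: "'a metric \<Rightarrow> 'a vec_field \<Rightarrow> 'a vec_field" where
  "hodge_star g V c p =
     (let w = g c p *v V c p in (1 / vol_density g c p) *\<^sub>R vector [- w $ 2, w $ 1])"

lemma hodge_star_rotation: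
  assumes sym: "transpose (g c p) = g c p"
    and pos: "\<And>v. v \<noteq> 0 \<Longrightarrow> v \<bullet> (g c p *v v) > 0"
  shows "hodge_star g V c p \<bullet> (g c p *v V c p) = 0"
    and "hodge_star g V c p \<bullet> (g c p *v hodge_star g V c p) = V c p \<bullet> (g c p *v V c p)"
    and "V c p \<noteq> 0 \<Longrightarrow> V c p $ 1 * hodge_star g V c p $ 2 - V c p $ 2 * hodge_star g V c p $ 1 > 0"
proof -
  define a b d where "a = g c p $ 1 $ 1" and "b = g c p $ 1 $ 2" and "d = g c p $ 2 $ 2"
  define v w where "v = V c p" and "w = g c p *v V c p"
  define D where "D = a * d - b\<^sup>2"
  have b': "g c p $ 2 $ 1 = b"
    unfolding b_def by (subst sym[symmetric]) (simp add: transpose_def)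
  have mv: "(g c p *v x) $ 1 = a * x $ 1 + b * x $ 2" "(g c p *v x) $ 2 = b * x $ 1 + d * x $ 2" for x
    by (simp_all add: matrix_vector_mult_def sum_2 a_def b_def d_def b'[unfolded b_def])
  have a: "a > 0"
    using pos[of "vector [1, 0]"] by (simp add: inner_vec_def sum_2 mv vec_eq_iff forall_2)
  have "a * D > 0"
    using pos[of "vector [- b, a]"] a
    by (simp add: inner_vec_def sum_2 mv vec_eq_iff forall_2 D_def power2_eq_square algebra_simps)
  with a have D: "D > 0" by (simp add: zero_less_mult_iff)
  have dens: "vol_density g c p = sqrt D"
    by (simp add: vol_density_def det_2 D_def a_def b_def d_def b'[unfolded b_def] power2_eq_square)
  have star: "hodge_star g V c p $ 1 = - w $ 2 / sqrt D" "hodge_star g V c p $ 2 = w $ 1 / sqrt D"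
    by (simp_all add: hodge_star_def dens w_def Let_def)
  have w: "w $ 1 = a * v $ 1 + b * v $ 2" "w $ 2 = b * v $ 1 + d * v $ 2"
    by (simp_all add: w_def v_def mv)
  show "hodge_star g V c p \<bullet> (g c p *v V c p) = 0"
    by (simp add: inner_vec_def sum_2 star flip: w_def)
  have "hodge_star g V c p \<bullet> (g c p *v hodge_star g V c p)
      = (a * (w $ 2)\<^sup>2 - 2 * b * w $ 1 * w $ 2 + d * (w $ 1)\<^sup>2) / (sqrt D)\<^sup>2"
    using D by (simp add: inner_vec_def sum_2 mv star field_simps power2_eq_square)
  also have "\<dots> = D * (v $ 1 * w $ 1 + v $ 2 * w $ 2) / D"
    using D by (simp add: w D_def power2_eq_square algebra_simps)
  also have "\<dots> = V c p \<bullet> (g c p *v V c p)"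
    using D by (simp add: inner_vec_def sum_2 v_def w_def)
  finally show "hodge_star g V c p \<bullet> (g c p *v hodge_star g V c p) = V c p \<bullet> (g c p *v V c p)" .
  assume "V c p \<noteq> 0"
  then have "v $ 1 * w $ 1 + v $ 2 * w $ 2 > 0"
    using pos[of v] by (simp add: inner_vec_def sum_2 v_def w_def)
  then have "(v $ 1 * w $ 1 + v $ 2 * w $ 2) / sqrt D > 0" using D by simp
  then show "V c p $ 1 * hodge_star g V c p $ 2 - V c p $ 2 * hodge_star g V c p $ 1 > 0"
    by (simp add: star v_def add_divide_distrib)
qed

text \<open>
  The Riemannian measure: the Borel measure on \<open>M\<close> that has density \<open>sqrt (det g)\<close> in every chart.
  Integration of functions against the Riemannian volume form is integration against it.
\<close>

definition riem_volume :: "'a::topological_space set \<Rightarrow> 'a chart set \<Rightarrow> 'a metric \<Rightarrow> 'a measure" where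
  "riem_volume M A g =
     (THE \<mu>. sets \<mu> = sets (restrict_space borel M) \<and>
        (\<forall>c\<in>A. \<forall>B\<in>sets \<mu>. B \<subseteq> cdom c \<longrightarrow>
           emeasure \<mu> B = (\<integral>\<^sup>+x\<in>cmap c ` B. ennreal (vol_density g c (cinv c x)) \<partial>lborel)))"

definition first_eigenvalue :: "'a::topological_space set \<Rightarrow> 'a chart set \<Rightarrow> 'a metric \<Rightarrow> real" where
  "first_eigenvalue M A g =
     (GREATEST l. \<forall>f. smooth_fun A f \<and>
        (if bdry A = {} then (\<integral>p. f p \<partial>riem_volume M A g) = 0 else (\<forall>p\<in>bdry A. f p = 0)) \<longrightarrow>
        (\<integral>p. f p * laplacian A g f p \<partial>riem_volume M A g)
          \<le> - l * (\<integral>p. (f p)\<^sup>2 \<partial>riem_volume M A g))"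


section \<open>Stationary solutions of the Euler equation\<close>

definition div_free :: "'a set \<Rightarrow> 'a chart set \<Rightarrow> 'a metric \<Rightarrow> 'a vec_field \<Rightarrow> bool" where
  "div_free M A g V \<longleftrightarrow> (\<forall>p\<in>M. divergence A g V p = 0)"

definition stationary_solution :: "'a set \<Rightarrow> 'a chart set \<Rightarrow> 'a metric \<Rightarrow> 'a vec_field \<Rightarrow> bool" where
  "stationary_solution M A g u \<longleftrightarrow>
     vector_field A u \<and>
     (\<exists>P. smooth_fun A P \<and> (\<forall>c\<in>A. \<forall>p\<in>cdom c. levi_civita g u u c p = - gradient g P c p)) \<and>
     div_free M A g u \<and> tangent_to_bdry A u"

definition stream_function :: "'a chart set \<Rightarrow> 'a metric \<Rightarrow> ('a \<Rightarrow> real) \<Rightarrow> 'a vec_field \<Rightarrow> bool" where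
  "stream_function A g \<psi> V \<longleftrightarrow>
     smooth_fun A \<psi> \<and> (\<forall>c\<in>A. \<forall>p\<in>cdom c. hodge_star g (gradient g \<psi>) c p = V c p)"

definition arnold_stable ::
  "'a::topological_space set \<Rightarrow> 'a chart set \<Rightarrow> 'a metric \<Rightarrow> 'a vec_field \<Rightarrow> bool" where
  "arnold_stable M A g u \<longleftrightarrow>
     stationary_solution M A g u \<and>
     (\<exists>\<psi> \<kappa>. stream_function A g \<psi> u \<and>
        (\<forall>c\<in>A. \<forall>p\<in>cdom c.
           gradient g (laplacian A g \<psi>) c p = \<kappa> p *\<^sub>R gradient g \<psi> c p) \<and>
        ((\<forall>p\<in>M. - first_eigenvalue M A g < \<kappa> p \<and> \<kappa> p < 0) \<or> (\<forall>p\<in>M. 0 < \<kappa> p)))"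

definition L2_inner ::
  "'a::topological_space set \<Rightarrow> 'a chart set \<Rightarrow> 'a metric \<Rightarrow> 'a vec_field \<Rightarrow> 'a vec_field \<Rightarrow> real" where
  "L2_inner M A g V W = (\<integral>p. metric_at A g V W p \<partial>riem_volume M A g)"

definition misiolek_curvature ::
  "'a::topological_space set \<Rightarrow> 'a chart set \<Rightarrow> 'a metric \<Rightarrow> 'a vec_field \<Rightarrow> 'a vec_field \<Rightarrow> real" where
  "misiolek_curvature M A g u Y =
     - L2_inner M A g (lie_bracket u Y) (lie_bracket u Y)
     - L2_inner M A g (lie_bracket (lie_bracket u Y) Y) u"

end

theory Submission
  imports Defs
begin

text \<open>
  Let \<open>\<psi>\<close> be the stream function of \<open>u\<close>, \<open>\<omega> = \<Delta>\<psi>\<close> and \<open>h = - Y \<psi>\<close>. Since \<open>div Y = 0\<close>, the bracket with \<open>Y\<close>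
  acts on Hamiltonian fields through their stream functions: \<open>[Y, \<star>grad f] = \<star>grad (Y f)\<close>. Hence
  \<open>[u, Y] = \<star>grad h\<close> and \<open>[[u, Y], Y] = - \<star>grad (Y h)\<close>. Both \<open>h\<close> and \<open>Y h\<close> vanish on the boundary, as
  \<open>u\<close> and \<open>Y\<close> are tangent to it, so integration by parts gives
  \<open>MC = \<integral> h \<Delta>h + \<integral> h (Y \<omega>) = \<integral> h \<Delta>h - \<integral> F'(\<psi>) h\<^sup>2\<close>, and \<open>h\<close> is admissible for the variational
  characterization of \<open>\<lambda>\<^sub>1\<close>.
\<close>

section \<open>Calculus on the half plane\<close>

text \<open>In charts the tangential direction of the boundary is the second axis. Tangency of
  \<open>u\<close> says that \<psi> has no tangential derivative there, so \<open>h\<close> is zero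
  on the boundary; then \<open>h\<close> has no tangential derivative either, and \<open>Y h\<close>
  is zero too. The zero mean of \<open>h\<close> comes from pairing \<open>Y \<psi>\<close> with the
  constant 1, and collinearity of the gradients turns \<open>Y \<omega>\<close> into
  \<open>- \<kappa> h\<close>. Most of the work is forced by the encodings: derivatives and
  divergence are evaluated in an arbitrarily chosen chart, the volume is a \<open>THE\<close> and
  the first eigenvalue a \<open>GREATEST\<close>. Hence chart independence, existence and uniqueness
  of the measure, and attainment of the eigenvalue bound must come before any use of these objects.
  Attainment is shown with a test function of positive norm; if \<open>h\<close> vanishes almost
  everywhere, the conclusion is drawn directly. As \<kappa> may fail to be measurable, \<kappa>
  times the square of \<open>h\<close> occurs only in pointwise comparisons, and the integrand is
  always \<open>h\<close> times \<open>Y \<omega>\<close>.\<close>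

abbreviation hopen :: "(real^2) set \<Rightarrow> bool" where
  "hopen \<equiv> openin (top_of_set half_plane)"

lemma closed_half_plane: "closed half_plane"
  unfolding half_plane_def using closed_halfspace_component_ge_cart[of 0 1] by simp

lemma hopen_subset_half_plane: "hopen S \<Longrightarrow> S \<subseteq> half_plane"
  using openin_imp_subset by blast

text \<open>Near a point of a relatively open \<open>S\<close>, the sets \<open>S\<close> and
  \<open>half_plane\<close> agree, so derivatives within chart images, overlaps and smaller pieces
  can be exchanged.\<close>

lemma at_within_hopen:
  assumes "hopen S" "x \<in> S"
  shows "at x within S = at x within half_plane"
proof -
  obtain T where "open T" "S = half_plane \<inter> T" using assms(1) by (auto simp: openin_open)
  with assms(2) show ?thesis by (intro at_within_nhd[of x T]) auto
qed

text \<open>Only nonnegative steps occur: from a boundary point the first axis can be followed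
  inward only. One small quadrant is what uniqueness of derivatives and the second differences rely
  on.\<close>

lemma hopen_contains_segment:
  assumes "hopen S" "x \<in> S"
  obtains r where "r > 0" "\<And>s t. \<lbrakk>0 \<le> s; s < r; 0 \<le> t; t < r\<rbrakk> \<Longrightarrow> x + s *\<^sub>R axis 1 1 + t *\<^sub>R axis 2 1 \<in> S"
proof -
  obtain T where T: "open T" "S = half_plane \<inter> T" using assms(1) by (auto simp: openin_open)
  with assms(2) obtain e where e: "e > 0" "ball x e \<subseteq> T" by (meson IntE openE)
  have "x + s *\<^sub>R axis 1 1 + t *\<^sub>R axis 2 1 \<in> S" if "0 \<le> s" "s < e/2" "0 \<le> t" "t < e/2" for s t
  proof -
    have "norm (s *\<^sub>R axis 1 1 + t *\<^sub>R axis 2 1 :: real^2) \<le> s + t"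
      using norm_triangle_ineq[of "s *\<^sub>R axis 1 1" "t *\<^sub>R axis 2 1 :: real^2"] that by simp
    then have "x + s *\<^sub>R axis 1 1 + t *\<^sub>R axis 2 1 \<in> ball x e"
      using that dist_add_cancel[of x 0 "s *\<^sub>R axis 1 1 + t *\<^sub>R axis 2 1"]
      by (simp add: add.assoc)
    moreover have "x + s *\<^sub>R axis 1 1 + t *\<^sub>R axis 2 1 \<in> half_plane"
      using assms(2) T that by (auto simp: half_plane_def axis_def)
    ultimately show ?thesis using T e by blast
  qed
  then show thesis using that[of "e/2"] e by auto
qed

lemma hopen_axis_direction:
  assumes "hopen S" "x \<in> S" "e > 0"
  shows "\<exists>d. 0 < \<bar>d\<bar> \<and> \<bar>d\<bar> < e \<and> x + d *\<^sub>R axis i 1 \<in> S"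
proof -
  obtain r where r: "r > 0"
    "\<And>s t. \<lbrakk>0 \<le> s; s < r; 0 \<le> t; t < r\<rbrakk> \<Longrightarrow> x + s *\<^sub>R axis 1 1 + t *\<^sub>R axis 2 1 \<in> S"
    using hopen_contains_segment[OF assms(1,2)] by blast
  have "x + (min r e / 2) *\<^sub>R axis i 1 \<in> S"
    using r(2)[of "min r e / 2" 0] r(2)[of 0 "min r e / 2"] r(1) assms(3) exhaust_2[of i] by auto
  then show ?thesis using r(1) assms(3) by (intro exI[of _ "min r e / 2"]) auto
qed

lemma hopen_derivative_unique:
  assumes "hopen S" "x \<in> S"
    and "(f has_derivative D) (at x within S)" "(f has_derivative E) (at x within S)"
  shows "D = E"
proof (rule frechet_derivative_unique_within[OF assms(3,4)])
  fix i :: "real^2" and e :: real assume "i \<in> Basis" "e > 0"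
  then obtain k where "i = axis k 1" by (auto simp: Basis_vec_def)
  then show "\<exists>d. 0 < \<bar>d\<bar> \<and> \<bar>d\<bar> < e \<and> x + d *\<^sub>R i \<in> S"
    using hopen_axis_direction[OF assms(1,2) \<open>e > 0\<close>] by simp
qed

lemma frechet_derivative_hopen:
  assumes "hopen S" "x \<in> S" "(f has_derivative D) (at x within S)"
  shows "frechet_derivative f (at x within S) = D"
  using assms hopen_derivative_unique frechet_derivative_works differentiableI by metis

lemma partial_within_eq:
  assumes "hopen S" "x \<in> S" "(f has_derivative D) (at x within S)"
  shows "partial_within S i f x = D (axis i 1)"
  using frechet_derivative_hopen[OF assms] by (simp add: partial_within_def)

text \<open>\<open>frechet_derivative\<close> is a choice among derivatives, so agreement on
  \<open>S\<close> is transferred through the predicate \<open>has_derivative\<close>; the equation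
  then holds even where no derivative exists.\<close>

lemma partial_within_cong:
  assumes "x \<in> S" "\<And>y. y \<in> S \<Longrightarrow> f y = g y"
  shows "partial_within S i f x = partial_within S i g x"
proof -
  have "(f has_derivative D) (at x within S) \<longleftrightarrow> (g has_derivative D) (at x within S)" for D
    using assms has_derivative_transform[of x S g f D] has_derivative_transform[of x S f g D] by metis
  then show ?thesis by (simp add: partial_within_def frechet_derivative_def)
qed

lemma partial_within_subset:
  assumes "hopen S" "hopen T" "x \<in> S" "x \<in> T"
  shows "partial_within S i f x = partial_within T i f x"
  using at_within_hopen[OF assms(1,3)] at_within_hopen[OF assms(2,4)]
  by (simp add: partial_within_def)

lemma axis_expansion_2: "v = v $ 1 *\<^sub>R axis 1 1 + v $ 2 *\<^sub>R (axis 2 1 :: real^2)"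
  by (simp add: vec_eq_iff axis_def forall_2)

lemma has_derivative_partials:
  assumes "f differentiable (at x within S)"
  shows "(f has_derivative (\<lambda>v. v $ 1 *\<^sub>R partial_within S 1 f x + v $ 2 *\<^sub>R partial_within S 2 f x))
           (at x within S)"
proof -
  let ?D = "frechet_derivative f (at x within S)"
  have D: "(f has_derivative ?D) (at x within S)" using assms frechet_derivative_works by blast
  then interpret bounded_linear ?D by (rule has_derivative_bounded_linear)
  have "?D v = v $ 1 *\<^sub>R ?D (axis 1 1) + v $ 2 *\<^sub>R ?D (axis 2 1)" for v
    using axis_expansion_2[of v] add[of "v $ 1 *\<^sub>R axis 1 1" "v $ 2 *\<^sub>R axis 2 1"] scaleR by simp
  then have "?D = (\<lambda>v. v $ 1 *\<^sub>R ?D (axis 1 1) + v $ 2 *\<^sub>R ?D (axis 2 1))" by (rule ext)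
  then show ?thesis unfolding partial_within_def by (rule has_derivative_eq_rhs[OF D])
qed

section \<open>Closure properties of the classes \<open>C_k_on\<close>\<close>

lemma differentiable_on_cong:
  assumes "\<And>x. x \<in> S \<Longrightarrow> f x = g x"
  shows "f differentiable_on S \<longleftrightarrow> g differentiable_on S"
  unfolding differentiable_on_def differentiable_def
  using assms has_derivative_transform[of _ S g f] has_derivative_transform[of _ S f g] by metis

lemma C_k_on_cong:
  assumes "\<And>x. x \<in> S \<Longrightarrow> f x = g x"
  shows "C_k_on k S f \<longleftrightarrow> C_k_on k S g"
  using assms
proof (induction k arbitrary: f g)
  case 0
  then show ?case using continuous_on_cong[of S S f g] by simp
next
  case (Suc k)
  have "C_k_on k S (partial_within S i f) \<longleftrightarrow> C_k_on k S (partial_within S i g)" for i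
    using Suc.prems by (intro Suc.IH partial_within_cong)
  then show ?case using differentiable_on_cong[of S f g] Suc.prems by simp
qed

lemma C_k_on_continuous: "C_k_on k S f \<Longrightarrow> continuous_on S f"
  by (cases k) (auto intro: differentiable_imp_continuous_on)

lemma C_k_on_Suc_D: "C_k_on (Suc k) S f \<Longrightarrow> C_k_on k S f"
  by (induction k arbitrary: f) (auto intro: differentiable_imp_continuous_on)

lemma C_k_on_mono:
  assumes "C_k_on k S f" "j \<le> k"
  shows "C_k_on j S f"
  using assms(2,1) by (induction rule: inc_induct) (blast intro: C_k_on_Suc_D)+

text \<open>Serves functions defined by cases, such as extensions by zero and bumps, whose
  regularity is checked on separate open pieces.\<close>

lemma C_k_on_local:
  assumes "hopen S" "\<And>x. x \<in> S \<Longrightarrow> \<exists>T. hopen T \<and> x \<in> T \<and> T \<subseteq> S \<and> C_k_on k T f"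
  shows "C_k_on k S f"
  using assms(2)
proof (induction k arbitrary: f)
  case 0
  have "continuous (at x within S) f" if x: "x \<in> S" for x
  proof -
    obtain T where "hopen T" "x \<in> T" "continuous_on T f"
      using 0[OF x] unfolding C_k_on.simps by blast
    then have "continuous (at x within T) f" by (simp add: continuous_on_eq_continuous_within)
    then show ?thesis
      using at_within_hopen[OF \<open>hopen T\<close> \<open>x \<in> T\<close>] at_within_hopen[OF assms(1) x] by simp
  qed
  then show ?case by (simp add: continuous_on_eq_continuous_within)
next
  case (Suc k)
  have "f differentiable (at x within S)" if x: "x \<in> S" for x
  proof -
    obtain T where "hopen T" "x \<in> T" "f differentiable_on T" using Suc.prems[OF x] by auto
    then have "f differentiable (at x within T)" by (simp add: differentiable_on_def)
    then show ?thesis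
      using at_within_hopen[OF \<open>hopen T\<close> \<open>x \<in> T\<close>] at_within_hopen[OF assms(1) x] by simp
  qed
  moreover have "C_k_on k S (partial_within S i f)" for i
  proof (rule Suc.IH)
    fix x assume x: "x \<in> S"
    obtain T where T: "hopen T" "x \<in> T" "T \<subseteq> S" "C_k_on k T (partial_within T i f)"
      using Suc.prems[OF x] by auto
    have "partial_within T i f y = partial_within S i f y" if "y \<in> T" for y
      using T that assms(1) by (intro partial_within_subset) auto
    then have "C_k_on k T (partial_within S i f)" using T(4) C_k_on_cong by blast
    then show "\<exists>T. hopen T \<and> x \<in> T \<and> T \<subseteq> S \<and> C_k_on k T (partial_within S i f)" using T by blast
  qed
  ultimately show ?case by (simp add: differentiable_on_def)
qed

lemma frechet_derivative_worksD:
  "f differentiable F \<Longrightarrow> (f has_derivative frechet_derivative f F) F"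
  by (simp add: frechet_derivative_works)

lemma C_k_on_SucD:
  assumes "C_k_on (Suc k) S f"
  shows "x \<in> S \<Longrightarrow> f differentiable (at x within S)" "C_k_on k S (partial_within S i f)"
  using assms by (auto simp: differentiable_on_def)

text \<open>\<open>p i\<close> is the expected formula for the partial derivative. The closure rules
  follow by induction on \<open>k\<close>: the product, quotient or chain formula inserted for
  \<open>p i\<close> is covered by the induction hypothesis.\<close>

lemma C_k_on_SucI:
  assumes "\<And>x. x \<in> S \<Longrightarrow> f differentiable (at x within S)"
    and "\<And>i x. x \<in> S \<Longrightarrow> partial_within S i f x = p i x"
    and "\<And>i. C_k_on k S (p i)"
  shows "C_k_on (Suc k) S f"
proof -
  have "C_k_on k S (partial_within S i f)" for i
    using assms(3)[of i] C_k_on_cong[of S "partial_within S i f" "p i" k] assms(2) by blast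
  then show ?thesis using assms(1) by (simp add: differentiable_on_def)
qed

lemma partial_within_const [simp]: "hopen S \<Longrightarrow> x \<in> S \<Longrightarrow> partial_within S i (\<lambda>x. c) x = 0"
  by (subst partial_within_eq[where D="\<lambda>_. 0"]) auto

lemma C_k_on_const:
  assumes "hopen S"
  shows "C_k_on k S (\<lambda>x. c)"
proof (induction k arbitrary: c)
  case (Suc k)
  show ?case by (rule C_k_on_SucI[where p="\<lambda>_ _. 0"]) (use assms Suc in auto)
qed simp

lemma partial_within_linear:
  assumes "bounded_linear L" "hopen S" "x \<in> S" "f differentiable (at x within S)"
  shows "partial_within S i (\<lambda>x. L (f x)) x = L (partial_within S i f x)"
    and "(\<lambda>x. L (f x)) differentiable (at x within S)"
proof -
  note D = bounded_linear.has_derivative[OF assms(1) frechet_derivative_worksD[OF assms(4)]]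
  show "partial_within S i (\<lambda>x. L (f x)) x = L (partial_within S i f x)"
    using partial_within_eq[OF assms(2,3) D, of i] by (simp add: partial_within_def)
  show "(\<lambda>x. L (f x)) differentiable (at x within S)" using D by (rule differentiableI)
qed

lemma C_k_on_linear:
  assumes "bounded_linear L" "hopen S" "C_k_on k S f"
  shows "C_k_on k S (\<lambda>x. L (f x))"
  using assms(3)
proof (induction k arbitrary: f)
  case 0
  then show ?case using bounded_linear.continuous_on[OF assms(1)] by simp
next
  case (Suc k)
  note f = C_k_on_SucD[OF Suc.prems]
  show ?case
    by (rule C_k_on_SucI[OF partial_within_linear(2)[OF assms(1,2) _ f(1)]
          partial_within_linear(1)[OF assms(1,2) _ f(1)] Suc.IH[OF f(2)]])
qed

lemmas C_k_on_component = C_k_on_linear[OF bounded_linear_vec_nth]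
lemmas partial_within_component = partial_within_linear[OF bounded_linear_vec_nth]
lemmas C_k_on_minus = C_k_on_linear[OF bounded_linear_minus[OF bounded_linear_ident]]
lemmas partial_within_minus = partial_within_linear[OF bounded_linear_minus[OF bounded_linear_ident]]

lemma partial_within_add:
  assumes "hopen S" "x \<in> S" "f differentiable (at x within S)" "g differentiable (at x within S)"
  shows "partial_within S i (\<lambda>x. f x + g x) x = partial_within S i f x + partial_within S i g x"
  using partial_within_eq[OF assms(1,2) has_derivative_add[OF assms(3,4)[THEN frechet_derivative_worksD]], of i]
  by (simp add: partial_within_def)

lemma C_k_on_add:
  assumes "hopen S" "C_k_on k S f" "C_k_on k S g"
  shows "C_k_on k S (\<lambda>x. f x + g x)"
  using assms(2,3)
proof (induction k arbitrary: f g)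
  case 0
  then show ?case by (simp add: continuous_on_add)
next
  case (Suc k)
  note f = C_k_on_SucD[OF Suc.prems(1)] and g = C_k_on_SucD[OF Suc.prems(2)]
  show ?case
    by (rule C_k_on_SucI[OF differentiable_add[OF f(1) g(1)] partial_within_add[OF assms(1) _ f(1) g(1)]
          Suc.IH[OF f(2) g(2)]])
qed

lemma C_k_on_diff:
  assumes "hopen S" "C_k_on k S f" "C_k_on k S g"
  shows "C_k_on k S (\<lambda>x. f x - g x)"
  using C_k_on_add[OF assms(1,2) C_k_on_minus[OF assms(1,3)]] by simp

lemma partial_within_diff:
  assumes "hopen S" "x \<in> S" "f differentiable (at x within S)" "g differentiable (at x within S)"
  shows "partial_within S i (\<lambda>x. f x - g x) x = partial_within S i f x - partial_within S i g x"
  using partial_within_eq[OF assms(1,2) has_derivative_diff[OF assms(3,4)[THEN frechet_derivative_worksD]], of i]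
  by (simp add: partial_within_def)

lemma C_k_on_sum:
  assumes "hopen S" "\<And>j. j \<in> I \<Longrightarrow> C_k_on k S (f j)"
  shows "C_k_on k S (\<lambda>x. \<Sum>j\<in>I. f j x)"
  using assms(2)
  by (induction I rule: infinite_finite_induct) (simp_all add: C_k_on_const C_k_on_add assms(1))

lemma partial_within_mult:
  fixes f g :: "real^2 \<Rightarrow> real"
  assumes "hopen S" "x \<in> S" "f differentiable (at x within S)" "g differentiable (at x within S)"
  shows "partial_within S i (\<lambda>x. f x * g x) x = f x * partial_within S i g x + partial_within S i f x * g x"
  using partial_within_eq[OF assms(1,2) has_derivative_mult[OF assms(3,4)[THEN frechet_derivative_worksD]], of i]
  by (simp add: partial_within_def)

lemma C_k_on_mult:
  fixes f g :: "real^2 \<Rightarrow> real"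
  assumes "hopen S" "C_k_on k S f" "C_k_on k S g"
  shows "C_k_on k S (\<lambda>x. f x * g x)"
  using assms(2,3)
proof (induction k arbitrary: f g)
  case 0
  then show ?case by (simp add: continuous_on_mult)
next
  case (Suc k)
  note f = C_k_on_SucD[OF Suc.prems(1)] and g = C_k_on_SucD[OF Suc.prems(2)]
  show ?case
    by (rule C_k_on_SucI[OF differentiable_mult[OF f(1) g(1)] partial_within_mult[OF assms(1) _ f(1) g(1)]
          C_k_on_add[OF assms(1) Suc.IH[OF C_k_on_Suc_D[OF Suc.prems(1)] g(2)]
            Suc.IH[OF f(2) C_k_on_Suc_D[OF Suc.prems(2)]]]])
qed

lemma partial_within_compose_real:
  fixes f :: "real^2 \<Rightarrow> real"
  assumes "hopen S" "x \<in> S" "f differentiable (at x within S)" "(\<phi> has_real_derivative d) (at (f x))"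
  shows "partial_within S i (\<lambda>x. \<phi> (f x)) x = d * partial_within S i f x"
    and "(\<lambda>x. \<phi> (f x)) differentiable (at x within S)"
proof -
  have D: "((\<lambda>x. \<phi> (f x)) has_derivative (\<lambda>v. d * frechet_derivative f (at x within S) v)) (at x within S)"
    using has_derivative_compose[OF frechet_derivative_worksD[OF assms(3)]
        assms(4)[unfolded has_field_derivative_def]] .
  show "partial_within S i (\<lambda>x. \<phi> (f x)) x = d * partial_within S i f x"
    using partial_within_eq[OF assms(1,2) D, of i] by (simp add: partial_within_def)
  show "(\<lambda>x. \<phi> (f x)) differentiable (at x within S)" using D by (rule differentiableI)
qed

text \<open>The derivative of the reciprocal is built from the reciprocal itself and a partial of
  \<open>f\<close>, so the induction hypothesis for the reciprocal closes the step.\<close>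

lemma C_k_on_inverse:
  fixes f :: "real^2 \<Rightarrow> real"
  assumes "hopen S" "C_k_on k S f" "\<And>x. x \<in> S \<Longrightarrow> f x \<noteq> 0"
  shows "C_k_on k S (\<lambda>x. inverse (f x))"
  using assms(2)
proof (induction k)
  case 0
  then show ?case using assms(3) by (simp add: continuous_on_inverse)
next
  case (Suc k)
  have IH: "C_k_on k S (\<lambda>x. inverse (f x))" by (rule Suc.IH[OF C_k_on_Suc_D[OF Suc.prems]])
  have D: "(inverse has_real_derivative - (inverse (f x) * inverse (f x))) (at (f x))" if "x \<in> S" for x
    using DERIV_inverse[of "f x" UNIV] assms(3) that by (simp add: power2_eq_square)
  note f = C_k_on_SucD[OF Suc.prems]
  show ?case
    by (rule C_k_on_SucI[OF partial_within_compose_real(2)[OF assms(1) _ f(1) D]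
          partial_within_compose_real(1)[OF assms(1) _ f(1) D]
          C_k_on_mult[OF assms(1) C_k_on_minus[OF assms(1) C_k_on_mult[OF assms(1) IH IH]] f(2)]])
qed

lemma C_k_on_divide:
  fixes f g :: "real^2 \<Rightarrow> real"
  assumes "hopen S" "C_k_on k S f" "C_k_on k S g" "\<And>x. x \<in> S \<Longrightarrow> g x \<noteq> 0"
  shows "C_k_on k S (\<lambda>x. f x / g x)"
  unfolding divide_inverse by (rule C_k_on_mult[OF assms(1,2) C_k_on_inverse[OF assms(1,3,4)]])

lemma C_k_on_sqrt:
  fixes f :: "real^2 \<Rightarrow> real"
  assumes "hopen S" "C_k_on k S f" "\<And>x. x \<in> S \<Longrightarrow> f x > 0"
  shows "C_k_on k S (\<lambda>x. sqrt (f x))"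
  using assms(2)
proof (induction k)
  case 0
  then show ?case by (simp add: continuous_on_real_sqrt)
next
  case (Suc k)
  have IH: "C_k_on k S (\<lambda>x. inverse (2 * sqrt (f x)))"
    using assms(3) by (intro C_k_on_inverse C_k_on_mult C_k_on_const assms(1)
        Suc.IH[OF C_k_on_Suc_D[OF Suc.prems]]) force
  have D: "(sqrt has_real_derivative inverse (2 * sqrt (f x))) (at (f x))" if "x \<in> S" for x
    using DERIV_real_sqrt[OF assms(3)[OF that]] by (simp add: divide_simps mult.commute)
  note f = C_k_on_SucD[OF Suc.prems]
  show ?case
    by (rule C_k_on_SucI[OF partial_within_compose_real(2)[OF assms(1) _ f(1) D]
          partial_within_compose_real(1)[OF assms(1) _ f(1) D] C_k_on_mult[OF assms(1) IH f(2)]])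
qed

lemma partial_within_coordinate:
  assumes "hopen S" "x \<in> S"
  shows "partial_within S i (\<lambda>x. x $ j) x = (if i = j then 1 else 0)"
  using partial_within_eq[OF assms bounded_linear_imp_has_derivative[OF bounded_linear_vec_nth], of i j]
  by (auto simp: axis_def)

lemma C_k_on_coordinate:
  assumes "hopen S"
  shows "C_k_on k S (\<lambda>x. x $ j)"
proof (cases k)
  case (Suc l)
  show ?thesis unfolding Suc
    by (rule C_k_on_SucI[OF bounded_linear_imp_differentiable[OF bounded_linear_vec_nth]
          partial_within_coordinate[OF assms] C_k_on_const[OF assms]])
qed (simp add: continuous_on_component)

lemma chain_partial:
  assumes "hopen S" "hopen T" "x \<in> S" "\<tau> ` S \<subseteq> T"
    and "\<tau> differentiable (at x within S)" "f differentiable (at (\<tau> x) within T)"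
  shows "partial_within S i (\<lambda>x. f (\<tau> x)) x =
      (partial_within S i \<tau> x $ 1) *\<^sub>R partial_within T 1 f (\<tau> x)
    + (partial_within S i \<tau> x $ 2) *\<^sub>R partial_within T 2 f (\<tau> x)"
    and "(\<lambda>x. f (\<tau> x)) differentiable (at x within S)"
proof -
  let ?D = "\<lambda>v. v $ 1 *\<^sub>R partial_within T 1 f (\<tau> x) + v $ 2 *\<^sub>R partial_within T 2 f (\<tau> x)"
  have D: "((\<lambda>x. f (\<tau> x)) has_derivative (\<lambda>v. ?D (frechet_derivative \<tau> (at x within S) v))) (at x within S)"
    using diff_chain_within[OF frechet_derivative_worksD[OF assms(5)]
        has_derivative_subset[OF has_derivative_partials[OF assms(6)] assms(4)]]
    by (simp add: o_def)
  show "partial_within S i (\<lambda>x. f (\<tau> x)) x =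
      (partial_within S i \<tau> x $ 1) *\<^sub>R partial_within T 1 f (\<tau> x)
    + (partial_within S i \<tau> x $ 2) *\<^sub>R partial_within T 2 f (\<tau> x)"
    using partial_within_eq[OF assms(1,3) D, of i] by (simp add: partial_within_def)
  show "(\<lambda>x. f (\<tau> x)) differentiable (at x within S)" using D by (rule differentiableI)
qed

text \<open>Carries the bump of one chart into the coordinates of another; one derivative matches
  the regularity of the bumps.\<close>

lemma C_1_on_compose:
  fixes f :: "real^2 \<Rightarrow> real"
  assumes "hopen S" "hopen T" "\<tau> ` S \<subseteq> T" "C_k_on (Suc 0) S \<tau>" "C_k_on (Suc 0) T f"
  shows "C_k_on (Suc 0) S (\<lambda>x. f (\<tau> x))"
proof -
  note \<tau> = C_k_on_SucD(1)[OF assms(4)]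
  have f: "f differentiable (at (\<tau> x) within T)" if "x \<in> S" for x
    using C_k_on_SucD(1)[OF assms(5)] assms(3) that by blast
  have c: "continuous_on S \<tau>" using assms(4) by (rule C_k_on_continuous)
  have "continuous_on S (\<lambda>x. (partial_within S i \<tau> x $ 1) *\<^sub>R partial_within T 1 f (\<tau> x)
      + (partial_within S i \<tau> x $ 2) *\<^sub>R partial_within T 2 f (\<tau> x))" for i
  proof -
    have "continuous_on S (\<lambda>x. partial_within T j f (\<tau> x))" for j
      using continuous_on_compose2[OF C_k_on_SucD(2)[OF assms(5), unfolded C_k_on.simps] c assms(3)] .
    moreover have "continuous_on S (partial_within S i \<tau>)"
      using C_k_on_SucD(2)[OF assms(4)] by simp
    ultimately show ?thesis by (intro continuous_intros)
  qed
  then show ?thesis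
    by (intro C_k_on_SucI[OF chain_partial(2)[OF assms(1,2) _ assms(3) \<tau> f]
          chain_partial(1)[OF assms(1,2) _ assms(3) \<tau> f]]) auto
qed

section \<open>Symmetry of second derivatives up to the boundary, and the Piola identity\<close>

lemma has_real_derivative_along_axis:
  fixes f :: "real^2 \<Rightarrow> real"
  assumes "hopen S" "f differentiable (at (x + t *\<^sub>R axis i 1) within S)"
    and "\<And>s. s \<in> I \<Longrightarrow> x + s *\<^sub>R axis i 1 \<in> S"
  shows "((\<lambda>t. f (x + t *\<^sub>R axis i 1)) has_real_derivative partial_within S i f (x + t *\<^sub>R axis i 1)) (at t within I)"
proof -
  let ?D = "frechet_derivative f (at (x + t *\<^sub>R axis i 1) within S)"
  have "((\<lambda>t. x + t *\<^sub>R axis i 1) has_derivative (\<lambda>s. s *\<^sub>R axis i 1)) (at t within I)"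
    by (auto intro!: derivative_eq_intros)
  moreover have "(f has_derivative ?D) (at (x + t *\<^sub>R axis i 1) within ((\<lambda>t. x + t *\<^sub>R axis i 1) ` I))"
    by (rule has_derivative_subset[OF frechet_derivative_worksD[OF assms(2)]]) (use assms(3) in auto)
  ultimately have "(f \<circ> (\<lambda>t. x + t *\<^sub>R axis i 1) has_derivative ?D \<circ> (\<lambda>s. s *\<^sub>R axis i 1)) (at t within I)"
    by (rule diff_chain_within)
  moreover have "?D \<circ> (\<lambda>s. s *\<^sub>R axis i 1) = (\<lambda>s. partial_within S i f (x + t *\<^sub>R axis i 1) * s)"
    using linear_scale[OF linear_frechet_derivative[OF assms(2)]]
    by (auto simp: fun_eq_iff partial_within_def)
  ultimately show ?thesis by (simp add: has_field_derivative_def o_def)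
qed

text \<open>
  The second difference over the rectangle from \<open>x\<close> to \<open>x + s e\<^sub>1 + t e\<^sub>2\<close> is evaluated
  by the mean value theorem in both orders; positive \<open>s\<close> and \<open>t\<close> keep the rectangle inside the half plane.
\<close>

lemma second_difference_mean_value:
  fixes f :: "real^2 \<Rightarrow> real"
  assumes S: "hopen S" and f: "C_k_on 2 S f" and st: "0 < s" "0 < t"
    and sub: "\<And>a b. \<lbrakk>0 \<le> a; a \<le> s; 0 \<le> b; b \<le> t\<rbrakk> \<Longrightarrow> x + a *\<^sub>R axis i 1 + b *\<^sub>R axis j 1 \<in> S"
  obtains a b where "0 \<le> a" "a \<le> s" "0 \<le> b" "b \<le> t"
    "f (x + s *\<^sub>R axis i 1 + t *\<^sub>R axis j 1) - f (x + s *\<^sub>R axis i 1) - f (x + t *\<^sub>R axis j 1) + f x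
     = s * t * partial_within S j (partial_within S i f) (x + a *\<^sub>R axis i 1 + b *\<^sub>R axis j 1)"
proof -
  note f1 = C_k_on_SucD[OF f[unfolded numeral_2_eq_2]]
  note f2 = C_k_on_SucD[OF f1(2)]
  define \<phi> where "\<phi> a = f (x + t *\<^sub>R axis j 1 + a *\<^sub>R axis i 1) - f (x + a *\<^sub>R axis i 1)" for a
  define \<phi>' where "\<phi>' a = partial_within S i f (x + t *\<^sub>R axis j 1 + a *\<^sub>R axis i 1) - partial_within S i f (x + a *\<^sub>R axis i 1)" for a
  have in1: "x + b *\<^sub>R axis j 1 + a *\<^sub>R axis i 1 \<in> S" if "0 \<le> a" "a \<le> s" "0 \<le> b" "b \<le> t" for a b
    using sub[OF that] by (simp add: add_ac)
  have in0: "x + a *\<^sub>R axis i 1 \<in> S" if "0 \<le> a" "a \<le> s" for a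
    using sub[OF that, of 0] st by simp
  have "(\<phi> has_real_derivative \<phi>' a) (at a within {0..s})" if "0 \<le> a" "a \<le> s" for a
    unfolding \<phi>_def \<phi>'_def
    using in1 in0 that st
    by (intro DERIV_diff has_real_derivative_along_axis[OF S f1(1)]) auto
  then have "\<exists>a\<in>{0<..<s}. \<phi> s - \<phi> 0 = \<phi>' a * (s - 0)"
    using mvt_simple[OF st(1), of \<phi> "\<lambda>a. (*) (\<phi>' a)"]
    by (simp add: has_field_derivative_def)
  then obtain a where a: "0 < a" "a < s" "\<phi> s - \<phi> 0 = s * \<phi>' a" by auto
  define \<psi> where "\<psi> b = partial_within S i f (x + a *\<^sub>R axis i 1 + b *\<^sub>R axis j 1)" for b
  define \<psi>' where "\<psi>' b = partial_within S j (partial_within S i f) (x + a *\<^sub>R axis i 1 + b *\<^sub>R axis j 1)" for b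
  have "(\<psi> has_real_derivative \<psi>' b) (at b within {0..t})" if "0 \<le> b" "b \<le> t" for b
    unfolding \<psi>_def \<psi>'_def using sub that a
    by (intro has_real_derivative_along_axis[OF S f2(1)]) auto
  then have "\<exists>b\<in>{0<..<t}. \<psi> t - \<psi> 0 = \<psi>' b * (t - 0)"
    using mvt_simple[OF st(2), of \<psi> "\<lambda>b. (*) (\<psi>' b)"]
    by (simp add: has_field_derivative_def)
  then obtain b where b: "0 < b" "b < t" "\<psi> t - \<psi> 0 = t * \<psi>' b" by auto
  have "\<phi>' a = \<psi> t - \<psi> 0" by (simp add: \<phi>'_def \<psi>_def add_ac)
  with a b have "\<phi> s - \<phi> 0 = s * t * \<psi>' b" by simp
  then show thesis using that[of a b] a b by (simp add: \<phi>_def \<psi>'_def algebra_simps)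
qed

lemma partial_within_commute:
  fixes f :: "real^2 \<Rightarrow> real"
  assumes S: "hopen S" and f: "C_k_on 2 S f" and x: "x \<in> S"
  shows "partial_within S 1 (partial_within S 2 f) x = partial_within S 2 (partial_within S 1 f) x"
proof -
  obtain r where r: "r > 0"
    "\<And>s t. \<lbrakk>0 \<le> s; s < r; 0 \<le> t; t < r\<rbrakk> \<Longrightarrow> x + s *\<^sub>R axis 1 1 + t *\<^sub>R axis 2 1 \<in> S"
    using hopen_contains_segment[OF S x] by blast
  have r': "x + s *\<^sub>R axis 2 1 + t *\<^sub>R axis 1 1 \<in> S" if "0 \<le> s" "s < r" "0 \<le> t" "t < r" for s t
    using r(2)[of t s] that by (simp add: add_ac)
  \<comment> \<open>The summand 2 keeps \<open>d n\<close> strictly below \<open>r\<close> already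
    for \<open>n = 0\<close>, so the closed square of side \<open>d n\<close> stays in
    \<open>S\<close>.\<close>
  define d where "d n = r / real (n + 2)" for n
  have d: "0 < d n" "d n < r" for n using r(1) by (auto simp: d_def field_simps add_pos_nonneg)
  have "d \<longlonglongrightarrow> 0" unfolding d_def
    by (rule LIMSEQ_ignore_initial_segment[OF lim_const_over_n])
  have "\<exists>a b a' b'. 0 \<le> a \<and> a \<le> d n \<and> 0 \<le> b \<and> b \<le> d n \<and> 0 \<le> a' \<and> a' \<le> d n \<and> 0 \<le> b' \<and> b' \<le> d n \<and>
      partial_within S 2 (partial_within S 1 f) (x + a *\<^sub>R axis 1 1 + b *\<^sub>R axis 2 1)
      = partial_within S 1 (partial_within S 2 f) (x + a' *\<^sub>R axis 2 1 + b' *\<^sub>R axis 1 1)" for n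
  proof -
    obtain a b where 1: "0 \<le> a" "a \<le> d n" "0 \<le> b" "b \<le> d n"
      "f (x + d n *\<^sub>R axis 1 1 + d n *\<^sub>R axis 2 1) - f (x + d n *\<^sub>R axis 1 1) - f (x + d n *\<^sub>R axis 2 1) + f x
      = d n * d n * partial_within S 2 (partial_within S 1 f) (x + a *\<^sub>R axis 1 1 + b *\<^sub>R axis 2 1)"
      by (rule second_difference_mean_value[OF S f d(1)[of n] d(1)[of n], of x 1 2])
        (use r(2) d(2)[of n] in auto)
    obtain a' b' where 2: "0 \<le> a'" "a' \<le> d n" "0 \<le> b'" "b' \<le> d n"
      "f (x + d n *\<^sub>R axis 2 1 + d n *\<^sub>R axis 1 1) - f (x + d n *\<^sub>R axis 2 1) - f (x + d n *\<^sub>R axis 1 1) + f x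
      = d n * d n * partial_within S 1 (partial_within S 2 f) (x + a' *\<^sub>R axis 2 1 + b' *\<^sub>R axis 1 1)"
      by (rule second_difference_mean_value[OF S f d(1)[of n] d(1)[of n], of x 2 1])
        (use r' d(2)[of n] in auto)
    \<comment> \<open>Both sides are the same second difference; dividing by the area leaves the two
      mixed partials at points that tend to \<open>x\<close>.\<close>
    have "d n * d n * partial_within S 2 (partial_within S 1 f) (x + a *\<^sub>R axis 1 1 + b *\<^sub>R axis 2 1)
      = d n * d n * partial_within S 1 (partial_within S 2 f) (x + a' *\<^sub>R axis 2 1 + b' *\<^sub>R axis 1 1)"
    proof -
      have corner: "x + d n *\<^sub>R axis 2 1 + d n *\<^sub>R axis 1 1 = x + d n *\<^sub>R axis 1 1 + d n *\<^sub>R axis 2 1"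
        by (simp only: add_ac)
      show ?thesis using 1(5) 2(5)[unfolded corner] by linarith
    qed
    then have "partial_within S 2 (partial_within S 1 f) (x + a *\<^sub>R axis 1 1 + b *\<^sub>R axis 2 1)
      = partial_within S 1 (partial_within S 2 f) (x + a' *\<^sub>R axis 2 1 + b' *\<^sub>R axis 1 1)"
      using d(1)[of n] by simp
    with 1 2 show ?thesis by blast
  qed
  then obtain a b a' b' where ab: "\<And>n. 0 \<le> a n" "\<And>n. a n \<le> d n" "\<And>n. 0 \<le> b n" "\<And>n. b n \<le> d n"
    "\<And>n. 0 \<le> a' n" "\<And>n. a' n \<le> d n" "\<And>n. 0 \<le> b' n" "\<And>n. b' n \<le> d n"
    and eq: "\<And>n. partial_within S 2 (partial_within S 1 f) (x + a n *\<^sub>R axis 1 1 + b n *\<^sub>R axis 2 1)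
      = partial_within S 1 (partial_within S 2 f) (x + a' n *\<^sub>R axis 2 1 + b' n *\<^sub>R axis 1 1)"
    by metis
  have lt: "a n < r" "b n < r" "a' n < r" "b' n < r" for n
    using ab(2)[of n] ab(4)[of n] ab(6)[of n] ab(8)[of n] d(2)[of n] by linarith+
  have lim0: "c \<longlonglongrightarrow> 0" if "\<And>n. 0 \<le> c n" "\<And>n. c n \<le> d n" for c :: "nat \<Rightarrow> real"
    using tendsto_sandwich[of "\<lambda>_. 0" c sequentially d 0] \<open>d \<longlonglongrightarrow> 0\<close> that by simp
  have limx: "(\<lambda>n. x + c n *\<^sub>R axis i 1 + e n *\<^sub>R axis j 1) \<longlonglongrightarrow> x" if "c \<longlonglongrightarrow> 0" "e \<longlonglongrightarrow> 0" for c e i j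
    using tendsto_add[OF tendsto_add[OF tendsto_const[of x] tendsto_scaleR[OF that(1) tendsto_const[of "axis i 1"]]]
       tendsto_scaleR[OF that(2) tendsto_const[of "axis j 1"]]] by simp
  have cont: "continuous_on S (partial_within S i (partial_within S j f))" for i j
    using C_k_on_SucD(2)[OF C_k_on_SucD(2)[OF f[unfolded numeral_2_eq_2]]] by simp
  have "(\<lambda>n. partial_within S 2 (partial_within S 1 f) (x + a n *\<^sub>R axis 1 1 + b n *\<^sub>R axis 2 1))
      \<longlonglongrightarrow> partial_within S 2 (partial_within S 1 f) x"
    using ab by (intro continuous_on_tendsto_compose[OF cont limx[OF lim0 lim0] x])
      (auto intro!: always_eventually r(2) lt)
  moreover have "(\<lambda>n. partial_within S 1 (partial_within S 2 f) (x + a' n *\<^sub>R axis 2 1 + b' n *\<^sub>R axis 1 1))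
      \<longlonglongrightarrow> partial_within S 1 (partial_within S 2 f) x"
    using ab by (intro continuous_on_tendsto_compose[OF cont limx[OF lim0 lim0] x])
      (auto intro!: always_eventually r' lt)
  ultimately show ?thesis using LIMSEQ_unique unfolding eq by blast
qed

text \<open>The Piola identity for the cofactor matrix of the derivative of \<open>\<tau>\<close>.\<close>

lemma divergence_pullback:
  fixes \<tau> :: "real^2 \<Rightarrow> real^2" and Z\<^sub>1 Z\<^sub>2 :: "real^2 \<Rightarrow> real"
  assumes S: "hopen S" and T: "hopen T" and x: "x \<in> S" and sub: "\<tau> ` S \<subseteq> T"
    and \<tau>: "C_k_on 2 S \<tau>" and Z: "C_k_on 1 T Z\<^sub>1" "C_k_on 1 T Z\<^sub>2"
  defines "D \<equiv> \<lambda>i j. partial_within S i (\<lambda>x. \<tau> x $ j)"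
  shows "partial_within S 1 (\<lambda>x. D 2 2 x * Z\<^sub>1 (\<tau> x) - D 2 1 x * Z\<^sub>2 (\<tau> x)) x
       + partial_within S 2 (\<lambda>x. D 1 1 x * Z\<^sub>2 (\<tau> x) - D 1 2 x * Z\<^sub>1 (\<tau> x)) x
    = (D 1 1 x * D 2 2 x - D 2 1 x * D 1 2 x)
      * (partial_within T 1 Z\<^sub>1 (\<tau> x) + partial_within T 2 Z\<^sub>2 (\<tau> x))"
proof -
  have c2: "C_k_on 2 S (\<lambda>x. \<tau> x $ j)" for j by (rule C_k_on_component[OF S \<tau>])
  have d\<tau>: "\<tau> differentiable (at x within S)"
    using C_k_on_SucD(1)[OF \<tau>[unfolded numeral_2_eq_2]] x by blast
  have D: "D i j differentiable (at x within S)" for i j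
    unfolding D_def
    using C_k_on_SucD(1)[OF C_k_on_SucD(2)[OF c2[unfolded numeral_2_eq_2]]] x by blast
  have Zd: "Z\<^sub>1 differentiable (at (\<tau> x) within T)" "Z\<^sub>2 differentiable (at (\<tau> x) within T)"
    using C_k_on_SucD(1)[OF Z(1)[unfolded One_nat_def]] C_k_on_SucD(1)[OF Z(2)[unfolded One_nat_def]] x sub by auto
  have comp: "partial_within S i \<tau> x $ j = D i j x" for i j
    unfolding D_def using partial_within_component(1)[OF S x d\<tau>] by simp
  note Z1 = chain_partial[OF S T x sub d\<tau> Zd(1), unfolded comp]
  note Z2 = chain_partial[OF S T x sub d\<tau> Zd(2), unfolded comp]
  have *: "partial_within S i (\<lambda>x. D k l x * Z\<^sub>1 (\<tau> x) - D m n x * Z\<^sub>2 (\<tau> x)) x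
      = D k l x * partial_within S i (\<lambda>x. Z\<^sub>1 (\<tau> x)) x + partial_within S i (D k l) x * Z\<^sub>1 (\<tau> x)
       - (D m n x * partial_within S i (\<lambda>x. Z\<^sub>2 (\<tau> x)) x + partial_within S i (D m n) x * Z\<^sub>2 (\<tau> x))"
    for i k l m n
    using partial_within_diff[OF S x differentiable_mult[OF D Z1(2)] differentiable_mult[OF D Z2(2)]]
      partial_within_mult[OF S x D Z1(2)] partial_within_mult[OF S x D Z2(2)] by simp
  have **: "partial_within S i (\<lambda>x. D m n x * Z\<^sub>2 (\<tau> x) - D k l x * Z\<^sub>1 (\<tau> x)) x
      = D m n x * partial_within S i (\<lambda>x. Z\<^sub>2 (\<tau> x)) x + partial_within S i (D m n) x * Z\<^sub>2 (\<tau> x)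
       - (D k l x * partial_within S i (\<lambda>x. Z\<^sub>1 (\<tau> x)) x + partial_within S i (D k l) x * Z\<^sub>1 (\<tau> x))"
    for i k l m n
    using partial_within_diff[OF S x differentiable_mult[OF D Z2(2)] differentiable_mult[OF D Z1(2)]]
      partial_within_mult[OF S x D Z1(2)] partial_within_mult[OF S x D Z2(2)] by simp
  \<comment> \<open>Equality of mixed partials removes every term in which a cofactor is
    differentiated; what remains is the determinant times the divergence.\<close>
  have sym: "partial_within S 1 (D 2 j) x = partial_within S 2 (D 1 j) x" for j
    unfolding D_def by (rule partial_within_commute[OF S c2 x])
  show ?thesis unfolding * ** Z1(1) Z2(1) sym by (simp add: algebra_simps)
qed

section \<open>Calculus in charts\<close>

lemma matrix_inv_unique:
  fixes A :: "'a::semiring_1^'n^'n"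
  assumes "A ** B = mat 1" "B ** A = mat 1"
  shows "matrix_inv A = B"
proof -
  have "A ** matrix_inv A = mat 1 \<and> matrix_inv A ** A = mat 1"
    unfolding matrix_inv_def using assms by (rule_tac someI_ex) blast
  then have "matrix_inv A = matrix_inv A ** (A ** B)" "(matrix_inv A ** A) ** B = B"
    using assms by simp_all
  then show ?thesis by (simp add: matrix_mul_assoc)
qed

text \<open>A finite degree is tracked because the bumps used later are shown to be
  \<open>C^1\<close>; smoothness is the statement for all \<open>k\<close>.\<close>

definition C_chart :: "nat \<Rightarrow> 'a chart \<Rightarrow> ('a \<Rightarrow> real) \<Rightarrow> bool" where
  "C_chart k c f \<longleftrightarrow> C_k_on k (cimg c) (\<lambda>x. f (cinv c x))"

definition C_fun :: "nat \<Rightarrow> 'a chart set \<Rightarrow> ('a \<Rightarrow> real) \<Rightarrow> bool" where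
  "C_fun k A f \<longleftrightarrow> (\<forall>c\<in>A. C_chart k c f)"

definition C_vfield :: "nat \<Rightarrow> 'a chart set \<Rightarrow> 'a vec_field \<Rightarrow> bool" where
  "C_vfield k A X \<longleftrightarrow>
     (\<forall>c\<in>A. \<forall>j. C_chart k c (\<lambda>p. X c p $ j)) \<and>
     (\<forall>c\<in>A. \<forall>d\<in>A. \<forall>p\<in>cdom c \<inter> cdom d. X d p = jacobian c d p *v X c p)"

text \<open>The derivative of \<open>f\<close> along \<open>X\<close>. The chart is chosen as in
  \<open>divergence\<close>; \<open>vec_deriv_eq\<close> shows that the choice is immaterial for
  fields with the correct transformation law.\<close>

definition vec_deriv :: "'a chart set \<Rightarrow> 'a vec_field \<Rightarrow> ('a \<Rightarrow> real) \<Rightarrow> 'a \<Rightarrow> real" where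
  "vec_deriv A X f p = (let c = chart_at A p in \<Sum>i\<in>UNIV. X c p $ i * cpartial c i f p)"

lemma smooth_fun_iff: "smooth_fun A f \<longleftrightarrow> (\<forall>k. C_fun k A f)"
  by (auto simp: smooth_fun_def smooth_on_def C_fun_def C_chart_def o_def)

lemma jacobian_component:
  "jacobian c d p $ j $ i
    = partial_within (cmap c ` (cdom c \<inter> cdom d)) i (cmap d \<circ> cinv c) (cmap c p) $ j"
  by (simp add: jacobian_def matrix_def partial_within_def)

lemma C_funD: "C_fun k A f \<Longrightarrow> c \<in> A \<Longrightarrow> C_chart k c f"
  unfolding C_fun_def by blast

lemma C_funI: "(\<And>c. c \<in> A \<Longrightarrow> C_chart k c f) \<Longrightarrow> C_fun k A f"
  unfolding C_fun_def by blast

lemma C_vfieldD: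
  assumes "C_vfield k A X" "c \<in> A"
  shows "C_chart k c (\<lambda>p. X c p $ j)"
    and "\<lbrakk>d \<in> A; p \<in> cdom c; p \<in> cdom d\<rbrakk> \<Longrightarrow> X d p = jacobian c d p *v X c p"
  using assms unfolding C_vfield_def by blast+

lemma C_vfieldI:
  assumes "\<And>c j. c \<in> A \<Longrightarrow> C_chart k c (\<lambda>p. X c p $ j)"
    and "\<And>c d p. \<lbrakk>c \<in> A; d \<in> A; p \<in> cdom c; p \<in> cdom d\<rbrakk> \<Longrightarrow> X d p = jacobian c d p *v X c p"
  shows "C_vfield k A X"
  using assms unfolding C_vfield_def by blast

locale oriented_riemannian_surface =
  fixes M :: "'a::t2_space set" and A :: "'a chart set" and g :: "'a metric"
  assumes compact_M: "compact M"
    and oriented: "oriented_atlas M A"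
    and metric: "riemannian_metric A g"
begin

lemma is_chart: "c \<in> A \<Longrightarrow> is_chart M c"
  using oriented by (simp add: oriented_atlas_def smooth_atlas_def)

lemma cdom_open: "c \<in> A \<Longrightarrow> openin (top_of_set M) (cdom c)"
  using is_chart by (auto simp: is_chart_def)

lemma cdom_subset: "c \<in> A \<Longrightarrow> cdom c \<subseteq> M"
  using cdom_open openin_imp_subset by blast

lemma cimg_hopen: "c \<in> A \<Longrightarrow> hopen (cimg c)"
  using is_chart by (auto simp: is_chart_def)

lemma chart_homeomorphism: "c \<in> A \<Longrightarrow> homeomorphism (cdom c) (cimg c) (cmap c) (cinv c)"
  using is_chart by (auto simp: is_chart_def)

lemma cinv_cmap [simp]: "c \<in> A \<Longrightarrow> p \<in> cdom c \<Longrightarrow> cinv c (cmap c p) = p"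
  using chart_homeomorphism by (auto simp: homeomorphism_def)

lemma cmap_cinv [simp]: "x \<in> cimg c \<Longrightarrow> cmap c (cinv c x) = x"
  by (rule f_inv_into_f)

lemma cinv_in: "x \<in> cimg c \<Longrightarrow> cinv c x \<in> cdom c"
  by (rule inv_into_into)

lemma inj_on_cmap: "c \<in> A \<Longrightarrow> inj_on (cmap c) (cdom c)"
  using cinv_cmap by (metis inj_on_inverseI)

lemma chart_at:
  assumes "p \<in> M"
  shows "chart_at A p \<in> A" "p \<in> cdom (chart_at A p)"
proof -
  have "\<exists>c. c \<in> A \<and> p \<in> cdom c"
    using oriented assms by (auto simp: oriented_atlas_def smooth_atlas_def)
  then have "chart_at A p \<in> A \<and> p \<in> cdom (chart_at A p)"
    unfolding chart_at_def by (rule someI_ex)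
  then show "chart_at A p \<in> A" "p \<in> cdom (chart_at A p)" by auto
qed

lemma image_hopen:
  assumes "c \<in> A" "openin (top_of_set M) U" "U \<subseteq> cdom c"
  shows "hopen (cmap c ` U)"
proof -
  have "openin (top_of_set (cdom c)) U"
    using assms cdom_subset by (intro openin_subset_trans[OF assms(2)]) auto
  then have "openin (top_of_set (cimg c)) (cmap c ` U)"
    by (rule homeomorphism_imp_open_map[OF chart_homeomorphism[OF assms(1)]])
  then show ?thesis using cimg_hopen[OF assms(1)] openin_trans by blast
qed

lemma overlap_hopen: "c \<in> A \<Longrightarrow> d \<in> A \<Longrightarrow> hopen (cmap c ` (cdom c \<inter> cdom d))"
  by (rule image_hopen[OF _ openin_Int[OF cdom_open cdom_open]]) auto

lemma transition_C_k:
  "c \<in> A \<Longrightarrow> d \<in> A \<Longrightarrow> C_k_on k (cmap c ` (cdom c \<inter> cdom d)) (cmap d \<circ> cinv c)"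
  using oriented by (auto simp: oriented_atlas_def smooth_atlas_def smooth_on_def)

lemma transition_image:
  "c \<in> A \<Longrightarrow> d \<in> A \<Longrightarrow> (cmap d \<circ> cinv c) ` (cmap c ` (cdom c \<inter> cdom d)) \<subseteq> cimg d"
  by auto

lemma det_jacobian_pos: "c \<in> A \<Longrightarrow> d \<in> A \<Longrightarrow> p \<in> cdom c \<inter> cdom d \<Longrightarrow> det (jacobian c d p) > 0"
  using oriented by (auto simp: oriented_atlas_def)

section \<open>Regularity and partial derivatives of functions in charts\<close>

lemma C_chart_cong:
  "(\<And>p. p \<in> cdom c \<Longrightarrow> f p = h p) \<Longrightarrow> C_chart k c f \<longleftrightarrow> C_chart k c h"
  unfolding C_chart_def by (rule C_k_on_cong) (simp add: cinv_in)

lemma C_chart_eqI: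
  "(\<And>p. p \<in> cdom c \<Longrightarrow> f p = h p) \<Longrightarrow> C_chart k c h \<Longrightarrow> C_chart k c f"
  using C_chart_cong[of c f h k] by blast

lemma C_chart_mono: "C_chart k c f \<Longrightarrow> j \<le> k \<Longrightarrow> C_chart j c f"
  unfolding C_chart_def by (rule C_k_on_mono)

lemma C_chart_add: "c \<in> A \<Longrightarrow> C_chart k c f \<Longrightarrow> C_chart k c h \<Longrightarrow> C_chart k c (\<lambda>p. f p + h p)"
  unfolding C_chart_def by (rule C_k_on_add[OF cimg_hopen])

lemma C_chart_diff: "c \<in> A \<Longrightarrow> C_chart k c f \<Longrightarrow> C_chart k c h \<Longrightarrow> C_chart k c (\<lambda>p. f p - h p)"
  unfolding C_chart_def by (rule C_k_on_diff[OF cimg_hopen])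

lemma C_chart_minus: "c \<in> A \<Longrightarrow> C_chart k c f \<Longrightarrow> C_chart k c (\<lambda>p. - f p)"
  unfolding C_chart_def by (rule C_k_on_minus[OF cimg_hopen])

lemma C_chart_mult: "c \<in> A \<Longrightarrow> C_chart k c f \<Longrightarrow> C_chart k c h \<Longrightarrow> C_chart k c (\<lambda>p. f p * h p)"
  unfolding C_chart_def by (rule C_k_on_mult[OF cimg_hopen])

lemma C_chart_divide:
  "c \<in> A \<Longrightarrow> C_chart k c f \<Longrightarrow> C_chart k c h \<Longrightarrow> (\<And>p. p \<in> cdom c \<Longrightarrow> h p \<noteq> 0)
    \<Longrightarrow> C_chart k c (\<lambda>p. f p / h p)"
  unfolding C_chart_def by (rule C_k_on_divide[OF cimg_hopen]) (auto dest: cinv_in)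

lemma C_chart_sqrt:
  "c \<in> A \<Longrightarrow> C_chart k c f \<Longrightarrow> (\<And>p. p \<in> cdom c \<Longrightarrow> f p > 0) \<Longrightarrow> C_chart k c (\<lambda>p. sqrt (f p))"
  unfolding C_chart_def by (rule C_k_on_sqrt[OF cimg_hopen]) (auto dest: cinv_in)

lemma C_chart_sum:
  "c \<in> A \<Longrightarrow> (\<And>j. j \<in> I \<Longrightarrow> C_chart k c (f j)) \<Longrightarrow> C_chart k c (\<lambda>p. \<Sum>j\<in>I. f j p)"
  unfolding C_chart_def by (rule C_k_on_sum[OF cimg_hopen])

lemma cpartial_altdef: "cpartial c i f p = partial_within (cimg c) i (\<lambda>x. f (cinv c x)) (cmap c p)"
  by (simp add: cpartial_def o_def)

lemma C_chart_differentiable: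
  "C_chart (Suc k) c f \<Longrightarrow> p \<in> cdom c \<Longrightarrow> (\<lambda>x. f (cinv c x)) differentiable (at (cmap c p) within cimg c)"
  unfolding C_chart_def by (rule C_k_on_SucD(1)) auto

lemma C_chart_cpartial: "C_chart (Suc k) c f \<Longrightarrow> C_chart k c (cpartial c i f)"
  using C_k_on_cong[of "cimg c" "\<lambda>x. cpartial c i f (cinv c x)"
      "partial_within (cimg c) i (\<lambda>x. f (cinv c x))" k]
  by (auto simp: C_chart_def cpartial_altdef intro: C_k_on_SucD(2) simp del: C_k_on.simps)

lemma cpartial_cong:
  "p \<in> cdom c \<Longrightarrow> (\<And>q. q \<in> cdom c \<Longrightarrow> f q = h q) \<Longrightarrow> cpartial c i f p = cpartial c i h p"
  unfolding cpartial_altdef by (rule partial_within_cong) (auto simp: cinv_in)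

lemma cpartial_const [simp]: "c \<in> A \<Longrightarrow> p \<in> cdom c \<Longrightarrow> cpartial c i (\<lambda>q. a) p = 0"
  unfolding cpartial_altdef by (simp add: cimg_hopen)

lemma cpartial_add:
  assumes "c \<in> A" "p \<in> cdom c" "C_chart (Suc k) c f" "C_chart (Suc l) c h"
  shows "cpartial c i (\<lambda>q. f q + h q) p = cpartial c i f p + cpartial c i h p"
  unfolding cpartial_altdef using assms
  by (intro partial_within_add cimg_hopen C_chart_differentiable) auto

lemma cpartial_minus:
  assumes "c \<in> A" "p \<in> cdom c" "C_chart (Suc k) c f"
  shows "cpartial c i (\<lambda>q. - f q) p = - cpartial c i f p"
  unfolding cpartial_altdef using assms
  by (intro partial_within_minus(1) cimg_hopen C_chart_differentiable) auto

lemma cpartial_mult: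
  assumes "c \<in> A" "p \<in> cdom c" "C_chart (Suc k) c f" "C_chart (Suc l) c h"
  shows "cpartial c i (\<lambda>q. f q * h q) p = f p * cpartial c i h p + cpartial c i f p * h p"
  unfolding cpartial_altdef
  using partial_within_mult[OF cimg_hopen[OF assms(1)] _ C_chart_differentiable[OF assms(3,2)]
      C_chart_differentiable[OF assms(4,2)], of i] assms(1,2)
  by simp

lemma cpartial_sum:
  assumes "c \<in> A" "p \<in> cdom c" "\<And>j. j \<in> I \<Longrightarrow> C_chart (Suc k) c (f j)"
  shows "cpartial c i (\<lambda>q. \<Sum>j\<in>I. f j q) p = (\<Sum>j\<in>I. cpartial c i (f j) p)"
  using assms(3)
proof (induction I rule: infinite_finite_induct)
  case (insert j I)
  then show ?case
    using cpartial_add[OF assms(1,2), of k "f j" k "\<lambda>q. \<Sum>j\<in>I. f j q"] C_chart_sum[OF assms(1), of I "Suc k" f]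
    by simp
qed (simp_all add: assms(1,2))

lemma cpartial_commute:
  assumes "c \<in> A" "p \<in> cdom c" "C_chart 2 c f"
  shows "cpartial c 1 (cpartial c 2 f) p = cpartial c 2 (cpartial c 1 f) p"
proof -
  have "cpartial c i (cpartial c j f) p
      = partial_within (cimg c) i (partial_within (cimg c) j (\<lambda>x. f (cinv c x))) (cmap c p)" for i j
    unfolding cpartial_altdef using assms(2) by (intro partial_within_cong) auto
  then show ?thesis
    using partial_within_commute[OF cimg_hopen[OF assms(1)] assms(3)[unfolded C_chart_def]] assms(2)
    by simp
qed

lemma partial_within_overlap:
  assumes "c \<in> A" "d \<in> A" "p \<in> cdom c \<inter> cdom d"
  shows "cpartial c i f p = partial_within (cmap c ` (cdom c \<inter> cdom d)) i (\<lambda>x. f (cinv c x)) (cmap c p)"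
  unfolding cpartial_altdef using assms
  by (intro partial_within_subset cimg_hopen overlap_hopen) auto

text \<open>Chain rule for \<open>f \<circ> cinv c = (f \<circ> cinv d) \<circ> \<tau>\<close> with
  the transition map \<tau>, on the image of the overlap.\<close>

lemma cpartial_transform:
  assumes "c \<in> A" "d \<in> A" "p \<in> cdom c \<inter> cdom d" "C_chart (Suc k) d f"
  shows "cpartial c i f p
    = jacobian c d p $ 1 $ i * cpartial d 1 f p + jacobian c d p $ 2 $ i * cpartial d 2 f p"
proof -
  let ?S = "cmap c ` (cdom c \<inter> cdom d)" and ?\<tau> = "cmap d \<circ> cinv c"
  have x: "cmap c p \<in> ?S" and \<tau>x: "?\<tau> (cmap c p) = cmap d p" using assms by auto
  have "cpartial c i f p = partial_within ?S i (\<lambda>x. f (cinv d (?\<tau> x))) (cmap c p)"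
    unfolding partial_within_overlap[OF assms(1-3)] by (rule partial_within_cong[OF x]) (use assms in auto)
  also have "\<dots> = jacobian c d p $ 1 $ i * cpartial d 1 f p + jacobian c d p $ 2 $ i * cpartial d 2 f p"
    using chain_partial(1)[OF overlap_hopen[OF assms(1,2)] cimg_hopen[OF assms(2)] x transition_image[OF assms(1,2)]
      C_k_on_SucD(1)[OF transition_C_k[OF assms(1,2)] x], of "\<lambda>x. f (cinv d x)" i]
      C_chart_differentiable[OF assms(4)] assms(3) \<tau>x
    by (simp add: jacobian_component cpartial_altdef)
  finally show ?thesis .
qed

text \<open>Components of \<open>X\<close> transform by the Jacobian and partials of
  \<open>f\<close> by its transpose, so their pairing in \<open>chart_at A p\<close> equals the
  pairing in any other chart around \<open>p\<close>.\<close>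

lemma vec_deriv_eq:
  assumes "c \<in> A" "p \<in> cdom c" "C_vfield k A X" "C_fun (Suc l) A f"
  shows "vec_deriv A X f p = X c p $ 1 * cpartial c 1 f p + X c p $ 2 * cpartial c 2 f p"
proof -
  let ?d = "chart_at A p"
  have p: "p \<in> M" using cdom_subset[OF assms(1)] assms(2) by blast
  have d: "?d \<in> A" "p \<in> cdom ?d" using chart_at[OF p] by auto
  have X: "X ?d p = jacobian c ?d p *v X c p"
    using C_vfieldD(2)[OF assms(3,1) d(1) assms(2) d(2)] .
  have f: "C_chart (Suc l) ?d f" using C_funD[OF assms(4) d(1)] .
  note t = cpartial_transform[OF assms(1) d(1) _ f]
  show ?thesis using t[of p 1] t[of p 2] assms(2) d(2)
    by (simp add: vec_deriv_def Let_def sum_2 X matrix_vector_mult_def algebra_simps)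
qed

lemma C_fun_mono: "C_fun k A f \<Longrightarrow> j \<le> k \<Longrightarrow> C_fun j A f"
  by (blast intro: C_funI C_chart_mono dest: C_funD)

lemma C_vfield_mono: "C_vfield k A X \<Longrightarrow> j \<le> k \<Longrightarrow> C_vfield j A X"
  unfolding C_vfield_def by (blast intro: C_chart_mono)

lemma C_fun_mult: "C_fun k A f \<Longrightarrow> C_fun k A h \<Longrightarrow> C_fun k A (\<lambda>p. f p * h p)"
  by (blast intro: C_funI C_chart_mult dest: C_funD)

lemma C_fun_const: "C_fun k A (\<lambda>p. a)"
  unfolding C_fun_def C_chart_def by (blast intro: C_k_on_const cimg_hopen)

lemma C_fun_vec_deriv:
  assumes "C_vfield k A X" "C_fun (Suc k) A f"
  shows "C_fun k A (vec_deriv A X f)"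
proof (rule C_funI)
  fix c assume c: "c \<in> A"
  note f = C_chart_cpartial[OF C_funD[OF assms(2) c]] and X = C_vfieldD(1)[OF assms(1) c]
  show "C_chart k c (vec_deriv A X f)"
    by (rule C_chart_eqI[OF vec_deriv_eq[OF c _ assms]]) (assumption, intro C_chart_add C_chart_mult c f X)
qed

lemma C_vfield_scale:
  assumes "C_fun k A f" "C_vfield k A X"
  shows "C_vfield k A (\<lambda>c p. f p *\<^sub>R X c p)"
proof (rule C_vfieldI)
  fix c j assume c: "c \<in> A"
  show "C_chart k c (\<lambda>p. (f p *\<^sub>R X c p) $ j)"
    using C_chart_mult[OF c C_funD[OF assms(1) c] C_vfieldD(1)[OF assms(2) c]] by simp
next
  fix c d p assume *: "c \<in> A" "d \<in> A" "p \<in> cdom c" "p \<in> cdom d"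
  show "f p *\<^sub>R X d p = jacobian c d p *v (f p *\<^sub>R X c p)"
    by (subst C_vfieldD(2)[OF assms(2) *]) (simp add: matrix_vector_mult_scaleR)
qed

subsection \<open>The metric\<close>

lemma metric_C_chart: "c \<in> A \<Longrightarrow> C_chart k c (\<lambda>p. g c p $ i $ j)"
  using metric C_k_on_component[OF cimg_hopen C_k_on_component[OF cimg_hopen]]
  unfolding C_chart_def riemannian_metric_def smooth_on_def o_def by blast

lemma metric_symmetric: "c \<in> A \<Longrightarrow> p \<in> cdom c \<Longrightarrow> g c p $ 2 $ 1 = g c p $ 1 $ 2"
proof -
  assume "c \<in> A" "p \<in> cdom c"
  then have "transpose (g c p) = g c p" using metric unfolding riemannian_metric_def by blast
  then have "transpose (g c p) $ 1 $ 2 = g c p $ 1 $ 2" by simp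
  then show ?thesis by (simp add: transpose_def)
qed

lemma metric_positive: "c \<in> A \<Longrightarrow> p \<in> cdom c \<Longrightarrow> v \<noteq> 0 \<Longrightarrow> v \<bullet> (g c p *v v) > 0"
  using metric unfolding riemannian_metric_def by blast

lemma metric_transform:
  "c \<in> A \<Longrightarrow> d \<in> A \<Longrightarrow> p \<in> cdom c \<inter> cdom d
    \<Longrightarrow> g c p = transpose (jacobian c d p) ** g d p ** jacobian c d p"
  using metric unfolding riemannian_metric_def by blast

lemma det_metric: "c \<in> A \<Longrightarrow> p \<in> cdom c \<Longrightarrow> det (g c p) = g c p $ 1 $ 1 * g c p $ 2 $ 2 - (g c p $ 1 $ 2)\<^sup>2"
  by (simp add: det_2 metric_symmetric power2_eq_square)

lemma det_metric_pos:
  assumes "c \<in> A" "p \<in> cdom c"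
  shows "det (g c p) > 0"
proof -
  have mv: "v \<bullet> (g c p *v v) = g c p $ 1 $ 1 * (v $ 1)\<^sup>2 + 2 * g c p $ 1 $ 2 * v $ 1 * v $ 2 + g c p $ 2 $ 2 * (v $ 2)\<^sup>2" for v
    by (simp add: inner_vec_def sum_2 matrix_vector_mult_def metric_symmetric[OF assms] power2_eq_square algebra_simps)
  have a: "g c p $ 1 $ 1 > 0"
    using metric_positive[OF assms, of "vector [1, 0]"] by (simp add: mv vec_eq_iff forall_2)
  \<comment> \<open>At the vector \<open>(- g12, g11)\<close> the quadratic form takes the value
    \<open>g11 * det g\<close>.\<close>
  have "g c p $ 1 $ 1 * det (g c p) > 0"
    using metric_positive[OF assms, of "vector [- g c p $ 1 $ 2, g c p $ 1 $ 1]"] a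
    by (simp add: mv det_metric[OF assms] vec_eq_iff forall_2 power2_eq_square algebra_simps)
  with a show ?thesis by (simp add: zero_less_mult_iff)
qed

lemma vol_density_pos: "c \<in> A \<Longrightarrow> p \<in> cdom c \<Longrightarrow> vol_density g c p > 0"
  by (simp add: vol_density_def det_metric_pos)

lemma vol_density_C_chart: "c \<in> A \<Longrightarrow> C_chart k c (vol_density g c)"
  unfolding vol_density_def
  by (intro C_chart_sqrt det_metric_pos) (auto simp: det_2 intro!: C_chart_diff C_chart_mult metric_C_chart)

text \<open>\<open>det g\<close> picks up the square of the Jacobian determinant, and the
  orientation makes that determinant positive, so it is its own absolute value under the
  root.\<close>

lemma vol_density_transform:
  assumes "c \<in> A" "d \<in> A" "p \<in> cdom c \<inter> cdom d"
  shows "vol_density g c p = det (jacobian c d p) * vol_density g d p"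
  unfolding vol_density_def metric_transform[OF assms] using det_jacobian_pos[OF assms]
  by (simp add: det_mul det_transpose real_sqrt_mult)

lemma metric_mult_gradient:
  assumes "c \<in> A" "p \<in> cdom c"
  shows "g c p *v gradient g f c p = (\<chi> i. cpartial c i f p)"
    and "gradient g f c p $ 1 = (g c p $ 2 $ 2 * cpartial c 1 f p - g c p $ 1 $ 2 * cpartial c 2 f p) / det (g c p)"
    and "gradient g f c p $ 2 = (g c p $ 1 $ 1 * cpartial c 2 f p - g c p $ 1 $ 2 * cpartial c 1 f p) / det (g c p)"
proof -
  let ?D = "det (g c p)"
  \<comment> \<open>Adjugate over determinant. It is checked from both sides because
    \<open>matrix_inv\<close> is defined by choice.\<close>
  define B :: "real^2^2" where "B = (1 / ?D) *\<^sub>R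
    vector [vector [g c p $ 2 $ 2, - g c p $ 1 $ 2], vector [- g c p $ 1 $ 2, g c p $ 1 $ 1]]"
  have D: "?D = g c p $ 1 $ 1 * g c p $ 2 $ 2 - (g c p $ 1 $ 2)\<^sup>2" "?D \<noteq> 0"
    using det_metric[OF assms] det_metric_pos[OF assms] by auto
  have B: "B $ 1 $ 1 = g c p $ 2 $ 2 / ?D" "B $ 1 $ 2 = - g c p $ 1 $ 2 / ?D"
    "B $ 2 $ 1 = - g c p $ 1 $ 2 / ?D" "B $ 2 $ 2 = g c p $ 1 $ 1 / ?D"
    by (simp_all add: B_def)
  have gB: "g c p ** B = mat 1"
    using D(2) unfolding vec_eq_iff forall_2 matrix_matrix_mult_def
    by (simp add: sum_2 B mat_def metric_symmetric[OF assms] flip: add_divide_distrib diff_divide_distrib)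
      (simp add: D(1) power2_eq_square algebra_simps)
  have Bg: "B ** g c p = mat 1"
    using D(2) unfolding vec_eq_iff forall_2 matrix_matrix_mult_def
    by (simp add: sum_2 B mat_def metric_symmetric[OF assms] flip: add_divide_distrib diff_divide_distrib)
      (simp add: D(1) power2_eq_square algebra_simps)
  have inv: "matrix_inv (g c p) = B" by (rule matrix_inv_unique[OF gB Bg])
  show "g c p *v gradient g f c p = (\<chi> i. cpartial c i f p)"
    by (simp add: gradient_def inv matrix_vector_mul_assoc gB)
  show "gradient g f c p $ 1 = (g c p $ 2 $ 2 * cpartial c 1 f p - g c p $ 1 $ 2 * cpartial c 2 f p) / ?D"
    "gradient g f c p $ 2 = (g c p $ 1 $ 1 * cpartial c 2 f p - g c p $ 1 $ 2 * cpartial c 1 f p) / ?D"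
    by (simp_all add: gradient_def inv matrix_vector_mult_def sum_2 B diff_divide_distrib)
qed

lemma metric_injective:
  assumes "c \<in> A" "p \<in> cdom c" "g c p *v v = g c p *v w"
  shows "v = w"
proof (rule ccontr)
  assume "v \<noteq> w"
  then have "(v - w) \<bullet> (g c p *v (v - w)) > 0" using metric_positive[OF assms(1,2)] by simp
  then show False using assms(3) by (simp add: matrix_vector_mult_diff_distrib)
qed

lemma C_vfield_gradient:
  assumes "C_fun (Suc k) A f"
  shows "C_vfield k A (gradient g f)"
proof (rule C_vfieldI)
  fix c j assume c: "c \<in> A"
  note f = C_chart_cpartial[OF C_funD[OF assms c]]
  have D: "C_chart k c (\<lambda>p. det (g c p))"
    unfolding det_2 by (intro C_chart_diff C_chart_mult metric_C_chart c)
  have D0: "det (g c p) \<noteq> 0" if "p \<in> cdom c" for p using det_metric_pos[OF c that] by simp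
  have "C_chart k c (\<lambda>p. (g c p $ 2 $ 2 * cpartial c 1 f p - g c p $ 1 $ 2 * cpartial c 2 f p) / det (g c p))"
    "C_chart k c (\<lambda>p. (g c p $ 1 $ 1 * cpartial c 2 f p - g c p $ 1 $ 2 * cpartial c 1 f p) / det (g c p))"
    by (intro C_chart_divide C_chart_diff C_chart_mult metric_C_chart c f D D0; assumption)+
  note q = this
  have "C_chart k c (\<lambda>p. gradient g f c p $ 1)"
    by (rule C_chart_eqI[OF _ q(1)]) (rule metric_mult_gradient(2)[OF c])
  moreover have "C_chart k c (\<lambda>p. gradient g f c p $ 2)"
    by (rule C_chart_eqI[OF _ q(2)]) (rule metric_mult_gradient(3)[OF c])
  ultimately show "C_chart k c (\<lambda>p. gradient g f c p $ j)" using exhaust_2[of j] by metis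
next
  fix c d p assume c: "c \<in> A" and d: "d \<in> A" and "p \<in> cdom c" "p \<in> cdom d"
  then have p: "p \<in> cdom c \<inter> cdom d" by blast
  let ?J = "jacobian c d p" and ?df = "\<lambda>c. (\<chi> i. cpartial c i f p) :: real^2"
  \<comment> \<open>The gradient is treated through its differential: differentials transform by
    \<open>transpose ?J\<close>, the metric by \<open>?J\<close> on both sides, and the injective
    factor \<open>transpose ?J\<close> cancels.\<close>
  have "?df c = transpose ?J *v ?df d"
    using cpartial_transform[OF c d p C_funD[OF assms d]]
    by (simp add: vec_eq_iff matrix_vector_mult_def sum_2 transpose_def)
  then have "transpose ?J *v (g d p *v (?J *v gradient g f c p)) = transpose ?J *v ?df d"
    using metric_mult_gradient(1)[OF c, of p f] p metric_transform[OF c d p]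
    by (simp add: matrix_vector_mul_assoc matrix_mul_assoc)
  moreover have "inj ((*v) (transpose ?J))"
    using det_jacobian_pos[OF c d p]
    by (intro inj_matrix_vector_mult) (simp add: det_transpose invertible_det_nz)
  ultimately have "g d p *v (?J *v gradient g f c p) = ?df d" by (blast dest: injD)
  then show "gradient g f d p = ?J *v gradient g f c p"
    using metric_injective[OF d, of p] metric_mult_gradient(1)[OF d, of p f] p by simp
qed

subsection \<open>Divergence\<close>

text \<open>Density times field transforms by the cofactors of the transition derivative, which is
  the situation of \<open>divergence_pullback\<close>.\<close>

lemma divergence_density_transform:
  assumes c: "c \<in> A" and d: "d \<in> A" and p: "p \<in> cdom c" "p \<in> cdom d" and X: "C_vfield (Suc k) A X"
  defines "W \<equiv> \<lambda>c i q. vol_density g c q * X c q $ i"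
  shows "cpartial c 1 (W c 1) p + cpartial c 2 (W c 2) p
    = det (jacobian c d p) * (cpartial d 1 (W d 1) p + cpartial d 2 (W d 2) p)"
proof -
  define S where "S = cmap c ` (cdom c \<inter> cdom d)"
  define \<tau> where "\<tau> = cmap d \<circ> cinv c"
  define D where "D i j = partial_within S i (\<lambda>x. \<tau> x $ j)" for i j
  define Z where "Z i y = W d i (cinv d y)" for i y
  have S: "hopen S" unfolding S_def by (rule overlap_hopen[OF c d])
  have x: "cmap c p \<in> S" unfolding S_def using p by blast
  have \<tau>: "C_k_on 2 S \<tau>" unfolding S_def \<tau>_def by (rule transition_C_k[OF c d])
  have d\<tau>: "\<tau> differentiable (at x within S)" if "x \<in> S" for x
    using C_k_on_SucD(1)[OF \<tau>[unfolded numeral_2_eq_2] that] .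
  have sub: "\<tau> ` S \<subseteq> cimg d" unfolding S_def \<tau>_def by (rule transition_image[OF c d])
  have J: "jacobian c d (cinv c x) $ j $ i = D i j x" if x: "x \<in> S" for x i j
  proof -
    have "cmap c (cinv c x) = x" using x c unfolding S_def by auto
    then show ?thesis unfolding jacobian_component D_def
      using partial_within_component(1)[OF S x d\<tau>[OF x], of i j] by (simp add: S_def \<tau>_def)
  qed
  have Z: "C_k_on 1 (cimg d) (Z i)" for i
  proof -
    have "C_chart (Suc 0) d (W d i)" unfolding W_def
      by (rule C_chart_mult[OF d vol_density_C_chart[OF d] C_chart_mono[OF C_vfieldD(1)[OF X d]]]) simp
    then show ?thesis unfolding C_chart_def Z_def by simp
  qed
  \<comment> \<open>The field law and the determinant in the density law combine: \<open>W c\<close>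
    is the adjugate of the Jacobian applied to \<open>W d\<close>.\<close>
  have W: "W c 1 (cinv c x) = D 2 2 x * Z 1 (\<tau> x) - D 2 1 x * Z 2 (\<tau> x)"
    "W c 2 (cinv c x) = D 1 1 x * Z 2 (\<tau> x) - D 1 2 x * Z 1 (\<tau> x)" if x: "x \<in> S" for x
  proof -
    obtain q where q: "q \<in> cdom c" "q \<in> cdom d" "x = cmap c q" using x unfolding S_def by blast
    have inv: "cinv c x = q" "cinv d (\<tau> x) = q" using q c d by (simp_all add: \<tau>_def)
    have Xd: "X d q $ 1 = D 1 1 x * X c q $ 1 + D 2 1 x * X c q $ 2"
      "X d q $ 2 = D 1 2 x * X c q $ 1 + D 2 2 x * X c q $ 2"
      unfolding C_vfieldD(2)[OF X c d q(1,2)] using J[OF x]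
      by (simp_all add: matrix_vector_mult_def sum_2 inv)
    have V: "vol_density g c q = (D 1 1 x * D 2 2 x - D 2 1 x * D 1 2 x) * vol_density g d q"
      using vol_density_transform[OF c d, of q] q J[OF x, unfolded inv(1)] by (simp add: det_2)
    show "W c 1 (cinv c x) = D 2 2 x * Z 1 (\<tau> x) - D 2 1 x * Z 2 (\<tau> x)"
      "W c 2 (cinv c x) = D 1 1 x * Z 2 (\<tau> x) - D 1 2 x * Z 1 (\<tau> x)"
      unfolding W_def Z_def inv Xd V by (simp_all add: algebra_simps)
  qed
  have "cpartial c 1 (W c 1) p + cpartial c 2 (W c 2) p
    = partial_within S 1 (\<lambda>x. D 2 2 x * Z 1 (\<tau> x) - D 2 1 x * Z 2 (\<tau> x)) (cmap c p)
    + partial_within S 2 (\<lambda>x. D 1 1 x * Z 2 (\<tau> x) - D 1 2 x * Z 1 (\<tau> x)) (cmap c p)"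
    using partial_within_overlap[OF c d, of p] p partial_within_cong[OF x W(1)] partial_within_cong[OF x W(2)]
    unfolding S_def by simp
  also have "\<dots> = (D 1 1 (cmap c p) * D 2 2 (cmap c p) - D 2 1 (cmap c p) * D 1 2 (cmap c p))
      * (partial_within (cimg d) 1 (Z 1) (\<tau> (cmap c p)) + partial_within (cimg d) 2 (Z 2) (\<tau> (cmap c p)))"
    unfolding D_def by (rule divergence_pullback[OF S cimg_hopen[OF d] x sub \<tau> Z Z])
  also have "\<dots> = det (jacobian c d p) * (cpartial d 1 (W d 1) p + cpartial d 2 (W d 2) p)"
    using J[OF x] c p by (simp add: det_2 cpartial_altdef Z_def[abs_def] \<tau>_def)
  finally show ?thesis .
qed

text \<open>The Jacobian determinant gained by the numerator cancels against the one gained by the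
  volume density.\<close>

lemma divergence_eq:
  assumes c: "c \<in> A" and p: "p \<in> cdom c" and X: "C_vfield (Suc k) A X"
  shows "divergence A g X p
    = (cpartial c 1 (\<lambda>q. vol_density g c q * X c q $ 1) p
     + cpartial c 2 (\<lambda>q. vol_density g c q * X c q $ 2) p) / vol_density g c p"
proof -
  let ?d = "chart_at A p"
  have M: "p \<in> M" using cdom_subset[OF c] p by blast
  note d = chart_at[OF M]
  show ?thesis
    using divergence_density_transform[OF c d(1) p d(2) X] vol_density_transform[OF c d(1), of p]
      det_jacobian_pos[OF c d(1), of p] p d
    by (simp add: divergence_def Let_def sum_2)
qed

lemma C_fun_divergence:
  assumes "C_vfield (Suc k) A X"
  shows "C_fun k A (divergence A g X)"
proof (rule C_funI)
  fix c assume c: "c \<in> A"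
  have "vol_density g c p \<noteq> 0" if "p \<in> cdom c" for p using vol_density_pos[OF c that] by simp
  then show "C_chart k c (divergence A g X)"
    by (intro C_chart_eqI[OF divergence_eq[OF c _ assms]] C_chart_divide C_chart_add C_chart_cpartial
      C_chart_mult vol_density_C_chart C_vfieldD(1)[OF assms] c)
qed

lemma divergence_scale:
  assumes f: "C_fun (Suc k) A f" and X: "C_vfield (Suc l) A X" and p: "p \<in> M"
  shows "divergence A g (\<lambda>c p. f p *\<^sub>R X c p) p = f p * divergence A g X p + vec_deriv A X f p"
proof -
  let ?c = "chart_at A p"
  note c = chart_at[OF p]
  let ?W = "\<lambda>i q. vol_density g ?c q * X ?c q $ i"
  have W: "C_chart (Suc l) ?c (?W i)" for i
    by (rule C_chart_mult[OF c(1) vol_density_C_chart[OF c(1)] C_vfieldD(1)[OF X c(1)]])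
  have "cpartial ?c i (\<lambda>q. vol_density g ?c q * (f q * X ?c q $ i)) p
      = f p * cpartial ?c i (?W i) p + cpartial ?c i f p * ?W i p" for i
    using cpartial_mult[OF c C_funD[OF f c(1)] W, of i i] by (simp add: algebra_simps)
  then show ?thesis
    using vol_density_pos[OF c]
    by (simp add: divergence_def vec_deriv_def Let_def sum_2 field_simps)
qed

subsection \<open>Hamiltonian vector fields\<close>

text \<open>The metric inside \<open>hodge_star\<close> undoes the inverse metric inside
  \<open>gradient\<close>. What remains is the Hamiltonian field of \<open>f\<close> for the area
  form, which sees \<open>g\<close> only through its density.\<close>

lemma hodge_star_gradient:
  assumes "c \<in> A" "p \<in> cdom c"
  shows "hodge_star g (gradient g f) c p $ 1 = - cpartial c 2 f p / vol_density g c p"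
    and "hodge_star g (gradient g f) c p $ 2 = cpartial c 1 f p / vol_density g c p"
  using metric_mult_gradient(1)[OF assms, of f] by (simp_all add: hodge_star_def Let_def)

text \<open>Rotation is an isometry, so this is the product of the gradients, written as the
  derivative of \<open>h\<close> along the gradient of \<open>f\<close> in preparation for
  integration by parts.\<close>

lemma metric_hodge_star_gradient:
  assumes "c \<in> A" "p \<in> cdom c"
  shows "hodge_star g (gradient g f) c p \<bullet> (g c p *v hodge_star g (gradient g h) c p)
    = gradient g f c p $ 1 * cpartial c 1 h p + gradient g f c p $ 2 * cpartial c 2 h p"
proof -
  have D: "det (g c p) > 0" by (rule det_metric_pos[OF assms])
  then have s: "vol_density g c p * vol_density g c p = det (g c p)" by (simp add: vol_density_def)
  show ?thesis using D unfolding metric_mult_gradient(2,3)[OF assms]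
    by (simp add: inner_vec_def sum_2 matrix_vector_mult_def hodge_star_gradient[OF assms]
        metric_symmetric[OF assms] s[symmetric] field_simps)
      (simp add: add_divide_distrib diff_divide_distrib)
qed

lemma lie_bracket_swap: "lie_bracket X Y c p = - lie_bracket Y X c p"
  by (simp add: lie_bracket_def vec_eq_iff sum_subtractf)

text \<open>A divergence-free \<open>Y\<close> preserves the area form, so its flow carries
  Hamiltonian fields to Hamiltonian fields and transports their stream functions. \<open>X\<close>
  is prescribed only on \<open>cdom c\<close>, because the lemma is also applied to a bracket, whose
  Hamiltonian form is known only in charts of the atlas.\<close>

lemma lie_bracket_hamiltonian:
  assumes c: "c \<in> A" and p: "p \<in> cdom c"
    and Y: "C_vfield (Suc k) A Y" and div: "\<And>q. q \<in> M \<Longrightarrow> divergence A g Y q = 0"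
    and f: "C_fun 2 A f" and X: "\<And>q. q \<in> cdom c \<Longrightarrow> X c q = hodge_star g (gradient g f) c q"
  shows "lie_bracket Y X c p = hodge_star g (gradient g (vec_deriv A Y f)) c p"
proof -
  let ?R = "vol_density g c"
  define w where "w q = 1 / ?R q" for q
  define P where "P i = cpartial c i" for i
  define y where "y i q = Y c q $ i" for i q
  have R0: "?R q \<noteq> 0" if "q \<in> cdom c" for q using vol_density_pos[OF c that] by simp
  have w: "C_chart (Suc 0) c w" unfolding w_def C_chart_def C_k_on_const
    using C_chart_divide[OF c _ vol_density_C_chart[OF c] R0, of "Suc 0" "\<lambda>_. 1"] C_k_on_const[OF cimg_hopen[OF c], of "Suc 0" 1]
    unfolding C_chart_def by blast
  have f2: "C_chart (Suc (Suc 0)) c f" using C_funD[OF f c] by (simp only: numeral_2_eq_2)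
  note f1 = C_chart_cpartial[OF f2]
  have y: "C_chart (Suc k) c (y i)" for i unfolding y_def by (rule C_vfieldD(1)[OF Y c])
  note R = vol_density_C_chart[OF c]
  have X1: "X c q $ 1 = - (w q * P 2 f q)" and X2: "X c q $ 2 = w q * P 1 f q" if "q \<in> cdom c" for q
    using X[OF that] hodge_star_gradient[OF c that, of f] by (simp_all add: w_def P_def)
  have wp: "C_chart (Suc 0) c (\<lambda>q. w q * P j f q)" for j
    unfolding P_def by (rule C_chart_mult[OF c w f1])
  have PX1: "cpartial c i (\<lambda>q. X c q $ 1) p = - (w p * P i (P 2 f) p + P i w p * P 2 f p)" for i
  proof -
    have "cpartial c i (\<lambda>q. X c q $ 1) p = cpartial c i (\<lambda>q. - (w q * P 2 f q)) p"
      by (rule cpartial_cong[OF p X1])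
    then show ?thesis
      using cpartial_minus[OF c p wp[of 2], of i] cpartial_mult[OF c p w f1[of 2], of i] by (simp add: P_def)
  qed
  have PX2: "cpartial c i (\<lambda>q. X c q $ 2) p = w p * P i (P 1 f) p + P i w p * P 1 f p" for i
  proof -
    have "cpartial c i (\<lambda>q. X c q $ 2) p = cpartial c i (\<lambda>q. w q * P 1 f q) p"
      by (rule cpartial_cong[OF p X2])
    then show ?thesis using cpartial_mult[OF c p w f1[of 1], of i] by (simp add: P_def)
  qed
  have h: "vec_deriv A Y f q = y 1 q * P 1 f q + y 2 q * P 2 f q" if "q \<in> cdom c" for q
    using vec_deriv_eq[OF c that Y f[unfolded numeral_2_eq_2]] by (simp add: y_def P_def)
  have Ph: "P i (vec_deriv A Y f) p = y 1 p * P i (P 1 f) p + P i (y 1) p * P 1 f p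
      + (y 2 p * P i (P 2 f) p + P i (y 2) p * P 2 f p)" for i
  proof -
    have yf: "C_chart (Suc 0) c (\<lambda>q. y j q * cpartial c j f q)" for j
      by (rule C_chart_mult[OF c C_chart_mono[OF y] f1]) simp
    have "P i (vec_deriv A Y f) p = P i (\<lambda>q. y 1 q * P 1 f q + y 2 q * P 2 f q) p"
      unfolding P_def[of i] by (rule cpartial_cong[OF p h])
    then show ?thesis
      using cpartial_add[OF c p yf[of 1] yf[of 2], of i] cpartial_mult[OF c p y[of 1] f1[of 1], of i]
        cpartial_mult[OF c p y[of 2] f1[of 2], of i]
      by (simp add: P_def)
  qed
  have Rw: "?R p * P i w p + P i ?R p * w p = 0" for i
  proof -
    have "cpartial c i (\<lambda>q. ?R q * w q) p = cpartial c i (\<lambda>q. 1) p"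
      by (rule cpartial_cong[OF p]) (simp add: w_def R0)
    then show ?thesis using cpartial_mult[OF c p R[of "Suc 0"] w, of i] c p by (simp add: P_def)
  qed
  have "P 1 (\<lambda>q. ?R q * y 1 q) p + P 2 (\<lambda>q. ?R q * y 2 q) p = 0"
    using div[of p] divergence_eq[OF c p Y] R0[OF p] cdom_subset[OF c] p by (auto simp: P_def y_def)
  then have dv: "?R p * P 1 (y 1) p + P 1 ?R p * y 1 p + (?R p * P 2 (y 2) p + P 2 ?R p * y 2 p) = 0"
    using cpartial_mult[OF c p R[of "Suc 0"] y[of 1], of 1] cpartial_mult[OF c p R[of "Suc 0"] y[of 2], of 2]
    by (simp add: P_def)
  have Rw1: "?R p * w p = 1" using R0[OF p] by (simp add: w_def)
  \<comment> \<open>The condition \<open>div Y = 0\<close> restated for the reciprocal density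
    \<open>w\<close>. With equality of mixed partials it settles both components of the
    bracket.\<close>
  have E: "y 1 p * P 1 w p + y 2 p * P 2 w p = w p * (P 1 (y 1) p + P 2 (y 2) p)"
    using Rw[of 1] Rw[of 2] dv Rw1 by algebra
  have sym: "P 1 (P 2 f) p = P 2 (P 1 f) p" unfolding P_def
    by (rule cpartial_commute[OF c p]) (use f2 in \<open>simp only: numeral_2_eq_2\<close>)
  have L: "lie_bracket Y X c p $ j = y 1 p * cpartial c 1 (\<lambda>q. X c q $ j) p - X c p $ 1 * P 1 (y j) p
      + (y 2 p * cpartial c 2 (\<lambda>q. X c q $ j) p - X c p $ 2 * P 2 (y j) p)" for j
    by (simp add: lie_bracket_def sum_2 y_def[abs_def] P_def)
  have "lie_bracket Y X c p $ 1 = - (w p * P 2 (vec_deriv A Y f) p)"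
    unfolding L PX1 X1[OF p] X2[OF p] Ph using E sym by algebra
  moreover have "lie_bracket Y X c p $ 2 = w p * P 1 (vec_deriv A Y f) p"
    unfolding L PX2 X1[OF p] X2[OF p] Ph using E sym by algebra
  ultimately show ?thesis
    unfolding vec_eq_iff forall_2 hodge_star_gradient[OF c p] by (simp add: w_def P_def)
qed

end

section \<open>The Riemannian measure\<close>

text \<open>Links absolute integrability for the completed Lebesgue measure, the language of the
  change of variables theorem, with nonnegative Borel integrals, the language of densities.\<close>

lemma absolutely_integrable_nn_integral:
  fixes f :: "'a::euclidean_space \<Rightarrow> real"
  assumes m: "(\<lambda>x. indicator U x * f x) \<in> borel_measurable borel" and f: "\<And>x. x \<in> U \<Longrightarrow> 0 \<le> f x"
  shows "(\<integral>\<^sup>+x. ennreal (indicator U x * f x) \<partial>lborel) < \<infinity> \<Longrightarrow> f absolutely_integrable_on U"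
    and "f absolutely_integrable_on U \<Longrightarrow> (\<integral>\<^sup>+x. ennreal (indicator U x * f x) \<partial>lborel) = ennreal (integral U f)"
proof -
  have m': "(\<lambda>x. indicator U x * f x) \<in> borel_measurable lborel" using m by simp
  have nn: "0 \<le> indicator U x * f x" for x using f by (auto simp: indicator_def)
  have iff: "f absolutely_integrable_on U \<longleftrightarrow> integrable lborel (\<lambda>x. indicator U x * f x)"
    unfolding set_integrable_def using integrable_completion[OF m'] by simp
  show "f absolutely_integrable_on U" if "(\<integral>\<^sup>+x. ennreal (indicator U x * f x) \<partial>lborel) < \<infinity>"
    unfolding iff using integrableI_nonneg[OF m' _ that] nn by simp
  show "(\<integral>\<^sup>+x. ennreal (indicator U x * f x) \<partial>lborel) = ennreal (integral U f)"
    if "f absolutely_integrable_on U"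
    using nn_integral_eq_integral[of lborel "\<lambda>x. indicator U x * f x"] that iff nn
      set_lebesgue_integral_eq_integral(2)[OF that] integral_completion[OF m']
    by (simp add: set_lebesgue_integral_def)
qed

text \<open>\<open>S\<close> is a general Borel set because it will be the image of a measurable
  piece of an overlap. If \<open>a\<close> is integrable, the two values agree; otherwise neither
  side is integrable and both integrals are infinite.\<close>

lemma nn_integral_change_of_variables:
  fixes \<tau> :: "real^2 \<Rightarrow> real^2" and a b :: "real^2 \<Rightarrow> real"
  assumes S: "S \<in> sets borel"
    and der: "\<And>x. x \<in> S \<Longrightarrow> (\<tau> has_derivative \<tau>' x) (at x within S)" and inj: "inj_on \<tau> S"
    and ma: "(\<lambda>x. indicator S x * a x) \<in> borel_measurable borel"
    and mb: "(\<lambda>y. indicator (\<tau> ` S) y * b y) \<in> borel_measurable borel"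
    and b: "\<And>y. y \<in> \<tau> ` S \<Longrightarrow> 0 \<le> b y"
    and eq: "\<And>x. x \<in> S \<Longrightarrow> a x = \<bar>det (matrix (\<tau>' x))\<bar> * b (\<tau> x)"
  shows "(\<integral>\<^sup>+x. ennreal (indicator S x * a x) \<partial>lborel) = (\<integral>\<^sup>+y. ennreal (indicator (\<tau> ` S) y * b y) \<partial>lborel)"
proof -
  have a: "0 \<le> a x" if "x \<in> S" for x using eq b that by simp
  \<comment> \<open>Values are lifted to \<open>real^1\<close>, since the change of variables
    theorem applied below concerns vector-valued functions.\<close>
  have abs_iff: "(\<lambda>x. \<bar>det (matrix (\<tau>' x))\<bar> *\<^sub>R (vec (b (\<tau> x)) :: real^1)) absolutely_integrable_on S
      \<longleftrightarrow> a absolutely_integrable_on S"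
  proof -
    have "(\<lambda>x. \<bar>det (matrix (\<tau>' x))\<bar> * b (\<tau> x)) absolutely_integrable_on S \<longleftrightarrow> a absolutely_integrable_on S"
      unfolding set_integrable_def by (rule Bochner_Integration.integrable_cong) (auto simp: eq indicator_def)
    then show ?thesis by (simp add: absolutely_integrable_on_1_iff)
  qed
  have int: "integral S (\<lambda>x. \<bar>det (matrix (\<tau>' x))\<bar> *\<^sub>R (vec (b (\<tau> x)) :: real^1)) = vec (integral S a)"
    by (subst integral_on_1_eq) (auto intro!: arg_cong[of _ _ vec] integral_cong simp: eq)
  have intb: "integral (\<tau> ` S) (\<lambda>y. vec (b y) :: real^1) = vec (integral (\<tau> ` S) b)"
    by (subst integral_on_1_eq) simp
  have "S \<in> sets lebesgue" using S by simp
  note cv = has_absolute_integral_change_of_variables[OF this der inj, of "\<lambda>y. vec (b y) :: real^1" "vec r" for r,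
      unfolded abs_iff int intb]
  have cv': "a absolutely_integrable_on S \<and> integral S a = r
    \<longleftrightarrow> b absolutely_integrable_on \<tau> ` S \<and> integral (\<tau> ` S) b = r" for r
    using cv[of r] by (simp add: absolutely_integrable_on_1_iff vec_eq_iff)
  note A = absolutely_integrable_nn_integral[OF ma a] and B = absolutely_integrable_nn_integral[OF mb b]
  show ?thesis
  proof (cases "a absolutely_integrable_on S")
    case True
    then show ?thesis using cv' A(2) B(2) by metis
  next
    case False
    then have "\<not> b absolutely_integrable_on \<tau> ` S" using cv' by metis
    then show ?thesis using False A(1) B(1) by (metis top.not_eq_extremum infinity_ennreal_def)
  qed
qed

lemma hopen_borel: "hopen S \<Longrightarrow> S \<in> sets borel"
proof -
  assume "hopen S"
  then obtain T where "open T" "S = half_plane \<inter> T" by (auto simp: openin_open)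
  then show ?thesis using closed_half_plane by auto
qed

context oriented_riemannian_surface
begin

text \<open>A measure on the whole plane that vanishes off the chart image, so that pieces of the
  chart domain are measured as Borel sets of the plane.\<close>

definition chart_measure :: "'a chart \<Rightarrow> (real^2) measure" where
  "chart_measure c = density lborel (\<lambda>x. ennreal (indicator (cimg c) x * vol_density g c (cinv c x)))"

abbreviation vol :: "'a measure" where "vol \<equiv> riem_volume M A g"

lemma sets_chart_measure [simp]: "sets (chart_measure c) = sets borel"
  by (simp add: chart_measure_def)

lemma space_chart_measure [simp]: "space (chart_measure c) = UNIV"
  by (simp add: chart_measure_def)

lemma M_borel: "M \<in> sets borel"
  by (intro borel_closed compact_imp_closed compact_M)

lemma cdom_borel: "c \<in> A \<Longrightarrow> cdom c \<in> sets borel"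
proof -
  assume "c \<in> A"
  then obtain T where "open T" "cdom c = M \<inter> T" using cdom_open openin_open by metis
  then show ?thesis using M_borel by auto
qed

lemma cimg_borel: "c \<in> A \<Longrightarrow> cimg c \<in> sets borel"
  by (rule hopen_borel[OF cimg_hopen])

lemma chart_image_eq:
  assumes "c \<in> A" "B \<subseteq> cdom c"
  shows "cmap c ` B = cinv c -` B \<inter> cimg c"
  using assms by (auto simp: subset_iff)

lemma chart_image_borel:
  assumes c: "c \<in> A" and B: "B \<in> sets borel" "B \<subseteq> cdom c"
  shows "cmap c ` B \<in> sets borel"
proof -
  have "continuous_on (cimg c) (cinv c)" using chart_homeomorphism[OF c] by (auto simp: homeomorphism_def)
  then have "cinv c \<in> borel_measurable (restrict_space borel (cimg c))"
    by (rule borel_measurable_continuous_on_restrict)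
  from measurable_sets[OF this B(1)]
  have "cmap c ` B \<in> sets (restrict_space borel (cimg c))"
    by (simp add: chart_image_eq[OF c B(2)] space_restrict_space)
  then show ?thesis using cimg_borel[OF c] by (simp add: sets_restrict_space_iff)
qed

lemma density_measurable:
  assumes "c \<in> A" "U \<in> sets borel" "U \<subseteq> cimg c"
  shows "(\<lambda>x. indicator U x * vol_density g c (cinv c x)) \<in> borel_measurable borel"
proof -
  have "continuous_on U (\<lambda>x. vol_density g c (cinv c x))"
    using C_k_on_continuous[OF vol_density_C_chart[OF assms(1), unfolded C_chart_def]] assms(3)
    by (rule continuous_on_subset)
  then show ?thesis using borel_measurable_continuous_on_indicator[OF assms(2)] by fastforce
qed

lemma emeasure_chart_measure:
  assumes "c \<in> A" "U \<in> sets borel" "U \<subseteq> cimg c"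
  shows "emeasure (chart_measure c) U
      = (\<integral>\<^sup>+x. ennreal (indicator U x * vol_density g c (cinv c x)) \<partial>lborel)"
    and "emeasure (chart_measure c) U = (\<integral>\<^sup>+x\<in>U. ennreal (vol_density g c (cinv c x)) \<partial>lborel)"
proof -
  have "emeasure (chart_measure c) U
      = (\<integral>\<^sup>+x. ennreal (indicator (cimg c) x * vol_density g c (cinv c x)) * indicator U x \<partial>lborel)"
    unfolding chart_measure_def using density_measurable[OF assms(1) cimg_borel[OF assms(1)]] assms(2)
    by (intro emeasure_density) auto
  also have "\<dots> = (\<integral>\<^sup>+x. ennreal (indicator U x * vol_density g c (cinv c x)) \<partial>lborel)"
    using assms(3) by (intro nn_integral_cong) (auto simp: indicator_def)
  finally show *: "emeasure (chart_measure c) U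
      = (\<integral>\<^sup>+x. ennreal (indicator U x * vol_density g c (cinv c x)) \<partial>lborel)" .
  show "emeasure (chart_measure c) U = (\<integral>\<^sup>+x\<in>U. ennreal (vol_density g c (cinv c x)) \<partial>lborel)"
    unfolding * by (intro nn_integral_cong) (auto simp: indicator_def)
qed

text \<open>Overlapping charts assign the same volume: the transition map contributes its Jacobian
  determinant, which is the ratio of the two densities.\<close>

lemma chart_measure_transition:
  assumes c: "c \<in> A" and d: "d \<in> A" and B: "B \<in> sets borel" "B \<subseteq> cdom c" "B \<subseteq> cdom d"
  shows "emeasure (chart_measure c) (cmap c ` B) = emeasure (chart_measure d) (cmap d ` B)"
proof -
  let ?S = "cmap c ` B" and ?O = "cmap c ` (cdom c \<inter> cdom d)" and ?\<tau> = "cmap d \<circ> cinv c"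
  let ?D = "\<lambda>x. frechet_derivative ?\<tau> (at x within ?O)"
  have img: "?\<tau> ` ?S = cmap d ` B" using B(2) c by (force simp: image_image)
  have inj: "inj_on ?\<tau> ?S"
  proof (rule inj_onI)
    fix x y assume "x \<in> ?S" "y \<in> ?S" and eq: "?\<tau> x = ?\<tau> y"
    then obtain p q where pq: "p \<in> B" "q \<in> B" "x = cmap c p" "y = cmap c q" by blast
    then have "cmap d p = cmap d q" using eq B c by (auto simp: subset_iff)
    then have "p = q" using inj_onD[OF inj_on_cmap[OF d]] pq B by blast
    then show "x = y" using pq by simp
  qed
  have der: "(?\<tau> has_derivative ?D x) (at x within ?S)" if "x \<in> ?S" for x
  proof (rule has_derivative_subset)
    have "x \<in> ?O" using that B by blast
    then show "(?\<tau> has_derivative ?D x) (at x within ?O)"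
      by (intro frechet_derivative_worksD C_k_on_SucD(1)[OF transition_C_k[OF c d]])
    show "?S \<subseteq> ?O" using B by blast
  qed
  have S: "?S \<in> sets borel" "?S \<subseteq> cimg c" and T: "cmap d ` B \<in> sets borel" "cmap d ` B \<subseteq> cimg d"
    using chart_image_borel[OF c B(1,2)] chart_image_borel[OF d B(1,3)] B by auto
  have eq: "vol_density g c (cinv c x) = \<bar>det (matrix (?D x))\<bar> * vol_density g d (cinv d (?\<tau> x))"
    if "x \<in> ?S" for x
  proof -
    obtain p where p: "p \<in> B" "x = cmap c p" using \<open>x \<in> ?S\<close> by blast
    then have pcd: "p \<in> cdom c \<inter> cdom d" using B by blast
    have "det (matrix (?D x)) = det (jacobian c d p)" unfolding jacobian_def p ..
    then show ?thesis
      using vol_density_transform[OF c d pcd] det_jacobian_pos[OF c d pcd] p pcd c d by simp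
  qed
  have pos: "0 \<le> vol_density g d (cinv d y)" if "y \<in> ?\<tau> ` ?S" for y
    using that T(2) vol_density_pos[OF d cinv_in] unfolding img by (meson less_imp_le subsetD)
  have mb: "(\<lambda>y. indicator (?\<tau> ` ?S) y * vol_density g d (cinv d y)) \<in> borel_measurable borel"
    unfolding img by (rule density_measurable[OF d T])
  note cv = nn_integral_change_of_variables[OF S(1) der inj density_measurable[OF c S] mb pos eq]
  show ?thesis
    unfolding emeasure_chart_measure(1)[OF c S] emeasure_chart_measure(1)[OF d T] by (rule cv[unfolded img])
qed

lemma finite_chart_cover:
  obtains n and e :: "nat \<Rightarrow> 'a chart" where "\<And>i. i < n \<Longrightarrow> e i \<in> A" "(\<Union>i<n. cdom (e i)) = M"
proof -
  have "\<exists>T. open T \<and> cdom c = M \<inter> T" if "c \<in> A" for c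
    using cdom_open[OF that] openin_open by metis
  then obtain T where T: "\<And>c. c \<in> A \<Longrightarrow> open (T c)" "\<And>c. c \<in> A \<Longrightarrow> cdom c = M \<inter> T c" by metis
  have "M \<subseteq> (\<Union>c\<in>A. T c)" using chart_at T(2) by blast
  then obtain F where F: "F \<subseteq> A" "finite F" "M \<subseteq> (\<Union>c\<in>F. T c)"
    using compactE_image[OF compact_M, of A T] T(1) by metis
  obtain e n where "F = e ` {i. i < (n::nat)}" using finite_imp_nat_seg_image_inj_on[OF F(2)] by metis
  then have "F = e ` {..<n}" by (simp add: lessThan_def)
  moreover have "(\<Union>c\<in>F. cdom c) = M" using F T(2) cdom_subset by blast
  ultimately show thesis using that[of n e] F(1) by auto
qed

text \<open>The \<open>THE\<close> becomes usable through existence and uniqueness. A finite chart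
  cover is cut into disjoint Borel pieces; every candidate is determined on each piece by its chart,
  and the sum of the chart measures of the pieces is a candidate.\<close>

lemma riem_volume_characterization:
  "sets vol = sets (restrict_space borel M) \<and>
   (\<forall>c\<in>A. \<forall>B\<in>sets vol. B \<subseteq> cdom c \<longrightarrow>
     emeasure vol B = (\<integral>\<^sup>+x\<in>cmap c ` B. ennreal (vol_density g c (cinv c x)) \<partial>lborel))"
proof -
  let ?N = "restrict_space borel M"
  let ?P = "\<lambda>\<mu>. sets \<mu> = sets ?N \<and> (\<forall>c\<in>A. \<forall>B\<in>sets \<mu>. B \<subseteq> cdom c \<longrightarrow>
     emeasure \<mu> B = (\<integral>\<^sup>+x\<in>cmap c ` B. ennreal (vol_density g c (cinv c x)) \<partial>lborel))"
  have N: "B \<in> sets ?N \<longleftrightarrow> B \<subseteq> M \<and> B \<in> sets borel" for B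
    using M_borel by (simp add: sets_restrict_space_iff)
  have integral_eq: "(\<integral>\<^sup>+x\<in>cmap c ` B. ennreal (vol_density g c (cinv c x)) \<partial>lborel)
      = emeasure (chart_measure c) (cmap c ` B)" if "c \<in> A" "B \<in> sets ?N" "B \<subseteq> cdom c" for c B
    using that N chart_image_borel by (intro emeasure_chart_measure(2)[symmetric]) auto
  obtain n and e :: "nat \<Rightarrow> 'a chart" where e: "\<And>i. i < n \<Longrightarrow> e i \<in> A" "(\<Union>i<n. cdom (e i)) = M"
    using finite_chart_cover by blast
  \<comment> \<open>Each point is assigned to the first chart of the cover that contains it.\<close>
  define D where "D i = cdom (e i) - (\<Union>j<i. cdom (e j))" for i
  have D: "D i \<in> sets borel" "D i \<subseteq> cdom (e i)" if "i < n" for i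
    unfolding D_def using e(1) that by (auto intro!: sets.Diff sets.finite_UN cdom_borel)
  have "(\<Union>i<n. D i) = M"
    using finite_UN_disjointed_eq[of "\<lambda>i. cdom (e i)" n] e(2)
    by (simp add: D_def disjointed_def atLeast0LessThan)
  have disj: "disjoint_family_on D {..<n}"
    using disjoint_family_disjointed[of "\<lambda>i. cdom (e i)"]
    by (auto simp: D_def disjointed_def atLeast0LessThan disjoint_family_on_def)
  define \<nu> where "\<nu> B = (\<Sum>i<n. emeasure (chart_measure (e i)) (cmap (e i) ` (B \<inter> D i)))" for B
  have piece: "B \<inter> D i \<in> sets borel" "B \<inter> D i \<subseteq> cdom (e i)" if "B \<in> sets ?N" "i < n" for B i
    using that D N by auto
  have DN: "D i \<in> sets ?N" if "i < n" for i
    using D[OF that] cdom_subset[OF e(1)[OF that]] N by blast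
  have PD: "emeasure \<mu> B = emeasure (chart_measure c) (cmap c ` B)"
    if "?P \<mu>" "c \<in> A" "B \<in> sets ?N" "B \<subseteq> cdom c" for \<mu> c B
  proof -
    have "B \<in> sets \<mu>" using that(1,3) by blast
    then show ?thesis using that(1,2,4) integral_eq[OF that(2-4)] by simp
  qed
  have unique: "emeasure \<mu> B = \<nu> B" if \<mu>: "?P \<mu>" and B: "B \<in> sets ?N" for \<mu> B
  proof -
    have sets_\<mu>: "sets \<mu> = sets ?N" using \<mu> by blast
    have "emeasure \<mu> B = (\<Sum>i<n. emeasure \<mu> (B \<inter> D i))"
    proof (rule sum_emeasure_cover)
      show "D ` {..<n} \<subseteq> sets \<mu>" using DN by (simp add: sets_\<mu> image_subset_iff)
      show "B \<in> sets \<mu>" using B by (simp add: sets_\<mu>)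
      show "B \<subseteq> (\<Union>i<n. D i)" using B N \<open>(\<Union>i<n. D i) = M\<close> by blast
    qed (use disj in auto)
    also have "\<dots> = \<nu> B" unfolding \<nu>_def
    proof (intro sum.cong refl)
      fix i assume "i \<in> {..<n}"
      then have i: "i < n" by simp
      show "emeasure \<mu> (B \<inter> D i) = emeasure (chart_measure (e i)) (cmap (e i) ` (B \<inter> D i))"
        by (rule PD[OF \<mu> e(1)[OF i] _ piece(2)[OF B i]]) (use B DN[OF i] in auto)
    qed
    finally show ?thesis .
  qed
  define \<mu> where "\<mu> = measure_of (space ?N) (sets ?N) \<nu>"
  have sets_\<mu>: "sets \<mu> = sets ?N" unfolding \<mu>_def by simp
  have emeasure_\<mu>: "emeasure \<mu> B = \<nu> B" if "B \<in> sets ?N" for B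
    unfolding \<mu>_def
  proof (rule emeasure_measure_of_sigma[OF sets.sigma_algebra_axioms _ _ that])
    show "positive (sets ?N) \<nu>" by (simp add: positive_def \<nu>_def)
    show "countably_additive (sets ?N) \<nu>"
      unfolding countably_additive_def
    proof (intro allI impI)
      fix B :: "nat \<Rightarrow> 'a set"
      assume B: "range B \<subseteq> sets ?N" "disjoint_family B"
      have "(\<Sum>k. \<nu> (B k)) = (\<Sum>i<n. \<Sum>k. emeasure (chart_measure (e i)) (cmap (e i) ` (B k \<inter> D i)))"
        unfolding \<nu>_def by (rule suminf_sum) auto
      also have "\<dots> = \<nu> (\<Union>k. B k)" unfolding \<nu>_def
      proof (intro sum.cong refl)
        fix i assume "i \<in> {..<n}"
        then have i: "i < n" by simp
        have Bk: "B k \<in> sets ?N" for k using B(1) by blast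
        have "(\<Sum>k. emeasure (chart_measure (e i)) (cmap (e i) ` (B k \<inter> D i)))
          = emeasure (chart_measure (e i)) (\<Union>k. cmap (e i) ` (B k \<inter> D i))"
        proof (rule suminf_emeasure)
          show "range (\<lambda>k. cmap (e i) ` (B k \<inter> D i)) \<subseteq> sets (chart_measure (e i))"
            using chart_image_borel[OF e(1)[OF i] piece[OF Bk i]] by auto
          show "disjoint_family (\<lambda>k. cmap (e i) ` (B k \<inter> D i))"
            unfolding disjoint_family_on_def
          proof (intro ballI impI)
            fix k l :: nat assume "k \<noteq> l"
            then have "(B k \<inter> D i) \<inter> (B l \<inter> D i) = {}" using B(2) by (auto simp: disjoint_family_on_def)
            then show "cmap (e i) ` (B k \<inter> D i) \<inter> cmap (e i) ` (B l \<inter> D i) = {}"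
              using inj_on_image_Int[OF inj_on_cmap[OF e(1)[OF i]] piece(2)[OF Bk i] piece(2)[OF Bk i], of k l] by simp
          qed
        qed
        also have "(\<Union>k. cmap (e i) ` (B k \<inter> D i)) = cmap (e i) ` ((\<Union>k. B k) \<inter> D i)" by blast
        finally show "(\<Sum>k. emeasure (chart_measure (e i)) (cmap (e i) ` (B k \<inter> D i)))
          = emeasure (chart_measure (e i)) (cmap (e i) ` ((\<Union>k. B k) \<inter> D i))" .
      qed
      finally show "(\<Sum>k. \<nu> (B k)) = \<nu> (\<Union>k. B k)" .
    qed
  qed
  have P\<mu>: "?P \<mu>"
  proof (intro conjI ballI impI sets_\<mu>)
    fix c B assume c: "c \<in> A" and B: "B \<in> sets \<mu>" "B \<subseteq> cdom c"
    then have BN: "B \<in> sets ?N" by (simp add: sets_\<mu>)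
    \<comment> \<open>Every piece is moved from its own chart to \<open>c\<close>, where the images
      are disjoint and their measures add up.\<close>
    have "\<nu> B = (\<Sum>i<n. emeasure (chart_measure c) (cmap c ` (B \<inter> D i)))"
      unfolding \<nu>_def using chart_measure_transition[OF e(1) c piece(1)[OF BN] piece(2)[OF BN]] B(2)
      by (intro sum.cong refl) auto
    also have "\<dots> = emeasure (chart_measure c) (\<Union>i<n. cmap c ` (B \<inter> D i))"
    proof (rule sum_emeasure)
      show "(\<lambda>i. cmap c ` (B \<inter> D i)) ` {..<n} \<subseteq> sets (chart_measure c)"
        using chart_image_borel[OF c piece(1)[OF BN]] B(2) by auto
      show "disjoint_family_on (\<lambda>i. cmap c ` (B \<inter> D i)) {..<n}"
        unfolding disjoint_family_on_def
      proof (intro ballI impI)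
        fix k l :: nat assume "k \<in> {..<n}" "l \<in> {..<n}" "k \<noteq> l"
        then have "(B \<inter> D k) \<inter> (B \<inter> D l) = {}" using disj by (auto simp: disjoint_family_on_def)
        then show "cmap c ` (B \<inter> D k) \<inter> cmap c ` (B \<inter> D l) = {}"
          using inj_on_image_Int[OF inj_on_cmap[OF c], of "B \<inter> D k" "B \<inter> D l"] B(2) by auto
      qed
    qed simp
    also have "(\<Union>i<n. cmap c ` (B \<inter> D i)) = cmap c ` (B \<inter> (\<Union>i<n. D i))" by blast
    also have "B \<inter> (\<Union>i<n. D i) = B" using \<open>(\<Union>i<n. D i) = M\<close> N BN by blast
    finally show "emeasure \<mu> B = (\<integral>\<^sup>+x\<in>cmap c ` B. ennreal (vol_density g c (cinv c x)) \<partial>lborel)"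
      using emeasure_\<mu>[OF BN] integral_eq[OF c BN B(2)] by simp
  qed
  have "?P vol"
    unfolding riem_volume_def
  proof (rule theI[of ?P \<mu>, OF P\<mu>])
    fix \<mu>' assume P: "?P \<mu>'"
    show "\<mu>' = \<mu>"
      by (rule measure_eqI) (use P sets_\<mu> unique[OF P] emeasure_\<mu> in auto)
  qed
  then show ?thesis .
qed

lemma sets_vol: "B \<in> sets vol \<longleftrightarrow> B \<subseteq> M \<and> B \<in> sets borel"
  using riem_volume_characterization M_borel by (simp add: sets_restrict_space_iff)

lemma space_vol: "space vol = M"
  using riem_volume_characterization sets_eq_imp_space_eq[of vol "restrict_space borel M"]
  by (simp add: space_restrict_space)

lemma emeasure_vol:
  assumes "c \<in> A" "B \<in> sets borel" "B \<subseteq> cdom c"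
  shows "emeasure vol B = emeasure (chart_measure c) (cmap c ` B)"
proof -
  have "B \<in> sets vol" using assms cdom_subset by (simp add: sets_vol) blast
  then have "emeasure vol B = (\<integral>\<^sup>+x\<in>cmap c ` B. ennreal (vol_density g c (cinv c x)) \<partial>lborel)"
    using riem_volume_characterization assms(1,3) by blast
  also have "\<dots> = emeasure (chart_measure c) (cmap c ` B)"
    using emeasure_chart_measure(2)[OF assms(1) chart_image_borel[OF assms]] assms(3) by (simp add: image_mono)
  finally show ?thesis .
qed

section \<open>Integration against the volume in a single chart\<close>

lemma chart_restrict_measurable:
  assumes c: "c \<in> A"
  shows "cinv c \<in> measurable (restrict_space (chart_measure c) (cimg c)) (restrict_space vol (cdom c))"
proof (rule measurableI)
  have V: "cdom c \<inter> space vol \<in> sets vol"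
    using cdom_subset[OF c] cdom_borel[OF c] by (auto simp: sets_vol space_vol Int_absorb2)
  fix x assume "x \<in> space (restrict_space (chart_measure c) (cimg c))"
  then have "cinv c x \<in> cdom c" by (intro cinv_in) (simp add: space_restrict_space)
  then show "cinv c x \<in> space (restrict_space vol (cdom c))"
    using cdom_subset[OF c] by (auto simp: space_restrict_space space_vol)
next
  have V: "cdom c \<inter> space vol \<in> sets vol"
    using cdom_subset[OF c] cdom_borel[OF c] by (auto simp: sets_vol space_vol Int_absorb2)
  fix B assume "B \<in> sets (restrict_space vol (cdom c))"
  then have B: "B \<in> sets borel" "B \<subseteq> cdom c" using V by (auto simp: sets_restrict_space_iff sets_vol)
  show "cinv c -` B \<inter> space (restrict_space (chart_measure c) (cimg c)) \<in> sets (restrict_space (chart_measure c) (cimg c))"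
    using chart_image_borel[OF c B] B(2) cimg_borel[OF c]
    by (auto simp: space_restrict_space sets_restrict_space_iff chart_image_eq[OF c B(2)])
qed

lemma restrict_vol_eq:
  assumes c: "c \<in> A"
  shows "restrict_space vol (cdom c)
    = distr (restrict_space (chart_measure c) (cimg c)) (restrict_space vol (cdom c)) (cinv c)"
proof (rule measure_eqI)
  have V: "cdom c \<inter> space vol \<in> sets vol"
    using cdom_subset[OF c] cdom_borel[OF c] by (auto simp: sets_vol space_vol Int_absorb2)
  fix B assume BV: "B \<in> sets (restrict_space vol (cdom c))"
  then have B: "B \<in> sets borel" "B \<subseteq> cdom c" using V by (auto simp: sets_restrict_space_iff sets_vol)
  have "emeasure (restrict_space vol (cdom c)) B = emeasure (chart_measure c) (cmap c ` B)"
    using emeasure_restrict_space[OF V B(2)] emeasure_vol[OF c B] by simp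
  also have "\<dots> = emeasure (restrict_space (chart_measure c) (cimg c)) (cmap c ` B)"
    using B(2) cimg_borel[OF c] by (intro emeasure_restrict_space[symmetric]) auto
  also have "\<dots> = emeasure (distr (restrict_space (chart_measure c) (cimg c)) (restrict_space vol (cdom c)) (cinv c)) B"
    using emeasure_distr[OF chart_restrict_measurable[OF c] BV] chart_image_eq[OF c B(2)]
    by (simp add: space_restrict_space)
  finally show "emeasure (restrict_space vol (cdom c)) B
    = emeasure (distr (restrict_space (chart_measure c) (cimg c)) (restrict_space vol (cdom c)) (cinv c)) B" .
qed simp

lemma integral_chart:
  fixes f :: "'a \<Rightarrow> real"
  assumes c: "c \<in> A" and f: "f \<in> borel_measurable vol" and 0: "\<And>p. p \<in> M \<Longrightarrow> p \<notin> cdom c \<Longrightarrow> f p = 0"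
  shows "(\<integral>p. f p \<partial>vol)
    = (\<integral>x. indicator (cimg c) x * (vol_density g c (cinv c x) * f (cinv c x)) \<partial>lborel)"
proof -
  have V: "cdom c \<inter> space vol \<in> sets vol"
    using cdom_subset[OF c] cdom_borel[OF c] by (auto simp: sets_vol space_vol Int_absorb2)
  have I: "cimg c \<inter> space (chart_measure c) \<in> sets (chart_measure c)" using cimg_borel[OF c] by simp
  have fV: "f \<in> borel_measurable (restrict_space vol (cdom c))" by (rule measurable_restrict_space1[OF f])
  have "(\<integral>p. f p \<partial>vol) = (\<integral>p. indicator (cdom c) p *\<^sub>R f p \<partial>vol)"
    using 0 by (intro Bochner_Integration.integral_cong) (auto simp: space_vol indicator_def)
  also have "\<dots> = (\<integral>p. f p \<partial>restrict_space vol (cdom c))" by (rule integral_restrict_space[OF V, symmetric])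
  also have "\<dots> = (\<integral>x. f (cinv c x) \<partial>restrict_space (chart_measure c) (cimg c))"
    using integral_distr[OF chart_restrict_measurable[OF c] fV] restrict_vol_eq[OF c] by simp
  also have "\<dots> = (\<integral>x. indicator (cimg c) x *\<^sub>R f (cinv c x) \<partial>chart_measure c)"
    by (rule integral_restrict_space[OF I])
  also have "\<dots> = (\<integral>x. (indicator (cimg c) x * vol_density g c (cinv c x)) *\<^sub>R (indicator (cimg c) x *\<^sub>R f (cinv c x)) \<partial>lborel)"
    unfolding chart_measure_def
  proof (rule integral_density)
    have "(\<lambda>x. f (cinv c x)) \<in> borel_measurable (restrict_space (chart_measure c) (cimg c))"
      by (rule measurable_compose[OF chart_restrict_measurable[OF c] fV])
    then have "(\<lambda>x. indicator (cimg c) x *\<^sub>R f (cinv c x)) \<in> borel_measurable (chart_measure c)"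
      by (subst (asm) borel_measurable_restrict_space_iff[OF I])
    then show "(\<lambda>x. indicator (cimg c) x *\<^sub>R f (cinv c x)) \<in> borel_measurable lborel"
      by (simp cong: measurable_cong_sets)
    show "(\<lambda>x. indicator (cimg c) x * vol_density g c (cinv c x)) \<in> borel_measurable lborel"
      using density_measurable[OF c cimg_borel[OF c]] by simp
    show "AE x in lborel. 0 \<le> indicator (cimg c) x * vol_density g c (cinv c x)"
      using vol_density_pos[OF c cinv_in] by (auto simp: indicator_def less_imp_le)
  qed
  also have "\<dots> = (\<integral>x. indicator (cimg c) x * (vol_density g c (cinv c x) * f (cinv c x)) \<partial>lborel)"
    by (intro Bochner_Integration.integral_cong) (auto simp: indicator_def)
  finally show ?thesis .
qed

section \<open>Coordinate balls and finiteness of the volume\<close>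

definition chart_ball :: "'a chart \<Rightarrow> 'a \<Rightarrow> real \<Rightarrow> 'a set" where
  "chart_ball c p r = {q \<in> cdom c. cmap c q \<in> ball (cmap c p) r}"

lemma chart_ball_open:
  assumes "c \<in> A"
  shows "openin (top_of_set M) (chart_ball c p r)"
proof -
  have "continuous_on (cdom c) (cmap c)" using chart_homeomorphism[OF assms] by (auto simp: homeomorphism_def)
  then have "openin (top_of_set (cdom c)) (cdom c \<inter> cmap c -` ball (cmap c p) r)"
    by (rule continuous_openin_preimage_gen) simp
  moreover have "chart_ball c p r = cdom c \<inter> cmap c -` ball (cmap c p) r" by (auto simp: chart_ball_def)
  ultimately show ?thesis using openin_trans[OF _ cdom_open[OF assms]] by simp
qed

text \<open>The closed half ball is compact: it bounds the density when the volume is shown to be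
  finite, and later it contains the support of a cutoff.\<close>

lemma chart_ball_radius:
  assumes "c \<in> A" "p \<in> cdom c"
  obtains r where "r > 0" "cball (cmap c p) r \<inter> half_plane \<subseteq> cimg c"
proof -
  obtain T where T: "open T" "cimg c = half_plane \<inter> T" using cimg_hopen[OF assms(1)] by (auto simp: openin_open)
  then obtain r where "r > 0" "cball (cmap c p) r \<subseteq> T" using assms(2) open_contains_cball by blast
  then show thesis using that T by blast
qed

text \<open>The radius varies with the centre, since the room available in a chart depends on the
  point; compactness then selects finitely many centres.\<close>

lemma finite_ball_cover:
  assumes "\<And>p. p \<in> M \<Longrightarrow> r p > 0"
  obtains F where "finite F" "F \<subseteq> M" "M = (\<Union>p\<in>F. chart_ball (chart_at A p) p (r p))"
proof -
  have "\<exists>T. open T \<and> chart_ball (chart_at A p) p (r p) = M \<inter> T" if "p \<in> M" for p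
    using chart_ball_open[OF chart_at(1)[OF that]] openin_open by metis
  then obtain T where T: "\<And>p. p \<in> M \<Longrightarrow> open (T p)"
    "\<And>p. p \<in> M \<Longrightarrow> chart_ball (chart_at A p) p (r p) = M \<inter> T p" by metis
  have "p \<in> chart_ball (chart_at A p) p (r p)" if "p \<in> M" for p
    using chart_at(2)[OF that] assms[OF that] by (simp add: chart_ball_def)
  then have "M \<subseteq> (\<Union>p\<in>M. T p)" using T(2) by blast
  then obtain F where F: "F \<subseteq> M" "finite F" "M \<subseteq> (\<Union>p\<in>F. T p)"
    using compactE_image[OF compact_M, of M T] T(1) by metis
  have "(\<Union>p\<in>F. chart_ball (chart_at A p) p (r p)) = (\<Union>p\<in>F. M \<inter> T p)" using F(1) T(2) by (intro SUP_cong) auto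
  moreover have "M = (\<Union>p\<in>F. M \<inter> T p)" using F(3) by blast
  ultimately show thesis using that[OF F(2,1)] by simp
qed

text \<open>The density is continuous on the compact half ball, hence bounded there, and a Euclidean
  ball has finite measure.\<close>

lemma emeasure_chart_ball_finite:
  assumes c: "c \<in> A" and r: "cball (cmap c p) r \<inter> half_plane \<subseteq> cimg c"
  shows "emeasure vol (chart_ball c p r) < \<infinity>"
proof -
  let ?K = "cball (cmap c p) r \<inter> half_plane" and ?U = "cmap c ` chart_ball c p r"
  have "chart_ball c p r \<in> sets borel"
  proof -
    obtain T where "open T" "chart_ball c p r = M \<inter> T"
      using chart_ball_open[OF c] openin_open by metis
    then show ?thesis using M_borel by auto
  qed
  then have B: "chart_ball c p r \<in> sets borel" "chart_ball c p r \<subseteq> cdom c" by (auto simp: chart_ball_def)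
  have UK: "?U \<subseteq> ?K" using hopen_subset_half_plane[OF cimg_hopen[OF c]] by (auto simp: chart_ball_def)
  have "compact ?K" using closed_half_plane by (intro compact_Int_closed) auto
  moreover have "continuous_on ?K (\<lambda>x. vol_density g c (cinv c x))"
    using C_k_on_continuous[OF vol_density_C_chart[OF c, unfolded C_chart_def]] r by (rule continuous_on_subset)
  ultimately have "bounded ((\<lambda>x. vol_density g c (cinv c x)) ` ?K)"
    by (intro compact_imp_bounded compact_continuous_image)
  then obtain b where b: "\<forall>x\<in>?K. vol_density g c (cinv c x) \<le> b"
    unfolding bounded_iff by (auto dest!: abs_le_D1)
  have "emeasure vol (chart_ball c p r) = (\<integral>\<^sup>+x. ennreal (indicator ?U x * vol_density g c (cinv c x)) \<partial>lborel)"
    unfolding emeasure_vol[OF c B] using emeasure_chart_measure(1)[OF c chart_image_borel[OF c B]] B(2)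
    by (simp add: image_mono)
  also have "\<dots> \<le> (\<integral>\<^sup>+x. ennreal b * indicator (cball (cmap c p) r) x \<partial>lborel)"
  proof (rule nn_integral_mono)
    fix x
    show "ennreal (indicator ?U x * vol_density g c (cinv c x)) \<le> ennreal b * indicator (cball (cmap c p) r) x"
    proof (cases "x \<in> ?U")
      case True
      then have "x \<in> ?K" using UK by blast
      with True b show ?thesis by (simp add: ennreal_leI)
    qed simp
  qed
  also have "\<dots> = ennreal b * emeasure lborel (cball (cmap c p) r)" by (simp add: nn_integral_cmult_indicator)
  also have "\<dots> < \<infinity>" using emeasure_lborel_cball_finite[of "cmap c p" r] by (simp add: ennreal_mult_less_top)
  finally show ?thesis .
qed

lemma finite_measure_vol: "finite_measure vol"
proof
  have "\<exists>r. p \<in> M \<longrightarrow> r > 0 \<and> cball (cmap (chart_at A p) p) r \<inter> half_plane \<subseteq> cimg (chart_at A p)" for p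
    using chart_ball_radius chart_at by metis
  then obtain r where r: "\<And>p. p \<in> M \<Longrightarrow> r p > 0"
    "\<And>p. p \<in> M \<Longrightarrow> cball (cmap (chart_at A p) p) (r p) \<inter> half_plane \<subseteq> cimg (chart_at A p)" by metis
  obtain F where F: "finite F" "F \<subseteq> M" "M = (\<Union>p\<in>F. chart_ball (chart_at A p) p (r p))"
    using finite_ball_cover[of r] r(1) by blast
  have "emeasure vol (\<Union>p\<in>F. chart_ball (chart_at A p) p (r p))
      \<le> (\<Sum>p\<in>F. emeasure vol (chart_ball (chart_at A p) p (r p)))"
  proof (rule emeasure_subadditive_finite[OF F(1)])
    have "chart_ball (chart_at A p) p (r p) \<in> sets vol" if p: "p \<in> M" for p
    proof -
      obtain T where "open T" "chart_ball (chart_at A p) p (r p) = M \<inter> T"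
        using chart_ball_open[OF chart_at(1)[OF p]] openin_open by metis
      then show ?thesis using M_borel by (auto simp: sets_vol)
    qed
    then show "(\<lambda>p. chart_ball (chart_at A p) p (r p)) ` F \<subseteq> sets vol" using F(2) by blast
  qed
  also have "\<dots> < \<infinity>"
  proof -
    have "emeasure vol (chart_ball (chart_at A p) p (r p)) < top" if "p \<in> F" for p
      using emeasure_chart_ball_finite[OF chart_at(1) r(2), of p] that F(2) by auto
    then show ?thesis by (simp add: F(1))
  qed
  finally have "emeasure vol M < \<infinity>" unfolding F(3)[symmetric] .
  then show "emeasure vol (space vol) \<noteq> \<infinity>" by (simp add: space_vol)
qed

lemma C_fun_continuous:
  assumes "C_fun k A f"
  shows "continuous_on M f"
  unfolding continuous_on_eq_continuous_within
proof
  fix p assume "p \<in> M"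
  let ?c = "chart_at A p"
  note c = chart_at[OF \<open>p \<in> M\<close>]
  have "continuous_on (cdom ?c) (\<lambda>q. f (cinv ?c (cmap ?c q)))"
    using C_k_on_continuous[OF C_funD[OF assms c(1), unfolded C_chart_def]] chart_homeomorphism[OF c(1)]
    by (intro continuous_on_compose2[of "cimg ?c" "\<lambda>x. f (cinv ?c x)" _ "cmap ?c"]) (auto simp: homeomorphism_def)
  then have "continuous_on (cdom ?c) f" using continuous_on_cong[of "cdom ?c" "cdom ?c"] c(1) by simp
  then have "continuous (at p within cdom ?c) f" using c(2) by (simp add: continuous_on_eq_continuous_within)
  moreover have "at p within cdom ?c = at p within M"
  proof -
    obtain T where "open T" "cdom ?c = M \<inter> T" using cdom_open[OF c(1)] openin_open by metis
    then show ?thesis using c(2) by (intro at_within_nhd[of p T]) auto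
  qed
  ultimately show "continuous (at p within M) f" by simp
qed

lemma C_fun_measurable: "C_fun k A f \<Longrightarrow> f \<in> borel_measurable vol"
  using borel_measurable_continuous_on_restrict[OF C_fun_continuous]
    riem_volume_characterization measurable_cong_sets[of vol "restrict_space borel M" borel borel] by blast

lemma C_fun_integrable:
  assumes "C_fun k A f"
  shows "integrable vol f"
proof -
  have "bounded (f ` M)"
    by (intro compact_imp_bounded compact_continuous_image C_fun_continuous[OF assms] compact_M)
  then obtain b where "\<And>p. p \<in> M \<Longrightarrow> norm (f p) \<le> b" by (auto simp: bounded_iff)
  then show ?thesis
    by (intro finite_measure.integrable_const_bound[OF finite_measure_vol _ C_fun_measurable[OF assms], of b])
      (auto simp: space_vol)
qed

end

section \<open>The divergence theorem\<close>

lemma hopen_half_plane: "hopen half_plane"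
  by simp

lemma half_plane_add_axis: "x \<in> half_plane \<Longrightarrow> 0 \<le> t \<Longrightarrow> x + t *\<^sub>R axis i 1 \<in> half_plane"
  by (simp add: half_plane_def axis_def)

text \<open>
  The difference quotients of \<open>f\<close> along an axis have integral zero by translation invariance and
  converge boundedly to the partial derivative.
\<close>

lemma integral_partial_half_plane:
  fixes f :: "real^2 \<Rightarrow> real"
  assumes f: "C_k_on (Suc 0) half_plane f" and K: "compact K" "K \<subseteq> half_plane"
    and 0: "\<And>x. x \<notin> K \<Longrightarrow> f x = 0" and bdry: "\<And>x. i = 1 \<Longrightarrow> x $ 1 = 0 \<Longrightarrow> f x = 0"
  shows "integrable lborel (\<lambda>x. indicator half_plane x * partial_within half_plane i f x)"
    and "(\<integral>x. indicator half_plane x * partial_within half_plane i f x \<partial>lborel) = 0"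
proof -
  have out: "f x = 0" if "x \<notin> half_plane" for x using 0 K(2) that by blast
  define e :: "real^2" where "e = axis i 1"
  define P where "P = partial_within half_plane i f"
  have P0: "P x = 0" if "x \<in> half_plane" "x \<notin> K" for x
  proof -
    have o: "hopen (half_plane - K)"
      using compact_imp_closed[OF K(1)] by (auto simp: openin_open Diff_eq open_Compl)
    have "P x = partial_within (half_plane - K) i f x"
      unfolding P_def using that by (intro partial_within_subset hopen_half_plane o) auto
    also have "\<dots> = partial_within (half_plane - K) i (\<lambda>x. 0) x"
      using that 0 by (intro partial_within_cong) auto
    also have "\<dots> = 0" using that o by simp
    finally show ?thesis .
  qed
  have "continuous_on K P" using C_k_on_SucD(2)[OF f] K(2) unfolding P_def
    by (auto intro: continuous_on_subset)
  then have "bounded (P ` K)" using K(1) by (intro compact_imp_bounded compact_continuous_image)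
  then obtain b where b: "\<forall>x\<in>K. \<bar>P x\<bar> \<le> b" unfolding bounded_iff by auto
  \<comment> \<open>\<open>K\<close> may be empty, in which case \<open>b\<close> could be
    negative.\<close>
  define B where "B = max b 0"
  have B: "0 \<le> B" "\<And>x. x \<in> half_plane \<Longrightarrow> \<bar>P x\<bar> \<le> B"
    using b P0 by (force simp: B_def)+
  have deriv: "((\<lambda>t. f (x + t *\<^sub>R e)) has_real_derivative P (x + t *\<^sub>R e)) (at t within I)"
    if "x \<in> half_plane" "0 \<le> t" "\<And>s. s \<in> I \<Longrightarrow> 0 \<le> s" for x t I
    unfolding e_def P_def using that
    by (intro has_real_derivative_along_axis[OF hopen_half_plane C_k_on_SucD(1)[OF f]] half_plane_add_axis) auto
  have lip_in: "\<bar>f (x + t *\<^sub>R e) - f x\<bar> \<le> B * t" if x: "x \<in> half_plane" and t: "0 \<le> t" for x t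
  proof (cases "t = 0")
    case False
    with t have "0 < t" by simp
    have "((\<lambda>t. f (x + t *\<^sub>R e)) has_derivative (*) (P (x + s *\<^sub>R e))) (at s within {0..t})"
      if "0 \<le> s" "s \<le> t" for s
      using deriv[OF x that(1), of "{0..t}"] by (simp add: has_field_derivative_def)
    from mvt_simple[OF \<open>0 < t\<close> this]
    obtain s where s: "0 < s" "s < t" "f (x + t *\<^sub>R e) - f (x + 0 *\<^sub>R e) = P (x + s *\<^sub>R e) * (t - 0)" by auto
    have "\<bar>P (x + s *\<^sub>R e)\<bar> \<le> B" using B(2) half_plane_add_axis[OF x, of s] s by (simp add: e_def)
    then show ?thesis using s t by (simp add: abs_mult mult_right_mono)
  qed simp
  \<comment> \<open>Since \<open>f\<close> is zero outside the half plane, the bound must survive a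
    crossing of the boundary line. Steps along the second axis never cross it; along the first,
    \<open>bdry\<close> makes \<open>f\<close> vanish at the crossing.\<close>
  have lip: "\<bar>f (x + t *\<^sub>R e) - f x\<bar> \<le> B * t" if t: "0 \<le> t" for x t
  proof (cases "x \<in> half_plane \<or> x + t *\<^sub>R e \<notin> half_plane")
    case True
    then show ?thesis
    proof
      assume "x + t *\<^sub>R e \<notin> half_plane"
      moreover from this have "x \<notin> half_plane" using half_plane_add_axis[OF _ t] by (auto simp: e_def)
      ultimately show ?thesis using t B(1) by (simp add: out)
    qed (rule lip_in[OF _ t])
  next
    case False
    then have x: "x $ 1 < 0" "(x + t *\<^sub>R e) $ 1 \<ge> 0" by (auto simp: half_plane_def)
    then have i: "i = 1" by (cases "i = 1") (auto simp: e_def axis_def)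
    \<comment> \<open>The point at which the segment from \<open>x\<close> enters the half plane;
      only the part beyond it changes \<open>f\<close>.\<close>
    define y where "y = x + (- x $ 1) *\<^sub>R e"
    have y1: "y $ 1 = 0" by (simp add: y_def e_def i axis_def)
    have y: "y \<in> half_plane" "f y = 0" using y1 bdry[OF i] by (auto simp: half_plane_def)
    have xt: "x + t *\<^sub>R e = y + (t + x $ 1) *\<^sub>R e" by (simp add: y_def algebra_simps)
    have t': "0 \<le> t + x $ 1" using x(2) by (simp add: e_def i axis_def add.commute)
    have "f x = 0" using False out by blast
    then have "\<bar>f (x + t *\<^sub>R e) - f x\<bar> \<le> B * (t + x $ 1)" using lip_in[OF y(1) t'] y(2) xt by simp
    also have "\<dots> \<le> B * t" using x(1) B(1) by (intro mult_left_mono) auto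
    finally show ?thesis .
  qed
  obtain R where R: "\<And>x. x \<in> K \<Longrightarrow> norm x \<le> R" using compact_imp_bounded[OF K(1)] by (auto simp: bounded_iff)
  define \<delta> where "\<delta> n = inverse (real (Suc n))" for n
  have \<delta>: "0 < \<delta> n" "\<delta> n \<le> 1" for n by (auto simp: \<delta>_def inverse_le_1_iff)
  have \<delta>0: "\<delta> \<longlonglongrightarrow> 0" unfolding \<delta>_def by (rule LIMSEQ_inverse_real_of_nat)
  define s where "s n x = (f (x + \<delta> n *\<^sub>R e) - f x) / \<delta> n" for n x
  define D where "D x = indicator half_plane x * P x" for x
  have lim: "(\<lambda>n. s n x) \<longlonglongrightarrow> D x" for x
  proof (cases "x \<in> half_plane")
    case True
    have "((\<lambda>t. (f (x + t *\<^sub>R e) - f (x + 0 *\<^sub>R e)) / (t - 0)) \<longlongrightarrow> P (x + 0 *\<^sub>R e)) (at 0 within {0..})"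
      using deriv[OF True, of 0 "{0..}"] unfolding has_field_derivative_iff by simp
    \<comment> \<open>Positive steps make the quotients converge to the one-sided derivative, so
      points of the boundary line are included.\<close>
    moreover have "filterlim \<delta> (at 0 within {0..}) sequentially"
      unfolding filterlim_at using \<delta>0 \<delta> by (auto intro!: always_eventually simp: less_imp_le less_imp_neq[symmetric])
    ultimately have "(\<lambda>n. (f (x + \<delta> n *\<^sub>R e) - f (x + 0 *\<^sub>R e)) / (\<delta> n - 0)) \<longlonglongrightarrow> P (x + 0 *\<^sub>R e)"
      by (rule filterlim_compose)
    then show ?thesis using True by (simp add: s_def D_def)
  next
    case False
    have "(\<lambda>n. x + \<delta> n *\<^sub>R e) \<longlonglongrightarrow> x"
      using tendsto_add[OF tendsto_const tendsto_scaleR[OF \<delta>0 tendsto_const], of x e] by simp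
    then have "\<forall>\<^sub>F n in sequentially. x + \<delta> n *\<^sub>R e \<in> - half_plane"
      using False by (intro topological_tendstoD) (auto simp: closed_half_plane open_Compl)
    then have "\<forall>\<^sub>F n in sequentially. s n x = 0"
      by (rule eventually_mono) (use False in \<open>simp add: s_def out\<close>)
    then show ?thesis using False by (simp add: D_def tendsto_eventually)
  qed
  have half_borel: "half_plane \<in> sets borel" using closed_half_plane by simp
  have "(\<lambda>x. indicator half_plane x *\<^sub>R f x) \<in> borel_measurable borel"
    using C_k_on_continuous[OF f] half_borel by (intro borel_measurable_continuous_on_indicator)
  moreover have "(\<lambda>x. indicator half_plane x *\<^sub>R f x) = f"
    using out by (auto simp: fun_eq_iff indicator_def)
  ultimately have mf: "f \<in> borel_measurable borel" by simp
  have ms: "s n \<in> borel_measurable borel" for n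
    unfolding s_def using mf by measurable
  have mD: "D \<in> borel_measurable borel" by (rule borel_measurable_LIMSEQ_real[OF lim ms])
  \<comment> \<open>Radius \<open>R + 1\<close>, because the quotient at \<open>x\<close> also sees
    a point shifted by at most 1.\<close>
  have bound: "\<bar>s n x\<bar> \<le> B * indicator (cball 0 (R + 1)) x" for n x
  proof (cases "x \<in> cball 0 (R + 1)")
    case True
    have "\<bar>s n x\<bar> = \<bar>f (x + \<delta> n *\<^sub>R e) - f x\<bar> / \<delta> n" using \<delta>(1)[of n] by (simp add: s_def)
    also have "\<dots> \<le> B" using lip[of "\<delta> n" x] \<delta>(1)[of n] by (simp add: divide_le_eq)
    finally show ?thesis using True by simp
  next
    case False
    have "norm x \<le> norm (x + \<delta> n *\<^sub>R e) + norm (\<delta> n *\<^sub>R e)"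
      using norm_triangle_ineq4[of "x + \<delta> n *\<^sub>R e" "\<delta> n *\<^sub>R e"] by simp
    also have "norm (\<delta> n *\<^sub>R e) \<le> 1" using \<delta>[of n] by (simp add: e_def)
    finally have "x \<notin> K" "x + \<delta> n *\<^sub>R e \<notin> K" using R[of x] R[of "x + \<delta> n *\<^sub>R e"] False by auto
    then show ?thesis using 0 False by (simp add: s_def)
  qed
  have bi: "integrable lborel (\<lambda>x::real^2. B * indicator (cball 0 (R + 1)) x)"
    using emeasure_lborel_cball_finite[of "0::real^2" "R + 1"] by (auto intro!: integrable_real_indicator)
  have ae: "AE x in lborel. (\<lambda>n. s n x) \<longlonglongrightarrow> D x"
    "AE x in lborel. norm (s n x) \<le> B * indicator (cball 0 (R + 1)) x" for n
    using lim bound by auto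
  have mD': "D \<in> borel_measurable lborel" and ms': "\<And>n. s n \<in> borel_measurable lborel" using mD ms by auto
  have "bounded (f ` K)"
    using continuous_on_subset[OF C_k_on_continuous[OF f] K(2)] K(1)
    by (intro compact_imp_bounded compact_continuous_image)
  then obtain b' where b': "\<forall>x\<in>K. \<bar>f x\<bar> \<le> b'" unfolding bounded_iff by auto
  have intf: "integrable lborel f"
  proof (rule Bochner_Integration.integrable_bound[of lborel "\<lambda>x::real^2. b' * indicator (cball 0 R) x"])
    show "integrable lborel (\<lambda>x::real^2. b' * indicator (cball 0 R) x)"
      using emeasure_lborel_cball_finite[of "0::real^2" R] by (auto intro!: integrable_real_indicator)
    show "f \<in> borel_measurable lborel" using mf by simp
    have "norm (f x) \<le> norm (b' * indicator (cball 0 R) x)" for x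
    proof (cases "x \<in> K")
      case True
      then show ?thesis using R[OF True] b' by (force simp: indicator_def)
    qed (simp add: 0)
    then show "AE x in lborel. norm (f x) \<le> norm (b' * indicator (cball 0 R) x)" by simp
  qed
  show "integrable lborel (\<lambda>x. indicator half_plane x * partial_within half_plane i f x)"
    using integrable_dominated_convergence[OF mD' ms' bi ae] by (simp add: D_def[abs_def] P_def)
  have "(\<integral>x. s n x \<partial>lborel) = 0" for n
  proof -
    have "(\<integral>x. f (x + \<delta> n *\<^sub>R e) \<partial>lborel) = (\<integral>x. f x \<partial>distr lborel borel ((+) (\<delta> n *\<^sub>R e)))"
      using mf by (subst integral_distr) (auto simp: add.commute)
    also have "\<dots> = (\<integral>x. f x \<partial>lborel)" by (simp add: lborel_distr_plus)
    finally have eq: "(\<integral>x. f (x + \<delta> n *\<^sub>R e) \<partial>lborel) = (\<integral>x. f x \<partial>lborel)" .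
    have "integrable (distr lborel borel ((+) (\<delta> n *\<^sub>R e))) f" using intf by (simp add: lborel_distr_plus)
    then have "integrable lborel (\<lambda>x. f (\<delta> n *\<^sub>R e + x))" using mf by (subst (asm) integrable_distr_eq) auto
    then have "integrable lborel (\<lambda>x. f (x + \<delta> n *\<^sub>R e))" by (simp add: add.commute)
    then show ?thesis using intf eq by (simp add: s_def)
  qed
  then have "(\<lambda>n. 0) \<longlonglongrightarrow> (\<integral>x. D x \<partial>lborel)"
    using integral_dominated_convergence[OF mD' ms' bi ae] by simp
  then have "(\<integral>x. D x \<partial>lborel) = 0" using LIMSEQ_unique tendsto_const by blast
  then show "(\<integral>x. indicator half_plane x * partial_within half_plane i f x \<partial>lborel) = 0"
    by (simp add: D_def[abs_def] P_def)
qed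

text \<open>Extension by zero reduces this to the whole half plane: the extension is
  \<open>C^1\<close> on \<open>U\<close> and on the complement of \<open>K\<close>, and these cover
  the half plane. The boundary condition concerns the direction that crosses the boundary
  line.\<close>

lemma integral_partial_compact_support:
  fixes f :: "real^2 \<Rightarrow> real"
  assumes U: "hopen U" and f: "C_k_on (Suc 0) U f" and K: "compact K" "K \<subseteq> U"
    and 0: "\<And>x. x \<in> U \<Longrightarrow> x \<notin> K \<Longrightarrow> f x = 0"
    and bdry: "\<And>x. \<lbrakk>i = 1; x \<in> U; x $ 1 = 0\<rbrakk> \<Longrightarrow> f x = 0"
  shows "integrable lborel (\<lambda>x. indicator U x * partial_within U i f x)"
    and "(\<integral>x. indicator U x * partial_within U i f x \<partial>lborel) = 0"
proof -
  define h where "h x = (if x \<in> U then f x else 0)" for x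
  have UH: "U \<subseteq> half_plane" by (rule hopen_subset_half_plane[OF U])
  define T where "T = half_plane \<inter> - K"
  have T: "hopen T" unfolding T_def openin_open using compact_imp_closed[OF K(1)] by (auto simp: open_Compl)
  have hT: "h x = 0" if "x \<in> T" for x using that 0 by (auto simp: h_def T_def)
  have C: "C_k_on (Suc 0) half_plane h"
  proof (rule C_k_on_local[OF hopen_half_plane])
    fix x :: "real^2" assume x: "x \<in> half_plane"
    show "\<exists>S. hopen S \<and> x \<in> S \<and> S \<subseteq> half_plane \<and> C_k_on (Suc 0) S h"
    proof (cases "x \<in> U")
      case True
      have "C_k_on (Suc 0) U h" using f C_k_on_cong[of U h f "Suc 0"] by (simp only: h_def if_True)
      then show ?thesis using True U UH by blast
    next
      case False
      then have "x \<in> T" using x K(2) by (auto simp: T_def)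
      moreover have "C_k_on (Suc 0) T h"
        using C_k_on_const[OF T, of "Suc 0" 0] C_k_on_cong[of T h "\<lambda>_. 0" "Suc 0"] hT by blast
      ultimately show ?thesis using T by (auto simp: T_def)
    qed
  qed
  have eq: "indicator half_plane x * partial_within half_plane i h x = indicator U x * partial_within U i f x" for x
  proof (cases "x \<in> U")
    case True
    have "partial_within half_plane i h x = partial_within U i h x"
      using True UH by (intro partial_within_subset hopen_half_plane U) auto
    also have "\<dots> = partial_within U i f x" using True by (intro partial_within_cong) (auto simp: h_def)
    finally show ?thesis using True UH by (auto simp: indicator_def)
  next
    case False
    show ?thesis
    proof (cases "x \<in> half_plane")
      case True
      then have x: "x \<in> T" using False K(2) by (auto simp: T_def)
      have "partial_within half_plane i h x = partial_within T i h x"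
        using True x by (intro partial_within_subset hopen_half_plane T)
      also have "\<dots> = partial_within T i (\<lambda>x. 0) x" using x hT by (intro partial_within_cong) auto
      also have "\<dots> = 0" using x T by simp
      finally show ?thesis using False by simp
    qed (use False in simp)
  qed
  have h0: "h x = 0" if "x \<notin> K" for x using that 0 by (auto simp: h_def)
  have hb: "h x = 0" if "i = 1" "x $ 1 = 0" for x using that bdry by (auto simp: h_def)
  show "integrable lborel (\<lambda>x. indicator U x * partial_within U i f x)"
    unfolding eq[symmetric]
    by (rule integral_partial_half_plane(1)[OF C K(1) subset_trans[OF K(2) UH]]) (use h0 hb in auto)
  show "(\<integral>x. indicator U x * partial_within U i f x \<partial>lborel) = 0"
    unfolding eq[symmetric]
    by (rule integral_partial_half_plane(2)[OF C K(1) subset_trans[OF K(2) UH]]) (use h0 hb in auto)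
qed

section \<open>Cutoff functions and their supports\<close>

lemma pos_part_square_derivative:
  "((\<lambda>t::real. (max 0 t)\<^sup>2) has_real_derivative 2 * max 0 t) (at t)"
proof -
  consider "t > 0" | "t < 0" | "t = 0" by linarith
  then show ?thesis
  proof cases
    case 1
    have "((\<lambda>t::real. t\<^sup>2) has_real_derivative 2 * max 0 t) (at t)"
      using 1 by (auto intro!: derivative_eq_intros)
    then show ?thesis
      by (rule has_field_derivative_transform_within_open[where S="{0<..}"]) (use 1 in auto)
  next
    case 2
    have "((\<lambda>t::real. 0) has_real_derivative 2 * max 0 t) (at t)" using 2 by simp
    then show ?thesis
      by (rule has_field_derivative_transform_within_open[where S="{..<0}"]) (use 2 in auto)
  next
    case 3
    \<comment> \<open>At 0 the difference quotient is \<open>max 0 h\<close> itself; squaring makes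
      the positive part differentiable there.\<close>
    have "((\<lambda>h::real. max 0 h) \<longlongrightarrow> max 0 0) (at 0)" by (intro tendsto_intros)
    moreover have "\<forall>\<^sub>F h::real in at 0. (max 0 h)\<^sup>2 / h = max 0 h"
      by (auto simp: eventually_at_filter power2_eq_square max_def)
    ultimately have "((\<lambda>h::real. (max 0 h)\<^sup>2 / h) \<longlongrightarrow> 0) (at 0)"
      using tendsto_cong by fastforce
    then show ?thesis using 3 by (simp add: has_field_derivative_iff)
  qed
qed

lemma C_1_on_pos_part_square:
  fixes f :: "real^2 \<Rightarrow> real"
  assumes "hopen S" "C_k_on (Suc 0) S f"
  shows "C_k_on (Suc 0) S (\<lambda>x. (max 0 (f x))\<^sup>2)"
proof (rule C_k_on_SucI)
  note f = C_k_on_SucD[OF assms(2)]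
  fix x i assume x: "x \<in> S"
  show "(\<lambda>x. (max 0 (f x))\<^sup>2) differentiable (at x within S)"
    by (rule partial_within_compose_real(2)[OF assms(1) x f(1)[OF x] pos_part_square_derivative])
  show "partial_within S i (\<lambda>x. (max 0 (f x))\<^sup>2) x = 2 * max 0 (f x) * partial_within S i f x"
    by (rule partial_within_compose_real(1)[OF assms(1) x f(1)[OF x] pos_part_square_derivative])
next
  fix i
  have "continuous_on S f" "continuous_on S (partial_within S i f)"
    using C_k_on_continuous[OF assms(2)] C_k_on_SucD(2)[OF assms(2)] by auto
  then show "C_k_on 0 S (\<lambda>x. 2 * max 0 (f x) * partial_within S i f x)"
    by (auto intro!: continuous_intros)
qed

lemma dist_square_2: "(dist x y)\<^sup>2 = (y $ 1 - x $ 1) * (y $ 1 - x $ 1) + (y $ 2 - x $ 2) * (y $ 2 - x $ 2)"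
  for x y :: "real^2"
  by (simp add: dist_norm power2_norm_eq_inner inner_vec_def sum_2 algebra_simps)

context oriented_riemannian_surface
begin

lemma vec_deriv_eq_0:
  assumes U: "openin (top_of_set M) U" and p: "p \<in> U" and f: "\<And>q. q \<in> U \<Longrightarrow> f q = 0"
  shows "vec_deriv A X f p = 0"
proof -
  let ?c = "chart_at A p" and ?T = "cmap (chart_at A p) ` (cdom (chart_at A p) \<inter> U)"
  have "p \<in> M" using openin_imp_subset[OF U] p by blast
  note c = chart_at[OF this]
  have T: "hopen ?T" by (rule image_hopen[OF c(1) openin_Int[OF cdom_open[OF c(1)] U]]) simp
  have pT: "cmap ?c p \<in> ?T" using c p by blast
  have "cpartial ?c i f p = 0" for i
  proof -
    have "cpartial ?c i f p = partial_within ?T i (\<lambda>x. f (cinv ?c x)) (cmap ?c p)"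
      unfolding cpartial_altdef using pT c by (intro partial_within_subset cimg_hopen T) auto
    also have "\<dots> = partial_within ?T i (\<lambda>x. 0) (cmap ?c p)"
      by (rule partial_within_cong[OF pT]) (use f c in auto)
    also have "\<dots> = 0" using T pT by simp
    finally show ?thesis .
  qed
  then show ?thesis by (simp add: vec_deriv_def Let_def)
qed

text \<open>The divergence theorem puts one derivative on a cutoff, so \<open>C^1\<close> is the
  regularity aimed at. The squared distance is polynomial in the coordinates, and squaring its
  positive part joins it to zero in a \<open>C^1\<close> way.\<close>

definition bump :: "'a chart \<Rightarrow> 'a \<Rightarrow> real \<Rightarrow> 'a \<Rightarrow> real" where
  "bump c p r q = (if q \<in> cdom c then (max 0 (r\<^sup>2 - (dist (cmap c p) (cmap c q))\<^sup>2))\<^sup>2 else 0)"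

text \<open>Written as an image under \<open>cinv c\<close>, so that compactness is inherited from
  the half ball once the latter lies in the chart image.\<close>

definition chart_cball :: "'a chart \<Rightarrow> 'a \<Rightarrow> real \<Rightarrow> 'a set" where
  "chart_cball c p r = cinv c ` (cball (cmap c p) r \<inter> half_plane)"

lemma bump_nonneg: "0 \<le> bump c p r q"
  by (simp add: bump_def)

lemma bump_pos:
  assumes "q \<in> chart_ball c p r"
  shows "0 < bump c p r q"
proof -
  have "(dist (cmap c p) (cmap c q))\<^sup>2 < r\<^sup>2"
    using assms by (intro power_strict_mono) (auto simp: chart_ball_def)
  then show ?thesis using assms by (simp add: bump_def chart_ball_def)
qed

lemma chart_cball_subset:
  assumes "cball (cmap c p) r \<inter> half_plane \<subseteq> cimg c"
  shows "chart_cball c p r \<subseteq> cdom c"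
proof
  fix q assume "q \<in> chart_cball c p r"
  then obtain x where "x \<in> cball (cmap c p) r \<inter> half_plane" "q = cinv c x"
    unfolding chart_cball_def by blast
  then show "q \<in> cdom c" using assms cinv_in[of x c] by blast
qed

text \<open>The image of the compact half ball is compact, hence closed in the ambient Hausdorff
  space and not merely in the chart domain.\<close>

lemma chart_cball_compl_open:
  assumes c: "c \<in> A" and r: "cball (cmap c p) r \<inter> half_plane \<subseteq> cimg c"
  shows "openin (top_of_set M) (M - chart_cball c p r)"
proof -
  have "continuous_on (cball (cmap c p) r \<inter> half_plane) (cinv c)"
    using chart_homeomorphism[OF c] r by (auto simp: homeomorphism_def intro: continuous_on_subset)
  then have "compact (chart_cball c p r)" unfolding chart_cball_def
    by (intro compact_continuous_image compact_Int_closed closed_half_plane) auto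
  then have "open (- chart_cball c p r)" using compact_imp_closed by blast
  then show ?thesis by (auto simp: openin_open Diff_eq)
qed

lemma bump_eq_0:
  assumes c: "c \<in> A" and r: "0 < r" and q: "q \<notin> chart_cball c p r"
  shows "bump c p r q = 0"
proof (cases "q \<in> cdom c")
  case True
  have "cmap c q \<in> half_plane" using True hopen_subset_half_plane[OF cimg_hopen[OF c]] by blast
  moreover have "q = cinv c (cmap c q)" using True c by simp
  ultimately have "cmap c q \<notin> cball (cmap c p) r" using q unfolding chart_cball_def by blast
  then have "r\<^sup>2 \<le> (dist (cmap c p) (cmap c q))\<^sup>2" using r by (intro power_mono) auto
  then show ?thesis by (simp add: bump_def)
qed (simp add: bump_def)

text \<open>Around points of \<open>cdom c\<close> the bump is a function composed with a transition
  map. All other points lie in the open complement of \<open>chart_cball c p r\<close>, where the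
  bump is identically zero.\<close>

lemma C_fun_bump:
  assumes c: "c \<in> A" and r: "0 < r" "cball (cmap c p) r \<inter> half_plane \<subseteq> cimg c"
  shows "C_fun (Suc 0) A (bump c p r)"
proof (rule C_funI)
  fix d assume d: "d \<in> A"
  let ?B = "\<lambda>y. (max 0 (r\<^sup>2 - (dist (cmap c p) y)\<^sup>2))\<^sup>2"
  have B: "C_k_on (Suc 0) (cimg c) ?B"
    unfolding dist_square_2
    by (intro C_1_on_pos_part_square C_k_on_diff C_k_on_add C_k_on_mult C_k_on_const C_k_on_coordinate
        cimg_hopen c)
  show "C_chart (Suc 0) d (bump c p r)"
    unfolding C_chart_def
  proof (rule C_k_on_local[OF cimg_hopen[OF d]])
    fix x assume "x \<in> cimg d"
    then obtain q where q: "q \<in> cdom d" "x = cmap d q" by blast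
    show "\<exists>T. hopen T \<and> x \<in> T \<and> T \<subseteq> cimg d \<and> C_k_on (Suc 0) T (\<lambda>x. bump c p r (cinv d x))"
    proof (cases "q \<in> cdom c")
      case True
      let ?T = "cmap d ` (cdom d \<inter> cdom c)" and ?\<tau> = "cmap c \<circ> cinv d"
      have "C_k_on (Suc 0) ?T (\<lambda>x. ?B (?\<tau> x))"
        by (rule C_1_on_compose[OF overlap_hopen[OF d c] cimg_hopen[OF c] transition_image[OF d c]
              transition_C_k[OF d c] B])
      moreover have "?B (?\<tau> x) = bump c p r (cinv d x)" if "x \<in> ?T" for x
        using that d by (auto simp: bump_def)
      ultimately have "C_k_on (Suc 0) ?T (\<lambda>x. bump c p r (cinv d x))"
        using C_k_on_cong[of ?T "\<lambda>x. ?B (?\<tau> x)" "\<lambda>x. bump c p r (cinv d x)" "Suc 0"] by blast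
      then show ?thesis using q True by (intro exI[of _ ?T] conjI overlap_hopen d c) auto
    next
      case False
      let ?U = "cdom d \<inter> (M - chart_cball c p r)"
      have qU: "q \<in> ?U" using q False cdom_subset[OF d] chart_cball_subset[OF r(2)] by blast
      have T: "hopen (cmap d ` ?U)"
        by (rule image_hopen[OF d openin_Int[OF cdom_open[OF d] chart_cball_compl_open[OF c r(2)]]]) simp
      have "bump c p r (cinv d x) = 0" if "x \<in> cmap d ` ?U" for x
        using that d bump_eq_0[OF c r(1)] by auto
      then have "C_k_on (Suc 0) (cmap d ` ?U) (\<lambda>x. bump c p r (cinv d x))"
        using C_k_on_cong[of "cmap d ` ?U" "\<lambda>x. bump c p r (cinv d x)" "\<lambda>_. 0" "Suc 0"]
          C_k_on_const[OF T, of "Suc 0" 0] by blast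
      then show ?thesis using qU q T by (intro exI[of _ "cmap d ` ?U"] conjI) auto
    qed
  qed
qed

lemma tangent_to_bdryD: "tangent_to_bdry A X \<Longrightarrow> c \<in> A \<Longrightarrow> p \<in> cdom c \<Longrightarrow> cmap c p $ 1 = 0 \<Longrightarrow> X c p $ 1 = 0"
  unfolding tangent_to_bdry_def by blast

text \<open>In the chart the integrand is a sum of two partial derivatives of compactly supported
  functions. Tangency of \<open>X\<close> makes the first of these functions vanish on the boundary
  line, as the derivative across that line requires.\<close>

lemma integral_divergence_local:
  assumes c: "c \<in> A" and r: "0 < r" "cball (cmap c p) r \<inter> half_plane \<subseteq> cimg c"
    and \<phi>: "C_fun (Suc 0) A \<phi>" "\<And>q. q \<notin> chart_cball c p r \<Longrightarrow> \<phi> q = 0"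
    and X: "C_vfield (Suc 0) A X" "tangent_to_bdry A X"
  shows "(\<integral>q. divergence A g (\<lambda>c q. \<phi> q *\<^sub>R X c q) q \<partial>vol) = 0"
proof -
  let ?X = "\<lambda>c q. \<phi> q *\<^sub>R X c q" and ?R = "vol_density g c" and ?K = "cball (cmap c p) r \<inter> half_plane"
  have X': "C_vfield (Suc 0) A ?X" by (rule C_vfield_scale[OF \<phi>(1) X(1)])
  define W where "W i x = ?R (cinv c x) * ?X c (cinv c x) $ i" for i x
  have W: "C_k_on (Suc 0) (cimg c) (W i)" for i
    using C_chart_mult[OF c vol_density_C_chart[OF c] C_vfieldD(1)[OF X' c]] unfolding C_chart_def W_def .
  have K: "compact ?K" using closed_half_plane by (intro compact_Int_closed) auto
  have W0: "W i x = 0" if "x \<in> cimg c" "x \<notin> ?K" for i x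
  proof -
    have "cinv c x \<notin> chart_cball c p r"
    proof
      assume "cinv c x \<in> chart_cball c p r"
      then obtain y where y: "y \<in> ?K" "cinv c x = cinv c y" unfolding chart_cball_def by blast
      have "y \<in> cimg c" using y(1) r(2) by blast
      have "x = cmap c (cinv c x)" by (rule cmap_cinv[OF that(1), symmetric])
      also have "\<dots> = cmap c (cinv c y)" by (simp only: y(2))
      also have "\<dots> = y" by (rule cmap_cinv[OF \<open>y \<in> cimg c\<close>])
      finally show False using that(2) y(1) by blast
    qed
    then show ?thesis by (simp add: W_def \<phi>(2))
  qed
  have Wb: "W i x = 0" if "i = 1" "x \<in> cimg c" "x $ 1 = 0" for i x
    using tangent_to_bdryD[OF X(2) c cinv_in[OF that(2)]] that by (simp add: W_def)
  have int: "integrable lborel (\<lambda>x. indicator (cimg c) x * partial_within (cimg c) i (W i) x)"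
    "(\<integral>x. indicator (cimg c) x * partial_within (cimg c) i (W i) x \<partial>lborel) = 0" for i
    by (rule integral_partial_compact_support[OF cimg_hopen[OF c] W K r(2)]; use W0 Wb in blast)+
  \<comment> \<open>Off the chart both \<phi> and its derivative along \<open>X\<close> vanish,
    because \<phi> is zero on an open neighbourhood.\<close>
  have out: "divergence A g ?X q = 0" if "q \<in> M" "q \<notin> cdom c" for q
  proof -
    have q: "q \<in> M - chart_cball c p r" using that chart_cball_subset[OF r(2)] by blast
    have "vec_deriv A X \<phi> q = 0"
      by (rule vec_deriv_eq_0[OF chart_cball_compl_open[OF c r(2)] q]) (use \<phi>(2) in blast)
    then show ?thesis using divergence_scale[OF \<phi>(1) X(1) that(1)] \<phi>(2) q by simp
  qed
  have "(\<integral>q. divergence A g ?X q \<partial>vol)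
    = (\<integral>x. indicator (cimg c) x * (?R (cinv c x) * divergence A g ?X (cinv c x)) \<partial>lborel)"
    by (rule integral_chart[OF c C_fun_measurable[OF C_fun_divergence[OF X']] out])
  also have "\<dots> = (\<integral>x. indicator (cimg c) x * partial_within (cimg c) 1 (W 1) x
      + indicator (cimg c) x * partial_within (cimg c) 2 (W 2) x \<partial>lborel)"
  proof (rule Bochner_Integration.integral_cong[OF refl])
    fix x
    show "indicator (cimg c) x * (?R (cinv c x) * divergence A g ?X (cinv c x))
      = indicator (cimg c) x * partial_within (cimg c) 1 (W 1) x
      + indicator (cimg c) x * partial_within (cimg c) 2 (W 2) x"
    proof (cases "x \<in> cimg c")
      case True
      have "?R (cinv c x) \<noteq> 0" using vol_density_pos[OF c cinv_in[OF True]] by simp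
      then show ?thesis
        using True divergence_eq[OF c cinv_in[OF True] X'] by (simp add: cpartial_altdef W_def[abs_def])
    qed simp
  qed
  also have "\<dots> = 0" using int[of 1] int[of 2] by simp
  finally show ?thesis .
qed

text \<open>A \<open>C^1\<close> partition of unity built from bumps on coordinate balls splits
  \<open>X\<close> into pieces, each covered by \<open>integral_divergence_local\<close>.\<close>

theorem divergence_theorem:
  assumes X: "C_vfield (Suc 0) A X" "tangent_to_bdry A X"
  shows "(\<integral>p. divergence A g X p \<partial>vol) = 0"
proof -
  have "\<exists>r. p \<in> M \<longrightarrow> r > 0 \<and> cball (cmap (chart_at A p) p) r \<inter> half_plane \<subseteq> cimg (chart_at A p)" for p
    using chart_ball_radius chart_at by metis
  then obtain r where r: "\<And>p. p \<in> M \<Longrightarrow> r p > 0"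
    "\<And>p. p \<in> M \<Longrightarrow> cball (cmap (chart_at A p) p) (r p) \<inter> half_plane \<subseteq> cimg (chart_at A p)" by metis
  obtain F where F: "finite F" "F \<subseteq> M" "M = (\<Union>p\<in>F. chart_ball (chart_at A p) p (r p))"
    using finite_ball_cover[of r] r(1) by blast
  define \<beta> where "\<beta> p = bump (chart_at A p) p (r p)" for p
  have \<beta>: "C_fun (Suc 0) A (\<beta> p)" if "p \<in> F" for p
    unfolding \<beta>_def using that F(2) by (intro C_fun_bump chart_at r) auto
  define S where "S q = (\<Sum>p\<in>F. \<beta> p q)" for q
  have S_pos: "S q > 0" if q: "q \<in> M" for q
  proof -
    obtain p where p: "p \<in> F" "q \<in> chart_ball (chart_at A p) p (r p)" using F(3) q by blast
    have "0 < \<beta> p q" unfolding \<beta>_def by (rule bump_pos[OF p(2)])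
    also have "\<beta> p q \<le> S q" unfolding S_def
      by (rule member_le_sum[OF p(1)]) (auto simp: F(1) \<beta>_def bump_nonneg)
    finally show ?thesis .
  qed
  define \<phi> where "\<phi> p q = \<beta> p q / S q" for p q
  have \<phi>: "C_fun (Suc 0) A (\<phi> p)" if p: "p \<in> F" for p
  proof (rule C_funI)
    fix c assume c: "c \<in> A"
    have "C_chart (Suc 0) c S" unfolding S_def by (intro C_chart_sum c C_funD[OF \<beta>])
    moreover have "S q \<noteq> 0" if "q \<in> cdom c" for q using S_pos[of q] cdom_subset[OF c] that by auto
    ultimately show "C_chart (Suc 0) c (\<phi> p)"
      unfolding \<phi>_def by (intro C_chart_divide c C_funD[OF \<beta>[OF p]])
  qed
  have sum1: "(\<Sum>p\<in>F. \<phi> p q) = 1" if "q \<in> M" for q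
    using S_pos[OF that] by (simp add: \<phi>_def S_def flip: sum_divide_distrib)
  \<comment> \<open>The functions of the partition sum to the constant 1, so their derivatives
    cancel and the splitting creates no extra divergence.\<close>
  have zero: "(\<Sum>p\<in>F. vec_deriv A X (\<phi> p) q) = 0" if q: "q \<in> M" for q
  proof -
    let ?c = "chart_at A q"
    note c = chart_at[OF q]
    have "(\<Sum>p\<in>F. cpartial ?c i (\<phi> p) q) = 0" for i
    proof -
      have "(\<Sum>p\<in>F. cpartial ?c i (\<phi> p) q) = cpartial ?c i (\<lambda>q. \<Sum>p\<in>F. \<phi> p q) q"
        by (rule cpartial_sum[OF c, symmetric]) (rule C_funD[OF \<phi> c(1)])
      also have "\<dots> = cpartial ?c i (\<lambda>q. 1) q"
        by (rule cpartial_cong[OF c(2)]) (use sum1 cdom_subset[OF c(1)] in blast)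
      finally show ?thesis using c by simp
    qed
    then have "(\<Sum>i\<in>UNIV. X ?c q $ i * (\<Sum>p\<in>F. cpartial ?c i (\<phi> p) q)) = 0" by simp
    then show ?thesis
      unfolding vec_deriv_def Let_def sum_distrib_left by (subst sum.swap) simp
  qed
  have "(\<integral>q. divergence A g X q \<partial>vol) = (\<integral>q. (\<Sum>p\<in>F. divergence A g (\<lambda>c q. \<phi> p q *\<^sub>R X c q) q) \<partial>vol)"
  proof (rule Bochner_Integration.integral_cong[OF refl])
    fix q assume "q \<in> space vol"
    then have q: "q \<in> M" by (simp add: space_vol)
    have "(\<Sum>p\<in>F. divergence A g (\<lambda>c q. \<phi> p q *\<^sub>R X c q) q)
        = (\<Sum>p\<in>F. \<phi> p q * divergence A g X q + vec_deriv A X (\<phi> p) q)"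
      by (intro sum.cong refl divergence_scale[OF \<phi> X(1) q])
    also have "\<dots> = divergence A g X q"
      using zero[OF q] sum1[OF q] by (simp add: sum.distrib flip: sum_distrib_right)
    finally show "divergence A g X q = (\<Sum>p\<in>F. divergence A g (\<lambda>c q. \<phi> p q *\<^sub>R X c q) q)" ..
  qed
  also have "\<dots> = (\<Sum>p\<in>F. \<integral>q. divergence A g (\<lambda>c q. \<phi> p q *\<^sub>R X c q) q \<partial>vol)"
    by (rule Bochner_Integration.integral_sum)
      (rule C_fun_integrable[OF C_fun_divergence[OF C_vfield_scale[OF \<phi> X(1)]]])
  also have "\<dots> = 0"
  proof (intro sum.neutral ballI)
    fix p assume p: "p \<in> F"
    then have M: "p \<in> M" using F(2) by blast
    have "\<phi> p q = 0" if "q \<notin> chart_cball (chart_at A p) p (r p)" for q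
      using bump_eq_0[OF chart_at(1)[OF M] r(1)[OF M] that] by (simp add: \<phi>_def \<beta>_def)
    then show "(\<integral>q. divergence A g (\<lambda>c q. \<phi> p q *\<^sub>R X c q) q \<partial>vol) = 0"
      by (intro integral_divergence_local[OF chart_at(1)[OF M] r[OF M] \<phi>[OF p] _ X])
  qed
  finally show ?thesis .
qed

end

section \<open>Misiolek curvature of Arnold stable solutions\<close>

context oriented_riemannian_surface
begin

lemma C_vfield_of_vector_field:
  assumes "vector_field A X"
  shows "C_vfield k A X"
proof (rule C_vfieldI)
  fix c j assume c: "c \<in> A"
  have "C_k_on k (cimg c) (X c \<circ> cinv c)"
    using assms c unfolding vector_field_def smooth_on_def by blast
  from C_k_on_component[OF cimg_hopen[OF c] this, of j]
  show "C_chart k c (\<lambda>p. X c p $ j)" by (simp add: C_chart_def)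
next
  fix c d p assume "c \<in> A" "d \<in> A" "p \<in> cdom c" "p \<in> cdom d"
  then show "X d p = jacobian c d p *v X c p" using assms unfolding vector_field_def by blast
qed

text \<open>Tangency is asked of the product, which covers both applications: \<open>f\<close>
  vanishing on the boundary for Green's identity, and \<open>X\<close> tangent to it for transport
  by \<open>Y\<close>.\<close>

lemma integral_by_parts:
  assumes f: "C_fun (Suc 0) A f" and X: "C_vfield (Suc 0) A X"
    and t: "tangent_to_bdry A (\<lambda>c p. f p *\<^sub>R X c p)"
  shows "(\<integral>p. f p * divergence A g X p \<partial>vol) = - (\<integral>p. vec_deriv A X f p \<partial>vol)"
proof -
  have X0: "C_vfield 0 A X" using C_vfield_mono[OF X] by simp
  have f0: "C_fun 0 A f" using C_fun_mono[OF f] by simp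
  have "0 = (\<integral>p. divergence A g (\<lambda>c p. f p *\<^sub>R X c p) p \<partial>vol)"
    by (rule divergence_theorem[OF C_vfield_scale[OF f X] t, symmetric])
  also have "\<dots> = (\<integral>p. f p * divergence A g X p + vec_deriv A X f p \<partial>vol)"
    by (intro Bochner_Integration.integral_cong refl divergence_scale[OF f X]) (simp add: space_vol)
  also have "\<dots> = (\<integral>p. f p * divergence A g X p \<partial>vol) + (\<integral>p. vec_deriv A X f p \<partial>vol)"
    by (intro Bochner_Integration.integral_add C_fun_integrable[OF C_fun_mult[OF f0 C_fun_divergence[OF X]]]
        C_fun_integrable[OF C_fun_vec_deriv[OF X0 f]])
  finally show ?thesis by simp
qed

lemma tangent_to_bdry_scale:
  assumes "\<And>c p. \<lbrakk>c \<in> A; p \<in> cdom c; cmap c p $ 1 = 0\<rbrakk> \<Longrightarrow> f p = 0 \<or> X c p $ 1 = 0"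
  shows "tangent_to_bdry A (\<lambda>c p. f p *\<^sub>R X c p)"
  unfolding tangent_to_bdry_def using assms by auto

lemma green_identity:
  assumes f: "C_fun (Suc 0) A f" and h: "C_fun 2 A h" and 0: "\<And>p. p \<in> bdry A \<Longrightarrow> f p = 0"
  shows "(\<integral>p. f p * laplacian A g h p \<partial>vol) = - (\<integral>p. vec_deriv A (gradient g h) f p \<partial>vol)"
  unfolding laplacian_def
  by (intro integral_by_parts f C_vfield_gradient h[unfolded numeral_2_eq_2] tangent_to_bdry_scale disjI1 0)
    (auto simp: bdry_def)

text \<open>\<open>Y\<close> acts as a skew-adjoint operator: the divergence of \<open>f h Y\<close>
  is \<open>Y (f h)\<close>, and its integral is zero.\<close>

lemma integral_div_free_by_parts:
  assumes f: "C_fun (Suc 0) A f" and h: "C_fun (Suc 0) A h" and Y: "C_vfield (Suc 0) A Y"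
    and div: "div_free M A g Y" and t: "tangent_to_bdry A Y"
  shows "(\<integral>p. f p * vec_deriv A Y h p \<partial>vol) = - (\<integral>p. h p * vec_deriv A Y f p \<partial>vol)"
proof -
  have Y0: "C_vfield 0 A Y" using C_vfield_mono[OF Y] by simp
  have f0: "C_fun 0 A f" using C_fun_mono[OF f] by simp
  have h0: "C_fun 0 A h" using C_fun_mono[OF h] by simp
  have t': "tangent_to_bdry A (\<lambda>c p. (f p * h p) *\<^sub>R Y c p)"
    by (rule tangent_to_bdry_scale) (use tangent_to_bdryD[OF t] in blast)
  have prod: "vec_deriv A Y (\<lambda>p. f p * h p) p = f p * vec_deriv A Y h p + h p * vec_deriv A Y f p" if p: "p \<in> M" for p
  proof -
    note c = chart_at[OF p]
    show ?thesis
      using cpartial_mult[OF c C_funD[OF f c(1)] C_funD[OF h c(1)]]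
      by (simp add: vec_deriv_def Let_def sum_2 algebra_simps)
  qed
  have "(\<integral>p. (f p * h p) * divergence A g Y p \<partial>vol) = (\<integral>p. 0 \<partial>vol)"
    using div by (intro Bochner_Integration.integral_cong refl) (simp add: div_free_def space_vol)
  then have "0 = (\<integral>p. vec_deriv A Y (\<lambda>p. f p * h p) p \<partial>vol)"
    using integral_by_parts[OF C_fun_mult[OF f h] Y t'] by simp
  also have "\<dots> = (\<integral>p. f p * vec_deriv A Y h p + h p * vec_deriv A Y f p \<partial>vol)"
    by (intro Bochner_Integration.integral_cong refl prod) (simp add: space_vol)
  also have "\<dots> = (\<integral>p. f p * vec_deriv A Y h p \<partial>vol) + (\<integral>p. h p * vec_deriv A Y f p \<partial>vol)"
    by (intro Bochner_Integration.integral_add C_fun_integrable[OF C_fun_mult[OF f0 C_fun_vec_deriv[OF Y0 h]]]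
        C_fun_integrable[OF C_fun_mult[OF h0 C_fun_vec_deriv[OF Y0 f]]])
  finally show ?thesis by simp
qed

lemma dirichlet_nonneg:
  assumes p: "p \<in> M"
  shows "0 \<le> vec_deriv A (gradient g f) f p"
proof -
  let ?c = "chart_at A p"
  note c = chart_at[OF p]
  have "vec_deriv A (gradient g f) f p = gradient g f ?c p \<bullet> (g ?c p *v gradient g f ?c p)"
    unfolding metric_mult_gradient(1)[OF c] by (simp add: vec_deriv_def Let_def inner_vec_def)
  also have "\<dots> \<ge> 0"
    using metric_positive[OF c, of "gradient g f ?c p"] by (cases "gradient g f ?c p = 0") auto
  finally show ?thesis .
qed

text \<open>\<open>GREATEST\<close> yields a member of the set once a largest member exists. The set
  contains 0 by the sign of the Dirichlet integral, is bounded above by the Rayleigh quotient of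
  \<open>h\<close>, whence the assumption \<open>pos\<close>, and contains its supremum because each
  defining inequality is closed in \<open>l\<close>.\<close>

lemma first_eigenvalue_inequality:
  assumes h: "smooth_fun A h" and h0: "\<And>p. p \<in> bdry A \<Longrightarrow> h p = 0"
    and hm: "bdry A = {} \<Longrightarrow> (\<integral>p. h p \<partial>vol) = 0" and pos: "(\<integral>p. (h p)\<^sup>2 \<partial>vol) > 0"
  shows "(\<integral>p. h p * laplacian A g h p \<partial>vol) \<le> - first_eigenvalue M A g * (\<integral>p. (h p)\<^sup>2 \<partial>vol)"
proof -
  define adm where "adm f \<longleftrightarrow> smooth_fun A f \<and>
    (if bdry A = {} then (\<integral>p. f p \<partial>vol) = 0 else (\<forall>p\<in>bdry A. f p = 0))" for f
  define I where "I f = (\<integral>p. f p * laplacian A g f p \<partial>vol)" for f :: "'a \<Rightarrow> real"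
  define Q where "Q f = (\<integral>p. (f p)\<^sup>2 \<partial>vol)" for f :: "'a \<Rightarrow> real"
  define L where "L = {l. \<forall>f. adm f \<longrightarrow> I f \<le> - l * Q f}"
  have fe: "first_eigenvalue M A g = (GREATEST l. l \<in> L)"
    by (simp add: first_eigenvalue_def L_def adm_def I_def Q_def)
  have "adm h" using h h0 hm by (auto simp: adm_def)
  have "0 \<in> L"
  proof -
    have "I f \<le> 0" if f: "adm f" for f
    proof -
      have "C_fun k A f" for k using f by (simp add: adm_def smooth_fun_iff)
      moreover have "f p = 0" if "p \<in> bdry A" for p using f that by (auto simp: adm_def split: if_splits)
      ultimately have "I f = - (\<integral>p. vec_deriv A (gradient g f) f p \<partial>vol)"
        unfolding I_def by (intro green_identity)
      moreover have "0 \<le> (\<integral>p. vec_deriv A (gradient g f) f p \<partial>vol)"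
        by (intro Bochner_Integration.integral_nonneg dirichlet_nonneg) (simp add: space_vol)
      ultimately show ?thesis by simp
    qed
    then show ?thesis by (simp add: L_def)
  qed
  have bdd: "l \<le> - I h / Q h" if "l \<in> L" for l
  proof -
    have "I h \<le> - l * Q h" using that \<open>adm h\<close> by (simp add: L_def)
    then show ?thesis using pos by (subst pos_le_divide_eq) (auto simp: Q_def)
  qed
  have bddL: "bdd_above L" using bdd by (rule bdd_aboveI)
  have "\<forall>f. adm f \<longrightarrow> I f \<le> - Sup L * Q f"
  proof (intro allI impI)
    fix f assume f: "adm f"
    have "0 \<le> Q f" by (simp add: Q_def)
    show "I f \<le> - Sup L * Q f"
    proof (cases "Q f = 0")
      \<comment> \<open>With \<open>Q f = 0\<close> the constant drops out of the inequality, and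
        membership of 0 in \<open>L\<close> decides it.\<close>
      case True
      then show ?thesis using \<open>0 \<in> L\<close> f by (auto simp: L_def)
    next
      case False
      with \<open>0 \<le> Q f\<close> have "0 < Q f" by simp
      have "Sup L \<le> - I f / Q f"
      proof (intro cSup_least)
        fix l assume "l \<in> L"
        then have "I f \<le> - l * Q f" using f by (simp add: L_def)
        then show "l \<le> - I f / Q f" using \<open>0 < Q f\<close> by (subst pos_le_divide_eq) auto
      qed (use \<open>0 \<in> L\<close> in auto)
      then have "Sup L * Q f \<le> - I f" by (subst (asm) pos_le_divide_eq[OF \<open>0 < Q f\<close>])
      then show ?thesis by simp
    qed
  qed
  then have "Sup L \<in> L" unfolding L_def by blast
  then have "(GREATEST l. l \<in> L) = Sup L"
    by (intro Greatest_equality) (auto intro: cSup_upper bddL)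
  then have "first_eigenvalue M A g \<in> L" using \<open>Sup L \<in> L\<close> fe by simp
  then show ?thesis using \<open>adm h\<close> by (simp add: L_def I_def Q_def)
qed

text \<open>The second axis runs along the boundary line, where \<open>f\<close> is zero; a
  one-sided difference quotient is enough.\<close>

lemma cpartial_tangential:
  assumes c: "c \<in> A" and p: "p \<in> cdom c" "cmap c p $ 1 = 0" and f: "C_chart (Suc 0) c f"
    and 0: "\<And>q. q \<in> cdom c \<Longrightarrow> cmap c q $ 1 = 0 \<Longrightarrow> f q = 0"
  shows "cpartial c 2 f p = 0"
proof -
  let ?x = "cmap c p" and ?F = "\<lambda>x. f (cinv c x)"
  have x: "?x \<in> cimg c" using p(1) by blast
  obtain r where r: "r > 0"
    "\<And>s t. \<lbrakk>0 \<le> s; s < r; 0 \<le> t; t < r\<rbrakk> \<Longrightarrow> ?x + s *\<^sub>R axis 1 1 + t *\<^sub>R axis 2 1 \<in> cimg c"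
    using hopen_contains_segment[OF cimg_hopen[OF c] x] by blast
  have seg: "?x + t *\<^sub>R axis 2 1 \<in> cimg c" if "t \<in> {0..<r}" for t using r(2)[of 0 t] r(1) that by simp
  have zero: "?F (?x + t *\<^sub>R axis 2 1) = 0" if "t \<in> {0..<r}" for t
    by (rule 0[OF cinv_in[OF seg[OF that]]])
      (use p(2) cmap_cinv[OF seg[OF that]] in \<open>simp add: axis_def\<close>)
  have "((\<lambda>t. ?F (?x + t *\<^sub>R axis 2 1)) has_real_derivative partial_within (cimg c) 2 ?F ?x) (at 0 within {0..<r})"
    using has_real_derivative_along_axis[OF cimg_hopen[OF c], of ?F ?x 0 2 "{0..<r}"]
      C_chart_differentiable[OF f p(1)] seg by simp
  then have "((\<lambda>t. 0) has_real_derivative partial_within (cimg c) 2 ?F ?x) (at 0 within {0..<r})"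
    unfolding has_field_derivative_def
    by (rule has_derivative_transform[rotated 2]) (use r(1) zero in auto)
  moreover have at: "at 0 within {0..<r} = at_right 0"
    by (rule at_within_nhd[of 0 "{..<r}"]) (use r(1) in auto)
  ultimately have "((\<lambda>t::real. 0::real) \<longlongrightarrow> partial_within (cimg c) 2 ?F ?x) (at_right 0)"
    using at by (simp add: has_field_derivative_iff)
  then have "partial_within (cimg c) 2 ?F ?x = 0"
    using tendsto_unique[OF trivial_limit_at_right_real _ tendsto_const] by metis
  then show ?thesis by (simp add: cpartial_altdef)
qed

text \<open>On the boundary only the second component of \<open>Y\<close> survives, so only the
  tangential partial of \<open>f\<close> enters. The lemma is applied to \<psi> and then to
  \<open>h\<close>.\<close>

lemma vec_deriv_vanishes_on_bdry:
  assumes Y: "C_vfield k A Y" "tangent_to_bdry A Y" and f: "C_fun (Suc l) A f"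
    and t: "\<And>c p. \<lbrakk>c \<in> A; p \<in> cdom c; cmap c p $ 1 = 0\<rbrakk> \<Longrightarrow> cpartial c 2 f p = 0"
    and p: "p \<in> bdry A"
  shows "vec_deriv A Y f p = 0"
proof -
  obtain c where c: "c \<in> A" "p \<in> cdom c" "cmap c p $ 1 = 0" using p unfolding bdry_def by blast
  show ?thesis
    using vec_deriv_eq[OF c(1,2) Y(1) f] tangent_to_bdryD[OF Y(2) c] t[OF c] by simp
qed

lemma misiolek_curvature_formula:
  assumes \<psi>: "stream_function A g \<psi> u"
    and u: "tangent_to_bdry A u"
    and Y: "vector_field A Y" "div_free M A g Y" "tangent_to_bdry A Y"
  defines "h \<equiv> \<lambda>p. - vec_deriv A Y \<psi> p"
  shows "smooth_fun A h" and "p \<in> bdry A \<Longrightarrow> h p = 0" and "(\<integral>p. h p \<partial>vol) = 0"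
    and "misiolek_curvature M A g u Y
      = (\<integral>p. h p * laplacian A g h p \<partial>vol) + (\<integral>p. h p * vec_deriv A Y (laplacian A g \<psi>) p \<partial>vol)"
proof -
  note CY = C_vfield_of_vector_field[OF Y(1)]
  have C\<psi>: "C_fun k A \<psi>" for k using \<psi> by (simp add: stream_function_def smooth_fun_iff)
  have u_eq: "u c p = hodge_star g (gradient g \<psi>) c p" if "c \<in> A" "p \<in> cdom c" for c p
    using \<psi> that unfolding stream_function_def by metis
  have div: "divergence A g Y q = 0" if "q \<in> M" for q using Y(2) that by (simp add: div_free_def)
  have Cv: "C_fun k A (vec_deriv A Y \<psi>)" for k by (rule C_fun_vec_deriv[OF CY C\<psi>])
  have Ch: "C_fun k A h" for k
    unfolding h_def using C_chart_minus[OF _ C_funD[OF Cv]] by (blast intro: C_funI)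
  show "smooth_fun A h" using Ch by (simp add: smooth_fun_iff)
  \<comment> \<open>The first component of \<open>u\<close> is minus this partial over the volume
    density, and tangency makes it zero.\<close>
  have \<psi>2: "cpartial c 2 \<psi> p = 0" if "c \<in> A" "p \<in> cdom c" "cmap c p $ 1 = 0" for c p
    using tangent_to_bdryD[OF u that] u_eq[OF that(1,2)] hodge_star_gradient(1)[OF that(1,2), of \<psi>]
      vol_density_pos[OF that(1,2)] by simp
  have h0: "h p = 0" if "p \<in> bdry A" for p
  proof -
    have "vec_deriv A Y \<psi> p = 0"
      by (rule vec_deriv_vanishes_on_bdry[OF CY Y(3) C\<psi> _ that]) (rule \<psi>2)
    then show ?thesis by (simp add: h_def)
  qed
  show "p \<in> bdry A \<Longrightarrow> h p = 0" by (rule h0)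
  \<comment> \<open>Zero mean: skew-adjointness of \<open>Y\<close> moves the derivative onto the
    constant 1.\<close>
  have "(\<integral>p. 1 * vec_deriv A Y \<psi> p \<partial>vol) = - (\<integral>p. \<psi> p * vec_deriv A Y (\<lambda>p. 1) p \<partial>vol)"
    by (rule integral_div_free_by_parts[OF C_fun_const C\<psi> CY Y(2,3)])
  also have "\<dots> = - (\<integral>p. 0 \<partial>vol)"
    by (intro arg_cong[of _ _ uminus] Bochner_Integration.integral_cong refl)
      (simp add: vec_deriv_def Let_def chart_at space_vol)
  finally show "(\<integral>p. h p \<partial>vol) = 0" by (simp add: h_def)
  \<comment> \<open>\<open>h\<close> is zero along the boundary, hence so is its tangential partial;
    this makes \<open>k = Y h\<close> vanish there.\<close>
  have h2: "cpartial c 2 h p = 0" if "c \<in> A" "p \<in> cdom c" "cmap c p $ 1 = 0" for c p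
  proof (rule cpartial_tangential[OF that C_funD[OF Ch that(1)]])
    fix q assume "q \<in> cdom c" "cmap c q $ 1 = 0"
    then have "q \<in> bdry A" using that(1) unfolding bdry_def by blast
    then show "h q = 0" by (rule h0)
  qed
  define k where "k = vec_deriv A Y h"
  have Ck: "C_fun n A k" for n unfolding k_def by (rule C_fun_vec_deriv[OF CY Ch])
  have k0: "k p = 0" if "p \<in> bdry A" for p
    unfolding k_def by (rule vec_deriv_vanishes_on_bdry[OF CY Y(3) Ch _ that]) (rule h2)
  have b1: "lie_bracket u Y c p = hodge_star g (gradient g h) c p" if c: "c \<in> A" "p \<in> cdom c" for c p
  proof -
    have "lie_bracket Y u c p = hodge_star g (gradient g (vec_deriv A Y \<psi>)) c p"
      by (rule lie_bracket_hamiltonian[OF c CY _ C\<psi>]) (rule div u_eq[OF c(1)]; assumption)+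
    then have "lie_bracket u Y c p = - hodge_star g (gradient g (vec_deriv A Y \<psi>)) c p"
      unfolding lie_bracket_swap[of u] by simp
    moreover have "cpartial c i h p = - cpartial c i (vec_deriv A Y \<psi>) p" for i
      unfolding h_def by (rule cpartial_minus[OF c C_funD[OF Cv c(1)]])
    ultimately show ?thesis
      by (simp add: vec_eq_iff forall_2 hodge_star_gradient[OF c])
  qed
  have b2: "lie_bracket (lie_bracket u Y) Y c p = - hodge_star g (gradient g k) c p"
    if c: "c \<in> A" "p \<in> cdom c" for c p
  proof -
    have "lie_bracket Y (lie_bracket u Y) c p = hodge_star g (gradient g k) c p"
      unfolding k_def by (rule lie_bracket_hamiltonian[OF c CY _ Ch]) (rule div b1[OF c(1)]; assumption)+
    then show ?thesis unfolding lie_bracket_swap[of "lie_bracket u Y"] by simp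
  qed
  have m1: "metric_at A g (lie_bracket u Y) (lie_bracket u Y) p = vec_deriv A (gradient g h) h p" if p: "p \<in> M" for p
    using metric_hodge_star_gradient[OF chart_at[OF p], of h h] b1[OF chart_at[OF p]]
    by (simp add: metric_at_def vec_deriv_def Let_def sum_2)
  \<comment> \<open>The product of gradients is symmetric. It is read as the derivative of
    \<open>k\<close> along the gradient of \<psi>, so that Green's identity, with \<open>k\<close>
    zero on the boundary, produces the Laplacian of \<psi>.\<close>
  have m2: "metric_at A g (lie_bracket (lie_bracket u Y) Y) u p = - vec_deriv A (gradient g \<psi>) k p" if p: "p \<in> M" for p
  proof -
    note c = chart_at[OF p]
    have "hodge_star g (gradient g k) (chart_at A p) p \<bullet> (g (chart_at A p) p *v hodge_star g (gradient g \<psi>) (chart_at A p) p)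
      = vec_deriv A (gradient g \<psi>) k p"
      unfolding metric_hodge_star_gradient[OF c] vec_deriv_def Let_def sum_2 metric_mult_gradient(2,3)[OF c]
      by (simp add: field_simps add_divide_distrib diff_divide_distrib)
    then show ?thesis by (simp add: metric_at_def Let_def b2[OF c] u_eq[OF c])
  qed
  have L1: "L2_inner M A g (lie_bracket u Y) (lie_bracket u Y) = - (\<integral>p. h p * laplacian A g h p \<partial>vol)"
  proof -
    have "L2_inner M A g (lie_bracket u Y) (lie_bracket u Y) = (\<integral>p. vec_deriv A (gradient g h) h p \<partial>vol)"
      unfolding L2_inner_def by (intro Bochner_Integration.integral_cong refl m1) (simp add: space_vol)
    then show ?thesis using green_identity[OF Ch Ch h0] by simp
  qed
  have \<omega>: "C_fun n A (laplacian A g \<psi>)" for n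
    unfolding laplacian_def by (rule C_fun_divergence[OF C_vfield_gradient[OF C\<psi>]])
  have L2: "L2_inner M A g (lie_bracket (lie_bracket u Y) Y) u = - (\<integral>p. h p * vec_deriv A Y (laplacian A g \<psi>) p \<partial>vol)"
  proof -
    have "L2_inner M A g (lie_bracket (lie_bracket u Y) Y) u = (\<integral>p. - vec_deriv A (gradient g \<psi>) k p \<partial>vol)"
      unfolding L2_inner_def by (intro Bochner_Integration.integral_cong refl m2) (simp add: space_vol)
    also have "\<dots> = (\<integral>p. k p * laplacian A g \<psi> p \<partial>vol)"
      using green_identity[OF Ck C\<psi> k0] by simp
    also have "\<dots> = (\<integral>p. laplacian A g \<psi> p * vec_deriv A Y h p \<partial>vol)" by (simp add: k_def mult.commute)
    \<comment> \<open>Skew-adjointness of \<open>Y\<close> moves the derivative from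
      \<open>h\<close> to \<omega>.\<close>
    also have "\<dots> = - (\<integral>p. h p * vec_deriv A Y (laplacian A g \<psi>) p \<partial>vol)"
      by (rule integral_div_free_by_parts[OF \<omega> Ch CY Y(2,3)])
    finally show ?thesis .
  qed
  show "misiolek_curvature M A g u Y
      = (\<integral>p. h p * laplacian A g h p \<partial>vol) + (\<integral>p. h p * vec_deriv A Y (laplacian A g \<psi>) p \<partial>vol)"
    unfolding misiolek_curvature_def L1 L2 by simp
qed

lemma misiolek_curvature_nonpos:
  assumes u: "arnold_stable M A g u" and Y: "vector_field A Y" "div_free M A g Y" "tangent_to_bdry A Y"
  shows "misiolek_curvature M A g u Y \<le> 0"
proof -
  obtain \<psi> \<kappa> where \<psi>: "stream_function A g \<psi> u"
    and \<kappa>: "\<And>c p. c \<in> A \<Longrightarrow> p \<in> cdom c \<Longrightarrow>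
      gradient g (laplacian A g \<psi>) c p = \<kappa> p *\<^sub>R gradient g \<psi> c p"
    and cases: "(\<forall>p\<in>M. - first_eigenvalue M A g < \<kappa> p \<and> \<kappa> p < 0) \<or> (\<forall>p\<in>M. 0 < \<kappa> p)"
    using u unfolding arnold_stable_def by blast
  have ut: "tangent_to_bdry A u" using u by (simp add: arnold_stable_def stationary_solution_def)
  define h where "h p = - vec_deriv A Y \<psi> p" for p
  define \<omega> where "\<omega> = laplacian A g \<psi>"
  note F = misiolek_curvature_formula[OF \<psi> ut Y, folded h_def, folded \<omega>_def]
  have Ch: "C_fun k A h" for k using F(1) by (simp add: smooth_fun_iff)
  have C\<omega>: "C_fun k A \<omega>" for k
    unfolding \<omega>_def laplacian_def
    using \<psi> by (intro C_fun_divergence C_vfield_gradient) (simp add: stream_function_def smooth_fun_iff)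
  \<comment> \<open>Applying the metric to the collinearity of the gradients gives
    \<open>d\<omega> = \<kappa> d\<psi>\<close>, which is then paired with \<open>Y\<close>, using
    \<open>Y \<psi> = - h\<close>.\<close>
  have Y\<omega>: "vec_deriv A Y \<omega> p = - \<kappa> p * h p" if p: "p \<in> M" for p
  proof -
    note c = chart_at[OF p]
    have "(\<chi> i. cpartial (chart_at A p) i \<omega> p) = \<kappa> p *\<^sub>R (\<chi> i. cpartial (chart_at A p) i \<psi> p)"
      using \<kappa>[OF c] metric_mult_gradient(1)[OF c, of \<omega>] metric_mult_gradient(1)[OF c, of \<psi>]
      by (simp add: \<omega>_def matrix_vector_mult_scaleR)
    then show ?thesis
      by (simp add: vec_deriv_def Let_def h_def sum_2 vec_eq_iff forall_2 algebra_simps)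
  qed
  have int1: "integrable vol (\<lambda>p. h p * vec_deriv A Y \<omega> p)"
    by (rule C_fun_integrable[OF C_fun_mult[OF Ch C_fun_vec_deriv[OF C_vfield_of_vector_field[OF Y(1)] C\<omega>]]])
  have int2: "integrable vol (\<lambda>p. (h p)\<^sup>2)"
    using C_fun_integrable[OF C_fun_mult[OF Ch Ch]] by (simp add: power2_eq_square)
  have dirichlet: "(\<integral>p. h p * laplacian A g h p \<partial>vol) \<le> 0"
  proof -
    have "0 \<le> (\<integral>p. vec_deriv A (gradient g h) h p \<partial>vol)"
      by (intro Bochner_Integration.integral_nonneg dirichlet_nonneg) (simp add: space_vol)
    then show ?thesis using green_identity[OF Ch Ch F(2)] by simp
  qed
  have "0 \<le> (\<integral>p. (h p)\<^sup>2 \<partial>vol)" by simp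
  then have "(\<integral>p. (h p)\<^sup>2 \<partial>vol) = 0 \<or> (\<integral>p. (h p)\<^sup>2 \<partial>vol) > 0" by linarith
  \<comment> \<open>The third case is separate because \<open>first_eigenvalue_inequality\<close>
    asks for a test function of positive norm.\<close>
  then consider "\<forall>p\<in>M. 0 < \<kappa> p" | "\<forall>p\<in>M. - first_eigenvalue M A g < \<kappa> p" "(\<integral>p. (h p)\<^sup>2 \<partial>vol) > 0"
    | "(\<integral>p. (h p)\<^sup>2 \<partial>vol) = 0"
    using cases by blast
  then show ?thesis
  proof cases
    case 1
    have "0 \<le> (\<integral>p. - (h p * vec_deriv A Y \<omega> p) \<partial>vol)"
    proof (intro Bochner_Integration.integral_nonneg)
      fix p assume "p \<in> space vol"
      then have p: "p \<in> M" by (simp add: space_vol)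
      then have "0 \<le> \<kappa> p * (h p)\<^sup>2" using 1 by (intro mult_nonneg_nonneg) (auto simp: less_imp_le)
      then show "0 \<le> - (h p * vec_deriv A Y \<omega> p)"
        by (simp add: Y\<omega>[OF p] power2_eq_square algebra_simps)
    qed
    then show ?thesis using F(4) dirichlet by simp
  next
    case 2
    have "(\<integral>p. h p * vec_deriv A Y \<omega> p \<partial>vol) \<le> (\<integral>p. first_eigenvalue M A g * (h p)\<^sup>2 \<partial>vol)"
    proof (rule integral_mono[OF int1])
      show "integrable vol (\<lambda>p. first_eigenvalue M A g * (h p)\<^sup>2)" using int2 by simp
      fix p assume "p \<in> space vol"
      then have p: "p \<in> M" by (simp add: space_vol)
      then have "- \<kappa> p * (h p)\<^sup>2 \<le> first_eigenvalue M A g * (h p)\<^sup>2"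
        using 2(1) by (intro mult_right_mono) (auto simp: minus_le_iff less_imp_le)
      then show "h p * vec_deriv A Y \<omega> p \<le> first_eigenvalue M A g * (h p)\<^sup>2"
        by (simp add: Y\<omega>[OF p] power2_eq_square algebra_simps)
    qed
    also have "\<dots> = first_eigenvalue M A g * (\<integral>p. (h p)\<^sup>2 \<partial>vol)" by simp
    finally show ?thesis
      using first_eigenvalue_inequality[OF F(1,2,3) 2(2)] F(4) by simp
  next
    case 3
    \<comment> \<open>The term with \<open>Y \<omega>\<close> vanishes since \<open>h\<close> does
      almost everywhere, and the Dirichlet term has the right sign.\<close>
    then have "AE p in vol. (h p)\<^sup>2 = 0"
      using integral_nonneg_eq_0_iff_AE[OF int2] by simp
    then have "(\<integral>p. h p * vec_deriv A Y \<omega> p \<partial>vol) = (\<integral>p. 0 \<partial>vol)"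
      using int1 by (intro integral_cong_AE) (auto dest: borel_measurable_integrable)
    then show ?thesis using F(4) dirichlet by simp
  qed
qed

end

theorem theorem1p5:
  fixes M :: "'a::t2_space set"
    and A :: "'a chart set"
    and g :: "'a metric"
    and u Y :: "'a vec_field"
  assumes "compact M"
    and "oriented_atlas M A"
    and "riemannian_metric A g"
    and "H1_dR A = {exact_one_forms A} \<or> diffeomorphic M A annulus annulus_atlas"
    and "arnold_stable M A g u"
    and "vector_field A Y"
    and "div_free M A g Y"
    and "tangent_to_bdry A Y"
  shows "misiolek_curvature M A g u Y \<le> 0"
proof -
  interpret oriented_riemannian_surface M A g by unfold_locales (rule assms)+
  show ?thesis by (rule misiolek_curvature_nonpos[OF assms(5-8)])
qed

end
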